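(* Let $d\geq 3$ be odd and $p$ an odd prime such that $p\nmid d(d-1)$. Let $\lambda\in\mathbb{F}_p$, $\lambda\neq 0$, and $\alpha=\lambda^d(d-1)^{d-1}$. Put $$S:=\sum_{t\in\mathbb{F}_p}\phi(t(t-1))\;{_{d-1}G}_{d-1}\left[\begin{array}{c}\frac1d,\ \frac2d,\ \ldots,\ \frac{d-2}{d},\ \frac{d-1}{d}\\ \frac{1}{d-1},\ \frac{2}{d-1},\ \ldots,\ \frac{\frac{d-1}{2}-1}{d-1},\ \frac{\frac{d-1}{2}+1}{d-1},\ \ldots,\ \frac{d-2}{d-1},\ 0,\ 0\end{array}\Big|\ \alpha t\right],$$ where the $d-1$ upper parameters are all $h/d$ with $1\le h\le d-1$, and the $d-1$ lower parameters are the numbers $h/(d-1)$ with $1\le h\le d-2$, $h\ne\frac{d-1}{2}$, together with $0$ taken twice. Then $$p\,N_{\mathbb{F}_p}(Z_{\lambda})=p-1-S.$$ Hence $S\equiv p-1\pmod p$.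
   Context: $N_{\mathbb{F}_p}(Z_\lambda)$ is the number of points $[x_1:x_2]\in\mathbb{P}^1(\mathbb{F}_p)$ satisfying $x_1^d+x_2^d=d\lambda x_1x_2^{d-1}$. $\phi$ is the quadratic character on $\mathbb{F}_p$, with $\phi(0)=0$. McCarthy's $p$-adic hypergeometric series: $\Gamma_p:\mathbb{Z}_p\to\mathbb{Z}_p^\times$ is the $p$-adic gamma function, i.e. the unique continuous function with $\Gamma_p(0)=1$ and $\Gamma_p(n)=(-1)^n\prod_{0<j<n,\,p\nmid j}j$ for positive integers $n$. $\omega:\mathbb{F}_p^\times\to\mathbb{Z}_p^\times$ is the Teichmüller character ($\omega(a)$ is the $(p-1)$-th root of unity with $\omega(a)\equiv a \pmod p$) and $\overline{\omega}$ its inverse; all characters, including the trivial one $\overline\omega^0$, are extended to $\mathbb{F}_p$ by the value $0$ at $0$. $\lfloor x\rfloor$ is the floor and $\langle x\rangle=x-\lfloor x\rfloor$ the fractional part of $x\in\mathbb{Q}$. For an odd prime $p$, $t\in\mathbb{F}_p$, $n\ge 1$ and $a_i,b_i\in\mathbb{Q}\cap\mathbb{Z}_p$ ($1\le i\le n$), $${_nG}_n\left[\begin{array}{cccc}a_1,&a_2,&\ldots,&a_n\\ b_1,&b_2,&\ldots,&b_n\end{array}\Big|\ t\right]:=\frac{-1}{p-1}\sum_{j=0}^{p-2}(-1)^{jn}\,\overline{\omega}^j(t)\prod_{i=1}^n(-p)^{-\lfloor\langle a_i\rangle-\frac{j}{p-1}\rfloor-\lfloor\langle -b_i\rangle+\frac{j}{p-1}\rfloor}\frac{\Gamma_p(\langle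 a_i-\frac{j}{p-1}\rangle)}{\Gamma_p(\langle a_i\rangle)}\frac{\Gamma_p(\langle -b_i+\frac{j}{p-1}\rangle)}{\Gamma_p(\langle -b_i\rangle)}.$$ *)

theory Defs
  imports
    "HOL-Number_Theory.Number_Theory"
    "HOL-Computational_Algebra.Fraction_Field"
    "Berlekamp_Zassenhaus.Finite_Field"
begin

text \<open>
  Throughout, the prime \<open>p\<close> is \<open>CARD('p)\<close> for a type \<open>'p :: prime_card\<close>,
  and \<open>'p mod_ring\<close> is the field with \<open>p\<close> elements.
\<close>

section \<open>The ring of p-adic integers\<close>

text \<open>
  The inverse limit of the rings of integers modulo \<open>p ^ n\<close>; the \<open>n\<close>-th component is
  represented by its least nonnegative residue.
\<close>

typedef (overloaded) 'p padic_int =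
  "{x :: nat \<Rightarrow> int. \<forall>n. x n \<in> {0..<int CARD('p::prime_card) ^ n} \<and>
                        x (Suc n) mod int CARD('p) ^ n = x n}"
  morphisms padic_nth Abs_padic_int
  by (rule exI[of _ "\<lambda>_. 0"]) (simp add: prime_gt_0_nat prime_card)

setup_lifting type_definition_padic_int

lemma CARD_prime_pos [simp]: "0 < CARD('p::prime_card)"
  using prime_card[where 'a='p] by (simp add: prime_gt_0_nat)

lemma mod_pow_Suc_mod_pow: "(a mod int q ^ Suc n) mod int q ^ n = a mod int q ^ n"
  by (rule mod_mod_cancel) simp

instantiation padic_int :: (prime_card) comm_ring_1
begin

lift_definition zero_padic_int :: "'a padic_int" is "\<lambda>_. 0"
  by simp

lift_definition one_padic_int :: "'a padic_int" is "\<lambda>n. 1 mod int CARD('a) ^ n"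
  by (simp only: mod_pow_Suc_mod_pow) simp

lift_definition plus_padic_int :: "'a padic_int \<Rightarrow> 'a padic_int \<Rightarrow> 'a padic_int" is
  "\<lambda>x y n. (x n + y n) mod int CARD('a) ^ n"
  by (simp only: mod_pow_Suc_mod_pow) (auto, metis mod_add_eq)

lift_definition minus_padic_int :: "'a padic_int \<Rightarrow> 'a padic_int \<Rightarrow> 'a padic_int" is
  "\<lambda>x y n. (x n - y n) mod int CARD('a) ^ n"
  by (simp only: mod_pow_Suc_mod_pow) (auto, metis mod_diff_eq)

lift_definition uminus_padic_int :: "'a padic_int \<Rightarrow> 'a padic_int" is
  "\<lambda>x n. (- x n) mod int CARD('a) ^ n"
  by (simp only: mod_pow_Suc_mod_pow) (auto, metis mod_minus_eq)

lift_definition times_padic_int :: "'a padic_int \<Rightarrow> 'a padic_int \<Rightarrow> 'a padic_int" is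
  "\<lambda>x y n. (x n * y n) mod int CARD('a) ^ n"
  by (simp only: mod_pow_Suc_mod_pow) (auto, metis mod_mult_eq)

instance
proof
  fix a b c :: "'a padic_int"
  show "a + b + c = a + (b + c)"
    by transfer (simp add: fun_eq_iff mod_simps add.assoc)
  show "a + b = b + a"
    by transfer (simp add: add.commute)
  show "0 + a = a"
    by transfer (simp add: fun_eq_iff)
  show "- a + a = 0"
    by transfer (simp add: fun_eq_iff mod_simps)
  show "a - b = a + - b"
    by transfer (simp add: fun_eq_iff mod_simps)
  show "a * b * c = a * (b * c)"
    by transfer (simp add: fun_eq_iff mod_simps mult.assoc)
  show "a * b = b * a"
    by transfer (simp add: mult.commute)
  show "1 * a = a"
    by transfer (simp add: fun_eq_iff mod_simps)
  show "(a + b) * c = a * c + b * c"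
    by transfer (simp add: fun_eq_iff mod_simps distrib_right)
  have "1 < int CARD('a)"
    using prime_card[where 'a='a] prime_gt_1_nat by auto
  then show "(0 :: 'a padic_int) \<noteq> 1"
    by transfer (auto simp: fun_eq_iff intro!: exI[of _ 1])
qed

end

lemma padic_int_eq_iff: "x = y \<longleftrightarrow> (\<forall>n. padic_nth x n = padic_nth y n)"
  by (simp add: padic_nth_inject[symmetric] fun_eq_iff)

lemma padic_nth_range: "padic_nth (x :: 'p::prime_card padic_int) n \<in> {0..<int CARD('p) ^ n}"
  using padic_nth[of x] by blast

lemma padic_nth_mod:
  assumes "m \<le> n"
  shows "padic_nth (x :: 'p::prime_card padic_int) n mod int CARD('p) ^ m = padic_nth x m"
  using assms
proof (induction n rule: dec_induct)
  case base
  then show ?case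
    using padic_nth_range[of x m] by auto
next
  case (step n)
  have "padic_nth x (Suc n) mod int CARD('p) ^ m
      = (padic_nth x (Suc n) mod int CARD('p) ^ n) mod int CARD('p) ^ m"
    using step by (simp add: mod_mod_cancel le_imp_power_dvd)
  also have "padic_nth x (Suc n) mod int CARD('p) ^ n = padic_nth x n"
    using padic_nth[of x] by blast
  finally show ?case
    using step by simp
qed

lemma padic_nth_dvd_iff:
  "m \<le> n \<Longrightarrow> int CARD('p) ^ m dvd padic_nth (x :: 'p::prime_card padic_int) n \<longleftrightarrow> padic_nth x m = 0"
  using padic_nth_mod[of m n x] by (simp add: dvd_eq_mod_eq_0)

lemma padic_nth_of_nat:
  "padic_nth (of_nat k :: 'p::prime_card padic_int) n = int k mod int CARD('p) ^ n"
  by (induction k)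
     (simp_all add: zero_padic_int.rep_eq one_padic_int.rep_eq plus_padic_int.rep_eq mod_simps
        add.commute)

instance padic_int :: (prime_card) idom
proof
  fix x y :: "'a padic_int"
  let ?p = "int CARD('a)"
  assume "x \<noteq> 0" "y \<noteq> 0"
  then obtain m n where mn: "padic_nth x m \<noteq> 0" "padic_nth y n \<noteq> 0"
    by (auto simp: padic_int_eq_iff zero_padic_int.rep_eq)
  let ?a = "padic_nth x (m + n)" and ?b = "padic_nth y (m + n)"
  have p: "prime ?p"
    by (rule prime_card_int)
  have na: "\<not> ?p ^ m dvd ?a" and nb: "\<not> ?p ^ n dvd ?b"
    using mn padic_nth_dvd_iff[of m "m + n" x] padic_nth_dvd_iff[of n "m + n" y] by auto
  then have a0: "?a \<noteq> 0" and b0: "?b \<noteq> 0"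
    by auto
  have "multiplicity ?p ?a < m" "multiplicity ?p ?b < n"
    using na nb by (meson multiplicity_dvd' not_le)+
  moreover have "multiplicity ?p (?a * ?b) = multiplicity ?p ?a + multiplicity ?p ?b"
    using p a0 b0 by (intro prime_elem_multiplicity_mult_distrib) auto
  ultimately have "\<not> ?p ^ (m + n) dvd ?a * ?b"
    using p a0 b0 by (subst power_dvd_iff_le_multiplicity) auto
  then have "padic_nth (x * y) (m + n) \<noteq> 0"
    by (simp add: times_padic_int.rep_eq dvd_eq_mod_eq_0)
  then show "x * y \<noteq> 0"
    by (auto simp: zero_padic_int.rep_eq)
qed

instance padic_int :: (prime_card) ring_char_0
proof
  show "inj (of_nat :: nat \<Rightarrow> 'a padic_int)"
  proof (rule injI)
    fix a b :: nat
    assume eq: "(of_nat a :: 'a padic_int) = of_nat b"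
    have p: "1 < CARD('a)"
      using prime_card[where 'a='a] prime_gt_1_nat by auto
    define n where "n = max a b"
    have "n < CARD('a) ^ n"
      using p by (intro power_gt_expt) simp
    then have "a < CARD('a) ^ n" "b < CARD('a) ^ n"
      unfolding n_def by linarith+
    then have "int a < int CARD('a) ^ n" "int b < int CARD('a) ^ n"
      by (simp_all flip: of_nat_power)
    moreover have "int a mod int CARD('a) ^ n = int b mod int CARD('a) ^ n"
      using eq by (metis padic_nth_of_nat)
    ultimately show "a = b"
      by simp
  qed
qed

section \<open>The p-adic metric\<close>

definition padic_norm :: "'p::prime_card padic_int \<Rightarrow> real" where
  "padic_norm x =
     (if x = 0 then 0 else 1 / real CARD('p) ^ Max {n. padic_nth x n = 0})"

lemma padic_norm_le_iff:
  fixes x :: "'p::prime_card padic_int"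
  shows "padic_norm x \<le> 1 / real CARD('p) ^ m \<longleftrightarrow> padic_nth x m = 0"
proof (cases "x = 0")
  case True
  then show ?thesis
    by (simp add: padic_norm_def zero_padic_int.rep_eq)
next
  case False
  let ?A = "{n. padic_nth x n = 0}"
  have mono: "padic_nth x k = 0" if "padic_nth x l = 0" "k \<le> l" for k l
    using padic_nth_mod[OF that(2), of x] that(1) by simp
  from False obtain N where "padic_nth x N \<noteq> 0"
    by (auto simp: padic_int_eq_iff zero_padic_int.rep_eq)
  then have "?A \<subseteq> {..N}"
    using mono[where k=N] nat_le_linear by blast
  then have fin: "finite ?A"
    by (rule finite_subset) simp
  have zero: "0 \<in> ?A"
    using padic_nth_range[of x 0] by simp
  have Max: "Max ?A \<in> ?A"
    using fin zero by (intro Max_in) auto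
  have p: "1 < real CARD('p)"
    using prime_card[where 'a='p] prime_gt_1_nat by auto
  have "padic_norm x \<le> 1 / real CARD('p) ^ m \<longleftrightarrow> m \<le> Max ?A"
    using False p by (simp add: padic_norm_def divide_simps)
  also have "\<dots> \<longleftrightarrow> padic_nth x m = 0"
  proof
    assume "m \<le> Max ?A"
    with Max show "padic_nth x m = 0"
      using mono by blast
  next
    assume "padic_nth x m = 0"
    with fin show "m \<le> Max ?A"
      by (intro Max_ge) simp_all
  qed
  finally show ?thesis .
qed

lemma padic_norm_eq_0_iff [simp]: "padic_norm x = 0 \<longleftrightarrow> x = 0"
  by (simp add: padic_norm_def)

lemma padic_norm_nonneg [simp]: "0 \<le> padic_norm x"
  by (simp add: padic_norm_def)

lemma padic_norm_diff_le:
  fixes x y :: "'p::prime_card padic_int"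
  shows "padic_norm (x - y) \<le> max (padic_norm x) (padic_norm y)"
proof -
  have *: "padic_norm (x - y) \<le> 1 / real CARD('p) ^ m"
    if "padic_norm x \<le> 1 / real CARD('p) ^ m" "padic_norm y \<le> 1 / real CARD('p) ^ m" for m
    using that by (simp add: padic_norm_le_iff minus_padic_int.rep_eq)
  have uminus: "padic_norm (- y) = padic_norm y"
  proof -
    have "padic_nth (- y) n = 0 \<longleftrightarrow> padic_nth y n = 0" for n
    proof -
      have "padic_nth (- y) n = 0 \<longleftrightarrow> int CARD('p) ^ n dvd padic_nth y n"
        by (simp add: uminus_padic_int.rep_eq flip: dvd_eq_mod_eq_0)
      then show ?thesis
        by (simp add: padic_nth_dvd_iff)
    qed
    then show ?thesis
      by (simp add: padic_norm_def)
  qed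
  consider "x = 0" | "y = 0" | "x \<noteq> 0" "y \<noteq> 0"
    by blast
  then show ?thesis
  proof cases
    case 3
    then obtain k l where kl: "padic_norm x = 1 / real CARD('p) ^ k"
        "padic_norm y = 1 / real CARD('p) ^ l"
      using that unfolding padic_norm_def if_not_P[OF 3(1)] if_not_P[OF 3(2)] by blast
    show ?thesis
    proof (cases "padic_norm x \<le> padic_norm y")
      case True
      then show ?thesis
        using *[of l] kl(2) by simp
    next
      case False
      then show ?thesis
        using *[of k] kl(1) by simp
    qed
  qed (use uminus in auto)
qed

instantiation padic_int :: (prime_card) metric_space
begin

definition dist_padic_int :: "'a padic_int \<Rightarrow> 'a padic_int \<Rightarrow> real" where
  "dist_padic_int x y = padic_norm (x - y)"

definition uniformity_padic_int :: "('a padic_int \<times> 'a padic_int) filter" where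
  "uniformity_padic_int = (INF e\<in>{0<..}. principal {(x, y). dist x y < e})"

definition open_padic_int :: "'a padic_int set \<Rightarrow> bool" where
  "open_padic_int U \<longleftrightarrow> (\<forall>x\<in>U. eventually (\<lambda>(x', y). x' = x \<longrightarrow> y \<in> U) uniformity)"

instance
proof
  fix x y z :: "'a padic_int"
  show "dist x y = 0 \<longleftrightarrow> x = y"
    by (simp add: dist_padic_int_def)
  have "padic_norm ((x - z) - (y - z)) \<le> max (padic_norm (x - z)) (padic_norm (y - z))"
    by (rule padic_norm_diff_le)
  also have "\<dots> \<le> padic_norm (x - z) + padic_norm (y - z)"
    by simp
  finally show "dist x y \<le> dist x z + dist y z"
    by (simp add: dist_padic_int_def)
qed (simp_all add: uniformity_padic_int_def open_padic_int_def)

end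

section \<open>The field of p-adic numbers\<close>

instance fract :: ("{idom, ring_char_0}") field_char_0
proof
  show "inj (of_nat :: nat \<Rightarrow> 'a fract)"
    by (rule injI) (simp add: Fraction_Field.of_nat_fract Fraction_Field.eq_fract)
qed

type_synonym 'p padic = "'p padic_int fract"

abbreviation padic_of_int :: "'p::prime_card padic_int \<Rightarrow> 'p padic" where
  "padic_of_int x \<equiv> Fraction_Field.Fract x 1"

text \<open>
  The inclusion of the rationals with denominator prime to \<open>p\<close> into the p-adic integers;
  unspecified for the other rationals.
\<close>

definition padic_int_of_rat :: "rat \<Rightarrow> 'p::prime_card padic_int" where
  "padic_int_of_rat r = (THE x. padic_of_int x = of_rat r)"

text \<open>Both sides are p-adic integers, and their difference is \<open>m\<close> times a p-adic integer.\<close>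

definition padic_cong :: "'p::prime_card padic \<Rightarrow> 'p padic \<Rightarrow> nat \<Rightarrow> bool" where
  "padic_cong x y m \<longleftrightarrow>
     (\<exists>a b. x = padic_of_int a \<and> y = padic_of_int b \<and> of_nat m dvd a - b)"

section \<open>The p-adic gamma function and the Teichmueller character\<close>

definition padic_Gamma :: "'p::prime_card padic_int \<Rightarrow> 'p padic_int" where
  "padic_Gamma = (THE f. continuous_on UNIV f \<and> (\<forall>x. f x dvd 1) \<and> f 0 = 1 \<and>
     (\<forall>n::nat. n > 0 \<longrightarrow>
        f (of_nat n) = (-1) ^ n * (\<Prod>j | 0 < j \<and> j < n \<and> \<not> CARD('p) dvd j. of_nat j)))"

definition padic_residue :: "'p::prime_card padic_int \<Rightarrow> 'p mod_ring" where
  "padic_residue x = of_int_mod_ring (padic_nth x 1)"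

text \<open>Only meaningful for \<open>a \<noteq> 0\<close>.\<close>

definition teichmuller :: "'p::prime_card mod_ring \<Rightarrow> 'p padic_int" where
  "teichmuller a = (THE x. x ^ (CARD('p) - 1) = 1 \<and> padic_residue x = a)"

text \<open>
  The \<open>j\<close>-th power of the inverse of the Teichmueller character. Its value at 0 is 0 for every
  \<open>j\<close>, including \<open>j = 0\<close>.
\<close>

definition teichmuller_bar_pow :: "nat \<Rightarrow> 'p::prime_card mod_ring \<Rightarrow> 'p padic" where
  "teichmuller_bar_pow j t =
     (if t = 0 then 0 else inverse (padic_of_int (teichmuller t)) ^ j)"

definition quadratic_char :: "'p::prime_card mod_ring \<Rightarrow> int" where
  "quadratic_char x = Legendre (to_int_mod_ring x) (int CARD('p))"

section \<open>McCarthy's p-adic hypergeometric series\<close>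

definition padic_Gamma_rat :: "rat \<Rightarrow> 'p::prime_card padic" where
  "padic_Gamma_rat r = padic_of_int (padic_Gamma (padic_int_of_rat r))"

text \<open>
  The two lists of parameters, here \<open>as\<close> and \<open>bs\<close>, are meant to have the same length.
  The fractional part \<open>\<langle>x\<rangle>\<close> is \<open>frac x\<close>.
\<close>

definition padic_G :: "rat list \<Rightarrow> rat list \<Rightarrow> 'p::prime_card mod_ring \<Rightarrow> 'p padic" where
  "padic_G as bs t =
     - 1 / (of_nat CARD('p) - 1) *
     (\<Sum>j = 0..CARD('p) - 2.
        (-1) ^ (j * length as) * teichmuller_bar_pow j t *
        (\<Prod>i<length as.
           let a = as ! i; b = bs ! i; u = of_nat j / of_nat (CARD('p) - 1) in
           (- of_nat CARD('p)) powi (- \<lfloor>frac a - u\<rfloor> - \<lfloor>frac (- b) + u\<rfloor>) *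
           (padic_Gamma_rat (frac (a - u)) / padic_Gamma_rat (frac a)) *
           (padic_Gamma_rat (frac (- b + u)) / padic_Gamma_rat (frac (- b)))))"

section \<open>Points on the variety\<close>

definition proj_rel :: "(('a::field \<times> 'a) \<times> ('a \<times> 'a)) set" where
  "proj_rel = {((x1, x2), (y1, y2)). (x1, x2) \<noteq> (0, 0) \<and> (y1, y2) \<noteq> (0, 0) \<and>
                 (\<exists>c. c \<noteq> 0 \<and> y1 = c * x1 \<and> y2 = c * x2)}"

definition proj_line :: "('a::field \<times> 'a) set set" where
  "proj_line = (UNIV - {(0, 0)}) // proj_rel"

text \<open>
  The equation is homogeneous, so it holds for one representative of a point if and only if it
  holds for all of them.
\<close>

definition num_points_Z :: "nat \<Rightarrow> 'p::prime_card mod_ring \<Rightarrow> nat" where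
  "num_points_Z d l = card {P \<in> proj_line.
     \<exists>x1 x2. (x1, x2) \<in> P \<and> x1 ^ d + x2 ^ d = of_nat d * l * x1 * x2 ^ (d - 1)}"

end

theory Submission
  imports
    Defs
    "HOL-Computational_Algebra.Polynomial_Factorial"
    "HOL-Computational_Algebra.Formal_Laurent_Series"
begin

text \<open>
  Dehomogenising and substituting turns the points into the solutions \<open>y\<close> of
  \<open>(d \<lambda>)\<^sup>d y (1 - y)\<^sup>d\<^sup>-\<^sup>1 = 1\<close>, so that \<open>(p - 1) N\<close> is a sum over the characters \<open>\<omega>\<^sup>-\<^sup>j\<close> of Jacobi sums
  \<open>J(\<omega>\<^sup>-\<^sup>j, \<omega>\<^sup>-\<^sup>(\<^sup>d\<^sup>-\<^sup>1\<^sup>)\<^sup>j)\<close>. In \<open>S\<close> the sum over \<open>t\<close> is a Jacobi sum of \<open>\<phi> \<omega>\<^sup>-\<^sup>j\<close> and \<open>\<phi>\<close>, and the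
  multiplication formula for the p-adic gamma function collapses the products over the parameters. The
  \<open>j\<close>-th terms of both sides are then compared through the Gross-Koblitz formula for Jacobi sums.

  That formula is proved by Dwork's method with \<open>E(y) = exp(y + y\<^sup>p / p) = \<Sum> b\<^sub>n y\<^sup>n\<close>. Expanding
  \<open>exp y = E(y) exp(- y\<^sup>p / p)\<close> gives \<open>\<Gamma>\<^sub>p(- a - p z) = \<Sum>\<^sub>j b\<^bsub>a + p j\<^esub> (- p)\<^sup>j z (z - 1) \<dots> (z - j + 1)\<close>, whose Mahler
  coefficients also bound the denominators of the \<open>b\<^sub>n\<close>. At \<open>z = - a / (p - 1)\<close> the right-hand side is the
  eigenvalue of a Frobenius operator on a one-dimensional cohomology group, hence \<open>1 - p\<close> times the trace
  of that operator, and the trace is the value of \<open>E\<close> that occurs in a Gauss sum. Finally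
  \<open>E(\<zeta>\<^sub>1 y) E(\<zeta>\<^sub>2 y) = E(\<zeta>\<^sub>3 y) exp(z (p y + y\<^sup>p))\<close> when \<open>\<zeta>\<^sub>1 + \<zeta>\<^sub>2 = \<zeta>\<^sub>3 + p z\<close> for Teichmueller representatives
  \<open>\<zeta>\<^sub>i\<close>, and the last factor is \<open>1\<close> modulo \<open>y\<^sup>p\<^sup>-\<^sup>1 + p\<close>; this additivity yields the Jacobi sums.
\<close>

section \<open>Congruences in the p-adic integers\<close>

text \<open>The obstacle is the size of the \<open>b_n\<close>. The truncation estimates rest on
  \<open>b_n (- p)^(n div p)\<close> tending to 0, so the valuation of \<open>b_n\<close> must have
  a slope above -1 in \<open>j = n div p\<close>. The \<open>j\<close>-th Mahler coefficient of
  gamma is \<open>b_n (- p)^j j!\<close>, and dividing by \<open>(- p)^j j!\<close> costs up to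
  \<open>j + j / (p - 1)\<close>, which is bounded by \<open>3 j / 2\<close> with
  \<open>p = 3\<close> as the worst case. So the \<open>j\<close>-th difference of gamma has to gain
  more than \<open>j / 2\<close>. The functional equation with the obvious congruences modulo
  \<open>p\<close> gains exactly \<open>1 / 2\<close> per step, just too little for
  \<open>p = 3\<close>. Because the inverses of the nonzero residues sum to 0, one of these
  congruences holds modulo \<open>p^2\<close>, and the gain becomes \<open>2 / 3\<close>. This gives
  the slope \<open>2 / 3 - 3 / 2 = - 5 / 6\<close>, and the remaining \<open>1 / 6\<close> is the
  source of the factors 6 in the truncation points.

  The map taking \<open>s\<close> to \<open>E(\<omega>(s) y)\<close> stands in for an additive
  character. Only its additivity modulo \<open>y^(p-1) + p\<close> is used, so no p-th root of unity
  has to be constructed.\<close>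

lemma CARD_prime_gt_1: "1 < CARD('p::prime_card)"
  using prime_card[where 'a='p] prime_gt_1_nat by auto

lemma padic_nth_mult_cong:
  fixes x x' y y' :: "'p::prime_card padic_int"
  shows "padic_nth x k = padic_nth x' k \<Longrightarrow> padic_nth y k = padic_nth y' k \<Longrightarrow>
    padic_nth (x * y) k = padic_nth (x' * y') k"
  by (simp add: times_padic_int.rep_eq)

lemma padic_nth_add_cong:
  fixes x x' y y' :: "'p::prime_card padic_int"
  shows "padic_nth x k = padic_nth x' k \<Longrightarrow> padic_nth y k = padic_nth y' k \<Longrightarrow>
    padic_nth (x + y) k = padic_nth (x' + y') k"
  by (simp add: plus_padic_int.rep_eq)

lemma padic_nth_diff_cong:
  fixes x x' y y' :: "'p::prime_card padic_int"
  shows "padic_nth x k = padic_nth x' k \<Longrightarrow> padic_nth y k = padic_nth y' k \<Longrightarrow>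
    padic_nth (x - y) k = padic_nth (x' - y') k"
  by (simp add: minus_padic_int.rep_eq)

lemma padic_nth_uminus_cong:
  fixes x x' :: "'p::prime_card padic_int"
  shows "padic_nth x k = padic_nth x' k \<Longrightarrow> padic_nth (- x) k = padic_nth (- x') k"
  by (simp add: uminus_padic_int.rep_eq)

lemma padic_nth_power_cong:
  fixes x x' :: "'p::prime_card padic_int"
  shows "padic_nth x k = padic_nth x' k \<Longrightarrow> padic_nth (x ^ n) k = padic_nth (x' ^ n) k"
  by (induction n) (auto intro: padic_nth_mult_cong)

lemma padic_nth_prod_cong:
  fixes f g :: "'a \<Rightarrow> 'p::prime_card padic_int"
  shows "(\<And>i. i \<in> A \<Longrightarrow> padic_nth (f i) k = padic_nth (g i) k) \<Longrightarrow>
    padic_nth (\<Prod>i\<in>A. f i) k = padic_nth (\<Prod>i\<in>A. g i) k"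
  by (induction A rule: infinite_finite_induct) (auto intro: padic_nth_mult_cong)

lemma padic_nth_eq_mono:
  fixes x y :: "'p::prime_card padic_int"
  shows "m \<le> n \<Longrightarrow> padic_nth x n = padic_nth y n \<Longrightarrow> padic_nth x m = padic_nth y m"
  using padic_nth_mod[of m n x] padic_nth_mod[of m n y] by simp

lemma padic_nth_mod_self [simp]:
  "padic_nth (x :: 'p::prime_card padic_int) n mod int CARD('p) ^ n = padic_nth x n"
  by (rule padic_nth_mod) simp

text \<open>Division by \<open>p ^ k\<close> is carried out in the inverse limit: component
  \<open>n\<close> of the quotient is component \<open>n + k\<close> of \<open>x\<close> divided by
  \<open>p ^ k\<close>, because the division costs \<open>k\<close> digits.\<close>

lemma padic_nth_eq_0_iff_dvd:
  fixes x :: "'p::prime_card padic_int"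
  shows "padic_nth x k = 0 \<longleftrightarrow> of_nat CARD('p) ^ k dvd x"
proof
  let ?p = "int CARD('p)"
  have pos: "?p ^ m > 0" for m by simp
  assume x: "padic_nth x k = 0"
  define s where "s = (\<lambda>n. padic_nth x (n + k) div ?p ^ k)"
  have div: "?p ^ k dvd padic_nth x (n + k)" for n
    using padic_nth_dvd_iff[of k "n + k" x] x by simp
  have s: "s n * ?p ^ k = padic_nth x (n + k)" for n
    using div by (simp add: s_def)
  have "s n \<in> {0..<?p ^ n}" for n
  proof -
    have "0 \<le> s n * ?p ^ k" "s n * ?p ^ k < ?p ^ n * ?p ^ k"
      using padic_nth_range[of x "n + k"] by (auto simp: s power_add)
    then show ?thesis
      using pos[of k] by (auto simp: zero_le_mult_iff mult_less_cancel_right)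
  qed
  moreover have "s (Suc n) mod ?p ^ n = s n" for n
  proof -
    have "(s (Suc n) mod ?p ^ n) * ?p ^ k = (s (Suc n) * ?p ^ k) mod (?p ^ (n + k))"
      by (simp only: power_add mod_mult_mult2)
    also have "\<dots> = s n * ?p ^ k"
      using padic_nth_mod[of "n + k" "Suc n + k" x] by (simp add: s)
    finally show ?thesis
      using pos[of k] by simp
  qed
  moreover define y :: "'p padic_int" where "y = Abs_padic_int s"
  ultimately have rep: "padic_nth y = s"
    unfolding y_def by (intro Abs_padic_int_inverse) auto
  have "x = of_nat (CARD('p) ^ k) * y"
    unfolding padic_int_eq_iff
  proof
    fix n
    have "padic_nth (of_nat (CARD('p) ^ k) * y) n = (?p ^ k * s n) mod ?p ^ n"
      by (simp only: times_padic_int.rep_eq padic_nth_of_nat rep)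
        (simp only: mod_mult_left_eq of_nat_power)
    also have "\<dots> = padic_nth x n"
      using padic_nth_mod[of n "n + k" x] s[of n] by (simp add: mult.commute)
    finally show "padic_nth x n = padic_nth (of_nat (CARD('p) ^ k) * y) n" ..
  qed
  then show "of_nat CARD('p) ^ k dvd x" by simp
next
  assume "of_nat CARD('p) ^ k dvd x"
  then obtain y where "x = of_nat (CARD('p) ^ k) * y" by (auto elim: dvdE)
  then show "padic_nth x k = 0"
    by (simp only: times_padic_int.rep_eq padic_nth_of_nat) simp
qed

lemma padic_nth_eq_iff_dvd:
  fixes x :: "'p::prime_card padic_int"
  shows "padic_nth x k = padic_nth y k \<longleftrightarrow> of_nat CARD('p) ^ k dvd x - y"
proof -
  have "padic_nth (x - y) k = 0 \<longleftrightarrow> padic_nth x k mod int CARD('p) ^ k =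
    padic_nth y k mod int CARD('p) ^ k"
    by (simp only: minus_padic_int.rep_eq mod_eq_dvd_iff dvd_eq_mod_eq_0)
  then show ?thesis by (simp add: padic_nth_eq_0_iff_dvd)
qed

text \<open>Completeness in the form that later yields inverses, Teichmueller representatives and
  gamma values: when the \<open>n\<close>-th term is already final modulo \<open>p ^ n\<close>, the
  limit is the diagonal.\<close>

lemma padic_int_complete:
  fixes s :: "nat \<Rightarrow> 'p::prime_card padic_int"
  assumes "\<And>n. padic_nth (s (Suc n)) n = padic_nth (s n) n"
  obtains y :: "'p padic_int" where "\<And>n. padic_nth y n = padic_nth (s n) n"
proof -
  have "padic_nth (Abs_padic_int (\<lambda>n. padic_nth (s n) n) :: 'p padic_int) = (\<lambda>n. padic_nth (s n) n)"
  proof (intro Abs_padic_int_inverse CollectI allI conjI)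
    fix n
    show "padic_nth (s n) n \<in> {0..<int CARD('p) ^ n}" by (rule padic_nth_range)
    show "padic_nth (s (Suc n)) (Suc n) mod int CARD('p) ^ n = padic_nth (s n) n"
      using padic_nth_mod[of n "Suc n" "s (Suc n)"] assms[of n] by simp
  qed
  then show ?thesis
    by (intro that[of "Abs_padic_int (\<lambda>n. padic_nth (s n) n) :: 'p padic_int"]) simp
qed

section \<open>Reduction modulo p\<close>

lemma padic_residue_eq_iff:
  fixes x y :: "'p::prime_card padic_int"
  shows "padic_residue x = padic_residue y \<longleftrightarrow> padic_nth x 1 = padic_nth y 1"
proof
  assume "padic_residue x = padic_residue y"
  then have "to_int_mod_ring (of_int_mod_ring (padic_nth x 1) :: 'p mod_ring) =
     to_int_mod_ring (of_int_mod_ring (padic_nth y 1) :: 'p mod_ring)"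
    by (simp add: padic_residue_def)
  then show "padic_nth x 1 = padic_nth y 1"
    using padic_nth_range[of x 1] padic_nth_range[of y 1]
    by (subst (asm) (1 2) to_int_mod_ring_of_int_mod_ring) auto
qed (simp add: padic_residue_def)

lemma of_int_mod_CARD [simp]:
  "of_int (a mod int CARD('p)) = (of_int a :: 'p::nontriv mod_ring)"
  unfolding of_int_of_int_mod_ring by transfer simp

lemma padic_residue_altdef: "padic_residue x = of_int (padic_nth x 1)"
  by (simp add: padic_residue_def of_int_of_int_mod_ring)

lemma padic_residue_add: "padic_residue (x + y) = padic_residue x + padic_residue y"
  unfolding padic_residue_altdef plus_padic_int.rep_eq power_one_right of_int_mod_CARD by simp

lemma padic_residue_mult: "padic_residue (x * y) = padic_residue x * padic_residue y"
  unfolding padic_residue_altdef times_padic_int.rep_eq power_one_right of_int_mod_CARD by simp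

lemma padic_residue_of_nat [simp]: "padic_residue (of_nat n :: 'p::prime_card padic_int) = of_nat n"
  unfolding padic_residue_altdef padic_nth_of_nat power_one_right of_int_mod_CARD by simp

lemma padic_residue_0 [simp]: "padic_residue 0 = 0"
  using padic_residue_of_nat[of 0] by simp

lemma padic_residue_1 [simp]: "padic_residue 1 = 1"
  using padic_residue_of_nat[of 1] by simp

lemma padic_residue_uminus: "padic_residue (- x) = - padic_residue x"
  using padic_residue_add[of x "- x"] by (simp add: eq_neg_iff_add_eq_0 add.commute)

lemma padic_residue_diff: "padic_residue (x - y) = padic_residue x - padic_residue y"
  using padic_residue_add[of x "- y"] by (simp add: padic_residue_uminus)

lemma padic_residue_power: "padic_residue (x ^ n) = padic_residue x ^ n"
  by (induction n) (simp_all add: padic_residue_mult)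

lemma padic_residue_sum: "padic_residue (\<Sum>i\<in>A. f i) = (\<Sum>i\<in>A. padic_residue (f i))"
  by (induction A rule: infinite_finite_induct) (simp_all add: padic_residue_add)

lemma padic_residue_eq_0_iff: "padic_residue x = 0 \<longleftrightarrow> of_nat CARD('p) dvd (x :: 'p::prime_card padic_int)"
  using padic_residue_eq_iff[of x 0] padic_nth_eq_0_iff_dvd[of x 1]
  by (simp add: zero_padic_int.rep_eq)

section \<open>Fermat's theorem, p-th powers and units\<close>

lemma mod_ring_fermat:
  fixes a :: "'p::prime_card mod_ring"
  assumes "a \<noteq> 0"
  shows "a ^ (CARD('p) - 1) = 1"
proof -
  let ?U = "UNIV - {0 :: 'p mod_ring}"
  have "bij_betw ((*) a) ?U ?U"
    by (rule bij_betwI[where g="\<lambda>x. x / a"]) (use assms in auto)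
  then have "(\<Prod>x\<in>?U. x) = (\<Prod>x\<in>?U. a * x)"
    using prod.reindex_bij_betw[of "(*) a" ?U ?U "\<lambda>x. x"] by simp
  also have "\<dots> = a ^ card ?U * (\<Prod>x\<in>?U. x)"
    by (simp add: prod.distrib)
  finally have "a ^ card ?U = 1" by simp
  moreover have "card ?U = CARD('p) - 1" by (simp add: card_Diff_singleton)
  ultimately show ?thesis by simp
qed

lemma mod_ring_power_card: "a ^ CARD('p) = (a :: 'p::prime_card mod_ring)"
proof (cases "a = 0")
  case False
  then show ?thesis
    using mod_ring_fermat[OF False] power_Suc[of a "CARD('p) - 1"] by simp
qed simp

text \<open>A p-th power gains a digit: the cofactor of \<open>x - y\<close> in
  \<open>x ^ p - y ^ p\<close> is a sum of \<open>p\<close> terms that all agree modulo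
  \<open>p\<close>.\<close>

lemma padic_nth_frobenius:
  fixes x y :: "'p::prime_card padic_int"
  assumes "padic_nth x k = padic_nth y k" "k \<ge> 1"
  shows "padic_nth (x ^ CARD('p)) (Suc k) = padic_nth (y ^ CARD('p)) (Suc k)"
proof -
  have "padic_residue x = padic_residue y"
    using padic_nth_eq_mono[OF assms(2,1)] by (simp add: padic_residue_eq_iff)
  then have "padic_residue (\<Sum>i<CARD('p). x ^ i * y ^ (CARD('p) - Suc i)) =
      (\<Sum>i<CARD('p). padic_residue y ^ i * padic_residue y ^ (CARD('p) - Suc i))"
    by (simp add: padic_residue_sum padic_residue_mult padic_residue_power)
  also have "\<dots> = (\<Sum>i<CARD('p). padic_residue y ^ (CARD('p) - 1))"
    by (intro sum.cong) (auto simp flip: power_add)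
  also have "\<dots> = 0" by simp
  finally have "of_nat CARD('p) dvd (\<Sum>i<CARD('p). x ^ i * y ^ (CARD('p) - Suc i))"
    by (simp add: padic_residue_eq_0_iff)
  moreover have "of_nat CARD('p) ^ k dvd x - y"
    using assms by (simp add: padic_nth_eq_iff_dvd)
  ultimately have "of_nat CARD('p) ^ k * of_nat CARD('p) dvd
      (x - y) * (\<Sum>i<CARD('p). x ^ i * y ^ (CARD('p) - Suc i))"
    by (intro mult_dvd_mono)
  also have "\<dots> = x ^ CARD('p) - y ^ CARD('p)"
    using diff_power_eq_sum[of x "CARD('p) - 1" y]
      by (simp add: lessThan_Suc_atMost[symmetric] mult.commute)
  finally show ?thesis
    by (simp add: padic_nth_eq_iff_dvd mult.commute)
qed

lemma padic_nth_frobenius_power: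
  fixes x y :: "'p::prime_card padic_int"
  assumes "padic_residue x = padic_residue y"
  shows "padic_nth (x ^ CARD('p) ^ k) (Suc k) = padic_nth (y ^ CARD('p) ^ k) (Suc k)"
proof (induction k)
  case 0
  then show ?case using assms by (simp add: padic_residue_eq_iff)
next
  case (Suc k)
  then show ?case
    using padic_nth_frobenius[of "x ^ CARD('p) ^ k" "Suc k" "y ^ CARD('p) ^ k"]
    by (simp add: power_mult[symmetric] mult.commute)
qed

lemma padic_int_unit_iff:
  fixes x :: "'p::prime_card padic_int"
  shows "x dvd 1 \<longleftrightarrow> padic_residue x \<noteq> 0"
proof
  assume "x dvd 1"
  then obtain y where "1 = x * y" ..
  then have "padic_residue x * padic_residue y = 1"
    by (metis padic_residue_1 padic_residue_mult)
  then show "padic_residue x \<noteq> 0" by auto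
next
  assume x: "padic_residue x \<noteq> 0"
  \<comment> \<open>These powers approximate the inverse of \<open>x\<close>, because
    \<open>x ^ ((p - 1) p ^ n)\<close> is 1 modulo \<open>p ^ (n + 1)\<close>.\<close>
  define s where "s = (\<lambda>n. x ^ ((CARD('p) - 1) * CARD('p) ^ n - 1))"
  have pos: "(CARD('p) - 1) * CARD('p) ^ n > 0" for n
    using CARD_prime_gt_1[where 'p='p] by simp
  have xs: "x * s n = (x ^ (CARD('p) - 1)) ^ CARD('p) ^ n" for n
    using pos[of n] power_Suc[of x "(CARD('p) - 1) * CARD('p) ^ n - 1"]
    by (simp add: s_def power_mult)
  have "padic_residue (x ^ (CARD('p) - 1)) = padic_residue 1"
    using mod_ring_fermat[OF x] by (simp add: padic_residue_power)
  then have *: "padic_nth (x * s n) (Suc n) = padic_nth (1 :: 'p padic_int) (Suc n)" for n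
    unfolding xs using padic_nth_frobenius_power[of "x ^ (CARD('p) - 1)" 1 n] by simp
  have **: "padic_nth (x * s n) k = padic_nth (1 :: 'p padic_int) k" if "k \<le> Suc n" for n k
    using padic_nth_eq_mono[OF that *] .
  have "padic_nth (s (Suc n)) n = padic_nth (s n) n" for n
  proof -
    \<comment> \<open>Two approximate inverses agree, since to this precision each equals the
      product of \<open>x\<close> with both of them.\<close>
    have "padic_nth (s (Suc n)) n = padic_nth (s (Suc n) * (x * s n)) n"
      using padic_nth_mult_cong[OF refl **[of n n], of "s (Suc n)"] by simp
    also have "s (Suc n) * (x * s n) = s n * (x * s (Suc n))" by (simp add: mult_ac)
    also have "padic_nth \<dots> n = padic_nth (s n) n"
      using padic_nth_mult_cong[OF refl **[of n "Suc n"], of "s n"] by simp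
    finally show ?thesis .
  qed
  then obtain y :: "'p padic_int" where y: "\<And>n. padic_nth y n = padic_nth (s n) n"
    using padic_int_complete[of s] by blast
  have "x * y = 1"
    unfolding padic_int_eq_iff using padic_nth_mult_cong[OF refl y] ** by auto
  then show "x dvd 1" by (metis dvd_triv_left)
qed

lemma padic_int_of_nat_approx:
  fixes x :: "'p::prime_card padic_int"
  obtains n :: nat where "padic_nth (of_nat n :: 'p padic_int) k = padic_nth x k"
proof -
  have "padic_nth (of_nat (nat (padic_nth x k)) :: 'p padic_int) k = padic_nth x k"
    using padic_nth_range[of x k] unfolding padic_nth_of_nat by simp
  then show ?thesis by (rule that)
qed

section \<open>The Teichmueller character\<close>

lemma power_card_power_eq:
  fixes x :: "'p::prime_card padic_int"
  assumes "x ^ (CARD('p) - 1) = 1"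
  shows "x ^ CARD('p) ^ n = x"
proof (induction n)
  case (Suc n)
  have "x ^ CARD('p) = x"
    using assms power_Suc[of x "CARD('p) - 1"] by simp
  then show ?case using Suc by (simp add: power_mult mult.commute)
qed simp

text \<open>Such a root of unity equals its own \<open>p ^ n\<close>-th power, and modulo
  \<open>p ^ (n + 1)\<close> that power depends on the residue alone.\<close>

lemma teichmuller_unique:
  fixes x y :: "'p::prime_card padic_int"
  assumes "x ^ (CARD('p) - 1) = 1" "y ^ (CARD('p) - 1) = 1" "padic_residue x = padic_residue y"
  shows "x = y"
  unfolding padic_int_eq_iff
proof
  fix n
  have "padic_nth x (Suc n) = padic_nth y (Suc n)"
    using padic_nth_frobenius_power[OF assms(3), of n] assms(1,2) by (simp add: power_card_power_eq)
  then show "padic_nth x n = padic_nth y n"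
    by (rule padic_nth_eq_mono[rotated]) simp
qed

text \<open>For any lift \<open>u\<close> of \<open>a\<close> the powers \<open>u ^ (p ^ n)\<close>
  converge by the gain of digits under p-th powers. The limit keeps the residue and inherits
  Fermat's theorem in all digits.\<close>

lemma teichmuller_ex:
  fixes a :: "'p::prime_card mod_ring"
  assumes "a \<noteq> 0"
  shows "\<exists>!x :: 'p padic_int. x ^ (CARD('p) - 1) = 1 \<and> padic_residue x = a"
proof (rule ex_ex1I)
  obtain i where i: "a = of_nat i" using surj_of_nat_mod_ring by blast
  define u where "u = (of_nat i :: 'p padic_int)"
  have u: "padic_residue u = a" by (simp add: u_def i)
  define s where "s = (\<lambda>n. u ^ CARD('p) ^ n)"
  have "padic_residue (u ^ CARD('p)) = padic_residue u"
    by (simp add: padic_residue_power mod_ring_power_card)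
  from padic_nth_frobenius_power[OF this]
  have "padic_nth (s (Suc n)) (Suc n) = padic_nth (s n) (Suc n)" for n
    by (simp add: s_def power_mult)
  then have "padic_nth (s (Suc n)) n = padic_nth (s n) n" for n
    by (rule padic_nth_eq_mono[rotated]) simp
  then obtain y :: "'p padic_int" where y: "\<And>n. padic_nth y n = padic_nth (s n) n"
    using padic_int_complete[of s] by blast
  have res: "padic_residue y = a"
  proof -
    have "padic_residue y = padic_residue (s 1)"
      using y[of 1] by (simp add: padic_residue_eq_iff)
    then show ?thesis by (simp add: s_def padic_residue_power mod_ring_power_card u)
  qed
  have "y ^ (CARD('p) - 1) = 1"
    unfolding padic_int_eq_iff
  proof
    fix n
    have "padic_residue (u ^ (CARD('p) - 1)) = padic_residue 1"
      using mod_ring_fermat[OF assms] by (simp add: padic_residue_power u)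
    from padic_nth_frobenius_power[OF this, of n]
    have "padic_nth (s n ^ (CARD('p) - 1)) (Suc n) = padic_nth (1 :: 'p padic_int) (Suc n)"
      by (simp add: s_def mult.commute flip: power_mult)
    then have "padic_nth (s n ^ (CARD('p) - 1)) n = padic_nth (1 :: 'p padic_int) n"
      by (rule padic_nth_eq_mono[rotated]) simp
    then show "padic_nth (y ^ (CARD('p) - 1)) n = padic_nth (1 :: 'p padic_int) n"
      using padic_nth_power_cong[OF y] by simp
  qed
  with res show "\<exists>x :: 'p padic_int. x ^ (CARD('p) - 1) = 1 \<and> padic_residue x = a" by blast
qed (use teichmuller_unique in blast)

lemma
  fixes a :: "'p::prime_card mod_ring"
  assumes "a \<noteq> 0"
  shows teichmuller_power: "teichmuller a ^ (CARD('p) - 1) = 1"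
    and teichmuller_residue: "padic_residue (teichmuller a) = (a :: 'p::prime_card mod_ring)"
  using theI'[OF teichmuller_ex[OF assms]] by (simp_all add: teichmuller_def)

lemma teichmuller_eqI:
  fixes a :: "'p::prime_card mod_ring"
  assumes "x ^ (CARD('p) - 1) = 1" "padic_residue x = (a :: 'p::prime_card mod_ring)"
  shows "teichmuller a = x"
proof -
  have "a \<noteq> 0"
  proof
    assume "a = 0"
    then have "padic_residue (x ^ (CARD('p) - 1)) = 0"
      using CARD_prime_gt_1[where 'p='p] assms(2) by (simp add: padic_residue_power)
    with assms(1) show False by simp
  qed
  then show ?thesis
    using assms teichmuller_unique teichmuller_power teichmuller_residue by metis
qed

lemma teichmuller_1 [simp]: "teichmuller 1 = 1"
  by (rule teichmuller_eqI) simp_all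

lemma teichmuller_mult:
  "a \<noteq> 0 \<Longrightarrow> b \<noteq> 0 \<Longrightarrow> teichmuller (a * b) = teichmuller a * teichmuller (b :: 'p::prime_card mod_ring)"
  using teichmuller_power[of a] teichmuller_power[of b]
  by (intro teichmuller_eqI)
     (simp_all add: power_mult_distrib padic_residue_mult teichmuller_residue)

lemma teichmuller_pow:
  "a \<noteq> 0 \<Longrightarrow> teichmuller (a ^ n) = teichmuller (a :: 'p::prime_card mod_ring) ^ n"
  by (induction n) (simp_all add: teichmuller_mult)

lemma teichmuller_nonzero: "a \<noteq> 0 \<Longrightarrow> teichmuller (a :: 'p::prime_card mod_ring) \<noteq> 0"
  using teichmuller_residue[of a] by auto

lemma teichmuller_inj:
  "a \<noteq> 0 \<Longrightarrow> b \<noteq> 0 \<Longrightarrow> teichmuller a = teichmuller b \<longleftrightarrow> a = (b :: 'p::prime_card mod_ring)"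
  using teichmuller_residue by metis

lemma teichmuller_uminus:
  assumes "a \<noteq> 0" "odd CARD('p)"
  shows "teichmuller (- a) = - teichmuller (a :: 'p::prime_card mod_ring)"
  using teichmuller_power[of a] assms
  by (intro teichmuller_eqI) (simp_all add: teichmuller_residue padic_residue_uminus)

text \<open>Used in the multiplication formula, where the powers \<open>m ^ (p ^ k)\<close> arise
  from counting units.\<close>

lemma teichmuller_approx:
  assumes "of_nat m \<noteq> (0 :: 'p::prime_card mod_ring)"
  shows "padic_nth (of_nat m ^ CARD('p) ^ k :: 'p padic_int) (Suc k) =
    padic_nth (teichmuller (of_nat m :: 'p mod_ring)) (Suc k)"
  using padic_nth_frobenius_power[of "of_nat m :: 'p padic_int"
    "teichmuller (of_nat m :: 'p mod_ring)" k]
    teichmuller_power[OF assms] teichmuller_residue[OF assms]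
  by (simp add: power_card_power_eq)

section \<open>Valuations of p-adic numbers\<close>

text \<open>
  The valuation of \<open>x\<close> is at least \<open>r\<close>. Real bounds are needed because the growth of the coefficients of
  Dwork's exponential has a fractional slope.
\<close>

definition vge :: "real \<Rightarrow> 'p::prime_card padic \<Rightarrow> bool" where
  "vge r x \<longleftrightarrow> (\<exists>n a. r \<le> real_of_int n \<and> x = of_nat CARD('p) powi n * to_fract a)"

lemma vgeI: "r \<le> real_of_int n \<Longrightarrow> x = of_nat CARD('p) powi n * to_fract a \<Longrightarrow>
  vge r (x :: 'p::prime_card padic)"
  by (auto simp: vge_def)

lemma vge_mono: "vge r x \<Longrightarrow> s \<le> r \<Longrightarrow> vge s x"
  unfolding vge_def using order_trans by blast

lemma to_fract_of_nat: "to_fract (of_nat n) = of_nat n"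
  by (induction n) simp_all

lemma to_fract_of_int: "to_fract (of_int n) = of_int n"
  by (cases n rule: int_diff_cases) (simp add: to_fract_of_nat)

lemma to_fract_power: "to_fract (x ^ n) = to_fract x ^ n"
  by (induction n) simp_all

lemma to_fract_prod: "to_fract (\<Prod>i\<in>A. f i) = (\<Prod>i\<in>A. to_fract (f i))"
  by (induction A rule: infinite_finite_induct) simp_all

lemma CARD_padic_nonzero [simp]: "of_nat CARD('p::prime_card) \<noteq> (0 :: 'p padic)"
  by simp

lemma vge_0 [simp]: "vge r 0"
proof -
  have "r \<le> real_of_int \<lceil>r\<rceil>" by simp
  then show ?thesis by (rule vgeI[where a=0]) simp
qed

lemma vge_to_fract [simp]: "r \<le> 0 \<Longrightarrow> vge r (to_fract a)"
  by (rule vgeI[of r 0 _ a]) simp_all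

lemma vge_mult: "vge r x \<Longrightarrow> vge s y \<Longrightarrow> vge (r + s) (x * y)"
proof -
  assume "vge r x" "vge s y"
  then obtain m n a b where "r \<le> real_of_int m" "s \<le> real_of_int n"
    "x = of_nat CARD('a) powi m * to_fract a" "y = of_nat CARD('a) powi n * to_fract b"
    unfolding vge_def by blast
  then show ?thesis
    by (intro vgeI[of "r + s" "m + n" _ "a * b"]) (simp_all add: power_int_add mult_ac)
qed

lemma vge_mult': "vge r x \<Longrightarrow> vge s y \<Longrightarrow> t \<le> r + s \<Longrightarrow> vge t (x * y)"
  using vge_mult vge_mono by blast

lemma vge_add:
  fixes x y :: "'p::prime_card padic"
  assumes "vge r x" "vge r y"
  shows "vge r (x + y)"
proof -
  obtain m n a b where h: "r \<le> real_of_int m" "r \<le> real_of_int n"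
    "x = of_nat CARD('p) powi m * to_fract a" "y = of_nat CARD('p) powi n * to_fract b"
    using assms unfolding vge_def by blast
  define k where "k = min m n"
  have "x = of_nat CARD('p) powi k * to_fract (of_nat CARD('p) ^ nat (m - k) * a)"
    "y = of_nat CARD('p) powi k * to_fract (of_nat CARD('p) ^ nat (n - k) * b)"
    using h(3,4) power_int_add[of "of_nat CARD('p) :: 'p padic" k "m - k"]
      power_int_add[of "of_nat CARD('p) :: 'p padic" k "n - k"]
    by (auto simp: to_fract_power to_fract_of_nat power_int_def k_def)
  then have "x + y = of_nat CARD('p) powi k * to_fract (of_nat CARD('p) ^ nat (m - k) * a +
    of_nat CARD('p) ^ nat (n - k) * b)"
    by (simp add: distrib_left)
  moreover have "r \<le> real_of_int k" using h(1,2) by (simp add: k_def min_def)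
  ultimately show ?thesis by (intro vgeI[of r k])
qed

lemma vge_uminus: "vge r x \<Longrightarrow> vge r (- x)"
  unfolding vge_def by (metis mult_minus_right to_fract_uminus)

lemma vge_uminus_iff [simp]: "vge r (- x) \<longleftrightarrow> vge r x"
  using vge_uminus[of r x] vge_uminus[of r "- x"] by auto

lemma vge_diff: "vge r x \<Longrightarrow> vge r y \<Longrightarrow> vge r (x - y)"
  using vge_add[of r x "- y"] by simp

lemma vge_diff_commute: "vge r (x - y) \<longleftrightarrow> vge r (y - x)"
  using vge_uminus_iff[of r "x - y"] by simp

lemma vge_diff_trans: "vge r (x - y) \<Longrightarrow> vge r (y - z) \<Longrightarrow> vge r (x - z)"
  using vge_add[of r "x - y" "y - z"] by simp

lemma vge_sum: "(\<And>i. i \<in> A \<Longrightarrow> vge r (f i)) \<Longrightarrow> vge r (\<Sum>i\<in>A. f i)"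
  by (induction A rule: infinite_finite_induct) (auto intro: vge_add)

lemma vge_of_nat [simp]: "r \<le> 0 \<Longrightarrow> vge r (of_nat n)"
  and vge_of_int [simp]: "r \<le> 0 \<Longrightarrow> vge r (of_int k)"
  and vge_1 [simp]: "r \<le> 0 \<Longrightarrow> vge r 1"
  using vge_to_fract[of r "of_nat n"] vge_to_fract[of r "of_int k"] vge_to_fract[of r 1]
  by (simp_all add: to_fract_of_nat to_fract_of_int)

lemma vge_power: "vge r x \<Longrightarrow> vge (real n * r) (x ^ n)"
proof (induction n)
  case (Suc n)
  then show ?case using vge_mult[of r x "real n * r" "x ^ n"] by (simp add: algebra_simps)
qed simp

lemma vge_CARD_powi: "r \<le> real_of_int n \<Longrightarrow> vge r (of_nat CARD('p) powi n :: 'p::prime_card padic)"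
  by (rule vgeI[where a=1]) simp_all

lemma vge_CARD_power: "r \<le> real n \<Longrightarrow> vge r (of_nat CARD('p) ^ n :: 'p::prime_card padic)"
  using vge_CARD_powi[of r "int n", where 'p='p] by simp

lemma vge_minus_CARD_power: "r \<le> real n \<Longrightarrow> vge r ((- of_nat CARD('p)) ^ n :: 'p::prime_card padic)"
  using vge_CARD_power[of r n] by (subst power_minus)
    (intro vge_mult'[of 0 _ r], auto simp: power_mult_distrib, metis vge_of_int of_int_minus of_int_1
    of_int_power order_refl)

lemma vge_nat_iff:
  fixes x :: "'p::prime_card padic"
  shows "vge (real n) x \<longleftrightarrow> (\<exists>a. x = of_nat CARD('p) ^ n * to_fract a)"
proof
  assume "vge (real n) x"
  then obtain m a where h: "real n \<le> real_of_int m" "x = of_nat CARD('p) powi m * to_fract a"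
    unfolding vge_def by blast
  then have m: "m = int n + int (nat (m - int n))" by simp
  have "x = of_nat CARD('p) ^ n * to_fract (of_nat CARD('p) ^ nat (m - int n) * a)"
    using h(2) unfolding arg_cong[OF m, of "\<lambda>k. of_nat CARD('p) powi k"]
    by (simp add: power_int_add to_fract_power to_fract_of_nat mult_ac del: int_nat_eq of_nat_nat)
  then show "\<exists>a. x = of_nat CARD('p) ^ n * to_fract a" ..
next
  assume "\<exists>a. x = of_nat CARD('p) ^ n * to_fract a"
  then obtain a where "x = of_nat CARD('p) powi (int n) * to_fract a" by auto
  then show "vge (real n) x" by (rule vgeI[rotated]) simp
qed

lemma vge_to_fract_iff:
  "vge (real n) (to_fract a) \<longleftrightarrow> of_nat CARD('p) ^ n dvd (a :: 'p::prime_card padic_int)"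
proof -
  have "to_fract a = of_nat CARD('p) ^ n * to_fract b \<longleftrightarrow> a = of_nat CARD('p) ^ n * b" for b
    by (metis to_fract_eq_iff to_fract_mult to_fract_of_nat of_nat_power)
  then show ?thesis by (simp add: vge_nat_iff dvd_def)
qed

lemma vge_diff_to_fract_iff:
  "vge (real n) (to_fract a - to_fract b) \<longleftrightarrow> padic_nth a n = padic_nth (b :: 'p::prime_card padic_int) n"
  using vge_to_fract_iff[of n "a - b"] by (simp add: padic_nth_eq_iff_dvd)

lemma vge_integral:
  assumes "vge r x" "-1 < r"
  obtains a where "x = to_fract a"
proof -
  obtain m a where h: "r \<le> real_of_int m" "x = of_nat CARD('a) powi m * to_fract a"
    using assms(1) unfolding vge_def by blast
  then have "0 \<le> m" using assms(2) by linarith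
  then have "x = to_fract (of_nat CARD('a) ^ nat m * a)"
    using h(2) by (simp add: to_fract_power to_fract_of_nat power_int_def)
  then show ?thesis by (rule that)
qed

lemma vge_all_eq_0:
  fixes x :: "'p::prime_card padic"
  assumes "\<And>n::nat. vge (real n) x"
  shows "x = 0"
proof -
  obtain a where a: "x = to_fract a"
    using vge_integral[OF assms[of 0]] by auto
  have "padic_nth a n = 0" for n
    using assms[of n] by (simp add: a vge_to_fract_iff padic_nth_eq_0_iff_dvd)
  then have "a = 0" by (simp add: padic_int_eq_iff zero_padic_int.rep_eq)
  then show ?thesis by (simp add: a)
qed

lemma to_fract_inverse_unit:
  assumes "x dvd 1"
  obtains y where "inverse (to_fract x) = to_fract y" "x * y = 1"
proof -
  obtain y where y: "1 = x * y" using assms ..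
  then have "to_fract x * to_fract y = 1" by (metis to_fract_1 to_fract_mult)
  then show ?thesis using that[of y] y inverse_unique by metis
qed

lemma vge_inverse_unit: "x dvd 1 \<Longrightarrow> vge 0 (inverse (to_fract x))"
  by (erule to_fract_inverse_unit) simp

section \<open>The p-adic gamma function\<close>

text \<open>The value 1 at multiples of \<open>p\<close>, and so at 0, allows products over all
  \<open>j < n\<close> and gives gamma a uniform one-step recursion.\<close>

definition unit_part :: "nat \<Rightarrow> 'p::prime_card padic_int" where
  "unit_part j = (if CARD('p) dvd j then 1 else of_nat j)"

lemma of_nat_dvd_padic_int_iff:
  "of_nat CARD('p) dvd (of_nat j :: 'p::prime_card padic_int) \<longleftrightarrow> CARD('p) dvd j"
proof -
  have "of_nat CARD('p) dvd (of_nat j :: 'p padic_int) \<longleftrightarrow> (of_nat j :: 'p mod_ring) = 0"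
    using padic_residue_eq_0_iff[of "of_nat j :: 'p padic_int"] by simp
  then show ?thesis using of_nat_0_mod_ring_dvd[where 'a='p] by (auto elim!: dvdE)
qed

lemma of_nat_unit_padic_int_iff: "(of_nat j :: 'p::prime_card padic_int) dvd 1 \<longleftrightarrow> \<not> CARD('p) dvd j"
  by (simp add: padic_int_unit_iff padic_residue_eq_0_iff of_nat_dvd_padic_int_iff flip:
    padic_residue_of_nat)

lemma unit_part_unit: "(unit_part j :: 'p::prime_card padic_int) dvd 1"
  by (simp add: unit_part_def of_nat_unit_padic_int_iff)

lemma unit_part_add_power:
  assumes "k \<ge> 1"
  shows "padic_nth (unit_part (j + t * CARD('p) ^ k) :: 'p::prime_card padic_int) k =
    padic_nth (unit_part j :: 'p padic_int) k"
proof -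
  have "CARD('p) dvd t * CARD('p) ^ k" using assms by (simp add: dvd_power)
  then have "CARD('p) dvd j + t * CARD('p) ^ k \<longleftrightarrow> CARD('p) dvd j"
    using dvd_add_left_iff by blast
  moreover have "padic_nth (of_nat (j + t * CARD('p) ^ k) :: 'p padic_int) k =
    padic_nth (of_nat j :: 'p padic_int) k"
    by (simp only: padic_nth_of_nat) (simp add: of_nat_power[symmetric] del: of_nat_power)
  ultimately show ?thesis by (simp add: unit_part_def del: of_nat_add)
qed

section \<open>Wilson's theorem modulo prime powers\<close>

lemma prod_affine_expansion:
  fixes a x :: "'a::comm_ring_1"
  shows "\<exists>c. (\<Prod>t\<le>n. a + of_nat t * x) = a ^ Suc n + a ^ n * x * of_nat (\<Sum>t\<le>n. t) + x ^ 2 * c"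
proof (induction n)
  case 0
  show ?case by (intro exI[of _ 0]) simp
next
  case (Suc n)
  then obtain c where c: "(\<Prod>t\<le>n. a + of_nat t * x) =
    a ^ Suc n + a ^ n * x * of_nat (\<Sum>t\<le>n. t) + x ^ 2 * c"
    by blast
  show ?case
    by (intro exI[of _ "a ^ n * of_nat (\<Sum>t\<le>n. t) * of_nat (Suc n) + c * (a + of_nat (Suc n) * x)"])
       (simp only: prod.atMost_Suc c sum.atMost_Suc, simp add: algebra_simps power2_eq_square)
qed

text \<open>In the expansion in powers of \<open>p ^ k\<close> the linear coefficient contains
  \<open>0 + ... + (p - 1)\<close>, a multiple of \<open>p\<close> because \<open>p\<close> is odd,
  and the remainder carries \<open>p ^ (2 k)\<close> with \<open>2 k \<ge> k + 1\<close>.\<close>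

lemma padic_nth_prod_translates:
  fixes a :: "'p::prime_card padic_int"
  assumes "odd CARD('p)" "k \<ge> 1"
  shows "padic_nth (\<Prod>t<CARD('p). a + of_nat t * of_nat CARD('p) ^ k) (Suc k) =
    padic_nth (a ^ CARD('p)) (Suc k)"
proof -
  let ?p = "of_nat CARD('p) :: 'p padic_int"
  obtain n where n: "CARD('p) = Suc n" using CARD_prime_pos[where 'p='p] gr0_implies_Suc by blast
  obtain c where c: "(\<Prod>t\<le>n. a + of_nat t * ?p ^ k) =
    a ^ Suc n + a ^ n * ?p ^ k * of_nat (\<Sum>t\<le>n. t) + (?p ^ k) ^ 2 * c"
    using prod_affine_expansion by blast
  have "even n" using assms(1) n by simp
  then obtain h where h: "n = 2 * h" by (elim evenE)
  have "(\<Sum>t\<le>n. t) = CARD('p) * h"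
    using gauss_sum_nat[of n] by (simp add: atMost_atLeast0 n h)
  then have "of_nat (\<Sum>t\<le>n. t) = ?p * of_nat h" by (metis of_nat_mult)
  moreover have "(?p ^ k) ^ 2 = ?p ^ Suc k * ?p ^ (k - 1)"
  proof -
    have "k * 2 = Suc k + (k - 1)" using assms(2) by simp
    then show ?thesis by (simp only: power_add power_mult[symmetric])
  qed
  ultimately have "(\<Prod>t\<le>n. a + of_nat t * ?p ^ k) - a ^ Suc n =
    ?p ^ Suc k * (a ^ n * of_nat h + ?p ^ (k - 1) * c)"
    unfolding c by (simp add: algebra_simps)
  then have "?p ^ Suc k dvd (\<Prod>t\<le>n. a + of_nat t * ?p ^ k) - a ^ Suc n" by simp
  then show ?thesis
    by (simp only: padic_nth_eq_iff_dvd n[symmetric] flip: lessThan_Suc_atMost)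
qed

text \<open>The units below \<open>p ^ (k + 1)\<close> are grouped by their class modulo
  \<open>p ^ k\<close>, and each class contributes the p-th power of its representative. The product
  at level \<open>k + 1\<close> is therefore the p-th power of the one at level \<open>k\<close>,
  and p-th powers gain a digit.\<close>

lemma wilson_prime_power:
  assumes "odd CARD('p)" "k \<ge> 1"
  shows "padic_nth (\<Prod>j<CARD('p) ^ k. unit_part j :: 'p padic_int) k =
    padic_nth (- 1 :: 'p::prime_card padic_int) k"
  using assms(2)
proof (induction k rule: dec_induct)
  case base
  obtain n where n: "CARD('p) = Suc n" using CARD_prime_pos[where 'p='p] gr0_implies_Suc by blast
  have "(\<Prod>j<CARD('p). unit_part j :: 'p padic_int) = (\<Prod>j\<in>{1..n}. of_nat j)"
  proof (rule prod.mono_neutral_cong_right)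
    show "\<forall>i\<in>{..<CARD('p)} - {1..n}. unit_part i = (1 :: 'p padic_int)"
      by (auto simp: unit_part_def n not_less_eq_eq Suc_le_eq)
    show "unit_part x = (of_nat x :: 'p padic_int)" if "x \<in> {1..n}" for x
      using that nat_dvd_not_less[of x "CARD('p)"] by (auto simp: unit_part_def n)
  qed (auto simp: n)
  also have "\<dots> = of_nat (fact n)" by (simp add: fact_prod)
  finally have "(\<Prod>j<CARD('p). unit_part j :: 'p padic_int) = of_nat (fact n)" .
  moreover have "padic_nth (of_nat (fact n) :: 'p padic_int) 1 = padic_nth (- 1 :: 'p padic_int) 1"
  proof -
    have "[fact (CARD('p) - 1) = - 1] (mod int CARD('p))"
      using wilson_theorem[of "CARD('p)"] prime_card by blast
    then have "int (fact n) mod int CARD('p) = (- 1) mod int CARD('p)"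
      by (simp add: cong_def n)
    then show ?thesis
      using CARD_prime_gt_1[where 'p='p] unfolding padic_nth_of_nat
      by (simp add: uminus_padic_int.rep_eq one_padic_int.rep_eq mod_minus_eq)
  qed
  ultimately show ?case by simp
next
  case (step k)
  let ?p = "CARD('p)"
  have "(\<Prod>j<?p ^ Suc k. unit_part j :: 'p padic_int) =
    (\<Prod>t<?p. \<Prod>j\<in>{t * ?p ^ k..<t * ?p ^ k + ?p ^ k}. unit_part j)"
    by (simp add: prod.nat_group)
  also have "\<dots> = (\<Prod>t<?p. \<Prod>j<?p ^ k. unit_part (j + t * ?p ^ k))"
  proof (rule prod.cong[OF refl])
    fix t
    show "prod unit_part {t * ?p ^ k..<t * ?p ^ k + ?p ^ k} =
      (\<Prod>j<?p ^ k. unit_part (j + t * ?p ^ k) :: 'p padic_int)"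
      using prod.shift_bounds_nat_ivl[of unit_part 0 "t * ?p ^ k" "?p ^ k"]
      by (simp add: atLeast0LessThan add.commute)
  qed
  also have "\<dots> = (\<Prod>j<?p ^ k. \<Prod>t<?p. unit_part (j + t * ?p ^ k))"
    by (rule prod.swap)
  also have "padic_nth \<dots> (Suc k) = padic_nth (\<Prod>j<?p ^ k. unit_part j ^ ?p :: 'p padic_int) (Suc k)"
  proof (rule padic_nth_prod_cong)
    fix j
    have "?p dvd j + t * ?p ^ k \<longleftrightarrow> ?p dvd j" for t
    proof -
      have "?p dvd t * ?p ^ k" using step.hyps by (simp add: dvd_power)
      then show ?thesis using dvd_add_left_iff by blast
    qed
    then have "(\<Prod>t<?p. unit_part (j + t * ?p ^ k) :: 'p padic_int) =
        (if ?p dvd j then 1 else \<Prod>t<?p. of_nat j + of_nat t * of_nat ?p ^ k)"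
      by (simp add: unit_part_def)
    then show "padic_nth (\<Prod>t<?p. unit_part (j + t * ?p ^ k) :: 'p padic_int) (Suc k) =
        padic_nth (unit_part j ^ ?p :: 'p padic_int) (Suc k)"
      using padic_nth_prod_translates[OF assms(1), of k "of_nat j :: 'p padic_int"] step.hyps
      by (simp add: unit_part_def)
  qed
  also have "(\<Prod>j<?p ^ k. unit_part j ^ ?p :: 'p padic_int) = (\<Prod>j<?p ^ k. unit_part j) ^ ?p"
    by (simp add: prod_power_distrib)
  also have "padic_nth \<dots> (Suc k) = padic_nth ((- 1) ^ ?p :: 'p padic_int) (Suc k)"
    using step by (intro padic_nth_frobenius) auto
  finally show ?case using assms(1) by simp
qed

definition gamma_nat :: "nat \<Rightarrow> 'p::prime_card padic_int" where
  "gamma_nat n = (-1) ^ n * (\<Prod>j<n. unit_part j)"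

lemma gamma_nat_0 [simp]: "gamma_nat 0 = 1"
  by (simp add: gamma_nat_def)

lemma gamma_nat_Suc: "gamma_nat (Suc n) = - unit_part n * gamma_nat n"
  by (simp add: gamma_nat_def)

lemma gamma_nat_unit: "gamma_nat n dvd 1"
  by (induction n) (simp_all add: gamma_nat_Suc unit_part_unit is_unit_mult_iff)

lemma padic_nth_cancel_unit:
  fixes x y u :: "'p::prime_card padic_int"
  assumes "padic_nth (u * x) k = padic_nth (u * y) k" "u dvd 1"
  shows "padic_nth x k = padic_nth y k"
proof -
  obtain v where "1 = u * v" using assms(2) ..
  then have uv: "v * u = 1" by (simp add: mult.commute)
  have "v * (u * z) = z" for z unfolding mult.assoc[symmetric] uv by simp
  then show ?thesis using padic_nth_mult_cong[OF refl assms(1), of v] by (simp only:)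
qed

text \<open>At \<open>n = 0\<close> this is Wilson's theorem, whose value -1 cancels the sign
  \<open>(- 1) ^ (p ^ k)\<close>; the recursion transports it to every \<open>n\<close>. It is the
  source of the continuity of gamma.\<close>

lemma gamma_nat_add_power:
  assumes "odd CARD('p)" "k \<ge> 1"
  shows "padic_nth (gamma_nat (n + CARD('p) ^ k) :: 'p::prime_card padic_int) k =
    padic_nth (gamma_nat n :: 'p padic_int) k"
proof (induction n)
  case 0
  have "padic_nth (gamma_nat (CARD('p) ^ k) :: 'p padic_int) k = padic_nth (- (- 1) :: 'p padic_int) k"
    using padic_nth_uminus_cong[OF wilson_prime_power[OF assms]] assms
    by (simp add: gamma_nat_def)
  then show ?case by simp
next
  case (Suc n)
  have "padic_nth (- unit_part (n + CARD('p) ^ k) :: 'p padic_int) k =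
    padic_nth (- unit_part n :: 'p padic_int) k"
    using unit_part_add_power[OF assms(2), of n 1, where 'p='p] by (intro padic_nth_uminus_cong) simp
  from padic_nth_mult_cong[OF this Suc] show ?case
    by (simp add: gamma_nat_Suc)
qed

lemma gamma_nat_cong:
  assumes "odd CARD('p)" "[m = n] (mod CARD('p) ^ k)"
  shows "padic_nth (gamma_nat m :: 'p::prime_card padic_int) k =
    padic_nth (gamma_nat n :: 'p padic_int) k"
proof (cases "k = 0")
  case True
  then show ?thesis
    using padic_nth_range[of "gamma_nat m :: 'p padic_int" 0] padic_nth_range[of
      "gamma_nat n :: 'p padic_int" 0] by simp
next
  case False
  have *: "padic_nth (gamma_nat (n + t * CARD('p) ^ k) :: 'p padic_int) k =
    padic_nth (gamma_nat n :: 'p padic_int) k" for n t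
  proof (induction t)
    case (Suc t)
    have "n + Suc t * CARD('p) ^ k = (n + t * CARD('p) ^ k) + CARD('p) ^ k" by simp
    then show ?case
      using gamma_nat_add_power[OF assms(1), of k "n + t * CARD('p) ^ k"] False Suc
        by (simp only: One_nat_def Suc_le_eq neq0_conv)
  qed simp
  have "m mod CARD('p) ^ k = n mod CARD('p) ^ k" using assms(2) by (simp add: cong_def)
  then show ?thesis
    using *[of "m mod CARD('p) ^ k" "m div CARD('p) ^ k", unfolded mod_div_mult_eq]
      *[of "n mod CARD('p) ^ k" "n div CARD('p) ^ k", unfolded mod_div_mult_eq]
    by simp
qed

section \<open>Continuity in terms of digits, and the extension of gamma from the natural
  numbers\<close>

lemma dist_padic_int_le_iff:
  fixes x y :: "'p::prime_card padic_int"
  shows "dist x y \<le> 1 / real CARD('p) ^ k \<longleftrightarrow> padic_nth x k = padic_nth y k"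
  by (simp add: dist_padic_int_def padic_norm_le_iff padic_nth_eq_0_iff_dvd padic_nth_eq_iff_dvd)

lemma CARD_power_small:
  assumes "e > 0"
  obtains k where "1 / real CARD('p::prime_card) ^ k < e"
proof -
  have "1 / real CARD('p) < 1" using CARD_prime_gt_1[where 'p='p] by simp
  then obtain k where "(1 / real CARD('p)) ^ k < e" using real_arch_pow_inv[OF assms] by blast
  then show ?thesis by (intro that[of k]) (simp add: power_divide)
qed

lemma continuous_on_UNIV_dist_iff:
  fixes f :: "'a::metric_space \<Rightarrow> 'b::metric_space"
  shows "continuous_on UNIV f \<longleftrightarrow> (\<forall>x. \<forall>e>0. \<exists>d>0. \<forall>y. dist y x < d \<longrightarrow> dist (f y) (f x) < e)"
  unfolding continuous_on_def tendsto_iff eventually_at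
proof (intro iffI allI impI ballI, goal_cases)
  case (1 x e)
  then show ?case by (metis UNIV_I dist_self)
next
  case (2 x e)
  then show ?case by metis
qed

lemma continuous_on_padic_intI:
  fixes f :: "'p::prime_card padic_int \<Rightarrow> 'p padic_int"
  assumes "\<And>x y k. padic_nth x k = padic_nth y k \<Longrightarrow> padic_nth (f x) k = padic_nth (f y) k"
  shows "continuous_on UNIV f"
  unfolding continuous_on_UNIV_dist_iff
proof (intro allI impI)
  fix x :: "'p padic_int" and e :: real
  assume "e > 0"
  then obtain k where k: "1 / real CARD('p) ^ k < e" using CARD_power_small[where 'p='p] by blast
  have "dist (f y) (f x) < e" if "dist y x < 1 / real CARD('p) ^ k" for y
  proof -
    have "padic_nth y k = padic_nth x k"
      using less_imp_le[OF that] by (simp only: dist_padic_int_le_iff)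
    then have "padic_nth (f y) k = padic_nth (f x) k" by (rule assms)
    then have "dist (f y) (f x) \<le> 1 / real CARD('p) ^ k"
      by (simp only: dist_padic_int_le_iff)
    then show ?thesis using k by simp
  qed
  moreover have "0 < 1 / real CARD('p) ^ k" by simp
  ultimately show "\<exists>d>0. \<forall>y. dist y x < d \<longrightarrow> dist (f y) (f x) < e" by blast
qed

lemma continuous_padic_int_eqI:
  fixes f g :: "'p::prime_card padic_int \<Rightarrow> 'p padic_int"
  assumes "continuous_on UNIV f" "continuous_on UNIV g" "\<And>n. f (of_nat n) = g (of_nat n)"
  shows "f = g"
proof (rule ext, rule ccontr)
  fix x
  assume "f x \<noteq> g x"
  define e where "e = dist (f x) (g x) / 2"
  have e: "e > 0" using \<open>f x \<noteq> g x\<close> by (simp add: e_def)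
  obtain d1 where d1: "d1 > 0" "\<And>y. dist y x < d1 \<Longrightarrow> dist (f y) (f x) < e"
    using assms(1) e unfolding continuous_on_UNIV_dist_iff by blast
  obtain d2 where d2: "d2 > 0" "\<And>y. dist y x < d2 \<Longrightarrow> dist (g y) (g x) < e"
    using assms(2) e unfolding continuous_on_UNIV_dist_iff by blast
  obtain k where k: "1 / real CARD('p) ^ k < min d1 d2"
    using CARD_power_small[of "min d1 d2", where 'p='p] d1 d2 by auto
  obtain n where "padic_nth (of_nat n :: 'p padic_int) k = padic_nth x k"
    using padic_int_of_nat_approx by blast
  then have "dist (of_nat n) x \<le> 1 / real CARD('p) ^ k" by (simp add: dist_padic_int_le_iff)
  then have "dist (f (of_nat n)) (f x) < e" "dist (g (of_nat n)) (g x) < e"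
    using d1(2) d2(2) k by simp_all
  then have "dist (f x) (g x) < e + e"
    using dist_triangle3[of "f x" "g x" "f (of_nat n)"] by (simp add: assms(3))
  then show False by (simp add: e_def)
qed

lemma padic_nth_nat_mod:
  fixes x :: "'p::prime_card padic_int"
  assumes "j \<le> k"
  shows "[nat (padic_nth x k) = nat (padic_nth x j)] (mod CARD('p) ^ j)"
proof -
  have "int (nat (padic_nth x i)) = padic_nth x i" for i
    using padic_nth_range[of x i] by simp
  then have "int (nat (padic_nth x k) mod CARD('p) ^ j) = int (nat (padic_nth x j) mod CARD('p) ^ j)"
    unfolding zmod_int of_nat_power using padic_nth_mod[OF assms, of x] by simp
  then show ?thesis unfolding cong_def of_nat_eq_iff .
qed

text \<open>Resolves the definite description of \<open>padic_Gamma\<close>: the congruences for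
  \<open>gamma_nat\<close> give a continuous extension, and density of the natural numbers makes it
  unique. Later arguments use the digitwise Lipschitz property recorded here in place of
  continuity.\<close>

lemma padic_Gamma_ex1:
  assumes "odd CARD('p)"
  obtains f :: "'p::prime_card padic_int \<Rightarrow> 'p padic_int"
  where "padic_Gamma = f" "\<And>n. f (of_nat n) = gamma_nat n"
    "\<And>x y k. padic_nth x k = padic_nth y k \<Longrightarrow> padic_nth (f x) k = padic_nth (f y) k"
proof -
  have "\<exists>y :: 'p padic_int. \<forall>k. padic_nth y k =
    padic_nth (gamma_nat (nat (padic_nth x k)) :: 'p padic_int) k"
    for x :: "'p padic_int"
  proof -
    define s where "s = (\<lambda>k. gamma_nat (nat (padic_nth x k)) :: 'p padic_int)"
    have "padic_nth (s (Suc k)) k = padic_nth (s k) k" for k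
      unfolding s_def by (intro gamma_nat_cong[OF assms] padic_nth_nat_mod) simp
    then obtain y :: "'p padic_int" where "\<And>k. padic_nth y k = padic_nth (s k) k"
      using padic_int_complete[of s] by blast
    then show ?thesis unfolding s_def by blast
  qed
  then obtain f :: "'p padic_int \<Rightarrow> 'p padic_int" where
    f: "\<And>x k. padic_nth (f x) k = padic_nth (gamma_nat (nat (padic_nth x k)) :: 'p padic_int) k"
    by metis
  have lip: "padic_nth (f x) k = padic_nth (f y) k" if "padic_nth x k = padic_nth y k" for x y k
    by (simp only: f that)
  have nat: "f (of_nat n) = gamma_nat n" for n
    unfolding padic_int_eq_iff
  proof
    fix k
    have "nat (padic_nth (of_nat n :: 'p padic_int) k) = n mod CARD('p) ^ k"
      unfolding padic_nth_of_nat using nat_int[of "n mod CARD('p) ^ k"] by (simp add: zmod_int)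
    then show "padic_nth (f (of_nat n)) k = padic_nth (gamma_nat n :: 'p padic_int) k"
      using gamma_nat_cong[OF assms, of "n mod CARD('p) ^ k" n k] by (simp add: f cong_def)
  qed
  have cont: "continuous_on UNIV f" by (rule continuous_on_padic_intI) (rule lip)
  have unit: "f x dvd 1" for x
    using f[of x 1] gamma_nat_unit[of "nat (padic_nth x 1)", where 'a='p]
    by (simp add: padic_int_unit_iff padic_residue_altdef)
  have prod: "(\<Prod>j | 0 < j \<and> j < n \<and> \<not> CARD('p) dvd j. of_nat j) = (\<Prod>j<n. unit_part j :: 'p padic_int)"
    for n
    by (rule prod.mono_neutral_cong_left) (auto simp: unit_part_def intro!: gr0I)
  have "padic_Gamma = f"
    unfolding padic_Gamma_def
  proof (rule the_equality)
    show "continuous_on UNIV f \<and> (\<forall>x. f x dvd 1) \<and> f 0 = 1 \<and> (\<forall>n>0. f (of_nat n) =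
       (- 1) ^ n * (\<Prod>j | 0 < j \<and> j < n \<and> \<not> CARD('p) dvd j. of_nat j))"
      using cont unit nat[of 0] nat by (simp add: prod gamma_nat_def)
  next
    fix g :: "'p padic_int \<Rightarrow> 'p padic_int"
    assume g: "continuous_on UNIV g \<and> (\<forall>x. g x dvd 1) \<and> g 0 = 1 \<and> (\<forall>n>0. g (of_nat n) =
       (- 1) ^ n * (\<Prod>j | 0 < j \<and> j < n \<and> \<not> CARD('p) dvd j. of_nat j))"
    have "g (of_nat n) = f (of_nat n)" for n
      using g nat[of n] by (cases "n = 0") (simp_all add: prod gamma_nat_def)
    then show "g = f" using g cont by (intro continuous_padic_int_eqI) auto
  qed
  then show ?thesis using that nat lip by blast
qed

context
  assumes odd: "odd CARD('p::prime_card)"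
begin

section \<open>Units, congruences and the functional equation\<close>

lemma padic_Gamma_of_nat: "padic_Gamma (of_nat n) = (gamma_nat n :: 'p padic_int)"
  using padic_Gamma_ex1[OF odd] by metis

lemma padic_Gamma_cong:
  fixes x y :: "'p padic_int"
  shows "padic_nth x k = padic_nth y k \<Longrightarrow> padic_nth (padic_Gamma x) k = padic_nth (padic_Gamma y) k"
  using padic_Gamma_ex1[OF odd] by metis

lemma padic_Gamma_0: "padic_Gamma 0 = (1 :: 'p padic_int)"
  using padic_Gamma_of_nat[of 0] by simp

lemma padic_Gamma_unit: "padic_Gamma x dvd (1 :: 'p padic_int)"
proof -
  obtain n where "padic_nth (of_nat n :: 'p padic_int) 1 = padic_nth x 1"
    using padic_int_of_nat_approx by blast
  from padic_Gamma_cong[OF this] show ?thesis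
    using gamma_nat_unit[of n, where 'a='p]
    by (simp add: padic_int_unit_iff padic_residue_altdef padic_Gamma_of_nat)
qed

lemma padic_Gamma_plus_1:
  fixes x :: "'p padic_int"
  shows "padic_Gamma (x + 1) = - (if of_nat CARD('p) dvd x then 1 else x) * padic_Gamma x"
  unfolding padic_int_eq_iff
proof
  fix k
  \<comment> \<open>One digit more than \<open>k\<close>, so that the residue of \<open>x\<close>,
    which decides divisibility by \<open>p\<close>, is known even for \<open>k = 0\<close>.\<close>
  obtain n where n: "padic_nth (of_nat n :: 'p padic_int) (Suc k) = padic_nth x (Suc k)"
    using padic_int_of_nat_approx by blast
  have n': "padic_nth (of_nat n :: 'p padic_int) k = padic_nth x k"
    by (rule padic_nth_eq_mono[OF _ n]) simp
  have "padic_nth (of_nat n :: 'p padic_int) 1 = padic_nth x 1"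
    by (rule padic_nth_eq_mono[OF _ n]) simp
  then have dvd: "of_nat CARD('p) dvd x \<longleftrightarrow> CARD('p) dvd n"
    using padic_residue_eq_iff[of "of_nat n" x] of_nat_dvd_padic_int_iff[of n, where 'p='p]
    by (metis padic_residue_eq_0_iff)
  have "padic_nth (padic_Gamma (x + 1)) k = padic_nth (padic_Gamma (of_nat (Suc n) :: 'p padic_int)) k"
    using padic_nth_add_cong[OF n' refl, of 1] by (intro padic_Gamma_cong) (simp add: add.commute)
  also have "\<dots> = padic_nth (- unit_part n * padic_Gamma (of_nat n) :: 'p padic_int) k"
    unfolding padic_Gamma_of_nat gamma_nat_Suc ..
  also have "\<dots> = padic_nth (- (if of_nat CARD('p) dvd x then 1 else x) * padic_Gamma x) k"
    by (intro padic_nth_mult_cong padic_nth_uminus_cong padic_Gamma_cong)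
       (use n' dvd in \<open>auto simp: unit_part_def\<close>)
  finally show "padic_nth (padic_Gamma (x + 1)) k =
    padic_nth (- (if of_nat CARD('p) dvd x then 1 else x) * padic_Gamma x) k" .
qed

section \<open>The multiplication formula\<close>

text \<open>Here \<open>w\<close> is \<open>1 / m\<close>. Passing from \<open>n\<close> to
  \<open>n + 1\<close> replaces the gamma factor at \<open>n / m\<close> by the one at
  \<open>n / m + 1\<close>, so the functional equation contributes \<open>- n / m\<close>, or -1 if
  \<open>p\<close> divides \<open>n\<close>. The factors \<open>m\<close> clear these denominators
  and leave the functional equation at \<open>n\<close>.\<close>

lemma padic_Gamma_multiplication_nat:
  fixes w :: "'p padic_int"
  assumes w: "of_nat m * w = 1" and m: "m > 0"
  shows "(\<Prod>i<m. padic_Gamma ((of_nat n + of_nat i) * w)) *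
    (\<Prod>j<n. if CARD('p) dvd j then 1 else of_nat m) =
    (\<Prod>i<m. padic_Gamma (of_nat i * w)) * padic_Gamma (of_nat n)"
proof (induction n)
  case 0
  then show ?case using padic_Gamma_0 by simp
next
  case (Suc n)
  let ?f = "\<lambda>n. \<Prod>i<m. padic_Gamma ((of_nat n + of_nat i) * w)"
  let ?c = "\<lambda>j. if CARD('p) dvd j then 1 else of_nat m :: 'p padic_int"
  obtain m' where m': "m = Suc m'" using m gr0_implies_Suc by blast
  let ?h = "\<lambda>i. padic_Gamma ((of_nat n + of_nat i) * w)"
  have "?f (Suc n) * ?h 0 = (\<Prod>i<m. ?h (Suc i)) * ?h 0" by (simp add: add_ac)
  also have "\<dots> = (\<Prod>i<Suc m. ?h i)" by (subst prod.lessThan_Suc_shift) simp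
  also have "\<dots> = ?f n * ?h m" by simp
  also have "(of_nat n + of_nat m) * w = of_nat n * w + 1" using w by (simp add: distrib_right)
  also have "padic_Gamma \<dots> = - (if of_nat CARD('p) dvd of_nat n * w then 1 else of_nat n * w) * ?h 0"
    by (subst padic_Gamma_plus_1) simp
  also have "of_nat CARD('p) dvd of_nat n * w \<longleftrightarrow> CARD('p) dvd n"
  proof -
    have "w dvd 1" by (metis w dvd_triv_right)
    then show ?thesis by (simp add: dvd_mult_unit_iff' dvd_mult_unit_iff of_nat_dvd_padic_int_iff)
  qed
  finally have "?f (Suc n) * ?h 0 = (- (if CARD('p) dvd n then 1 else of_nat n * w) * ?f n) * ?h 0"
    by (simp add: mult_ac)
  moreover have "?h 0 \<noteq> 0" using padic_Gamma_unit[of "(of_nat n + of_nat 0) * w"] by auto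
  ultimately have "?f (Suc n) = - (if CARD('p) dvd n then 1 else of_nat n * w) * ?f n"
    using mult_right_cancel by metis
  then have "?f (Suc n) * (\<Prod>j<Suc n. ?c j) =
      - (if CARD('p) dvd n then 1 else of_nat n * w) * ?c n * (?f n * (\<Prod>j<n. ?c j))"
    by (simp add: mult_ac)
  also have "\<dots> = - (if CARD('p) dvd n then 1 else of_nat n * w) * ?c n *
    ((\<Prod>i<m. padic_Gamma (of_nat i * w)) * padic_Gamma (of_nat n))"
    using Suc by simp
  also have "- (if CARD('p) dvd n then 1 else of_nat n * w) * ?c n = - unit_part n"
    using w by (simp add: unit_part_def mult_ac)
  also have "- unit_part n * ((\<Prod>i<m. padic_Gamma (of_nat i * w)) * padic_Gamma (of_nat n)) =
    (\<Prod>i<m. padic_Gamma (of_nat i * w)) * padic_Gamma (of_nat (Suc n))"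
    unfolding padic_Gamma_of_nat gamma_nat_Suc by (simp add: mult_ac)
  finally show ?case .
qed

lemma prod_units_power:
  fixes c :: "'a::comm_monoid_mult"
  shows "(\<Prod>j<CARD('p) * n. if CARD('p) dvd j then 1 else c) = c ^ ((CARD('p) - 1) * n)"
proof -
  let ?p = "CARD('p)"
  have "(\<Prod>j<n * ?p. if ?p dvd j then 1 else c) =
    (\<Prod>t<n. \<Prod>j\<in>{t * ?p..<t * ?p + ?p}. if ?p dvd j then 1 else c)"
    by (simp add: prod.nat_group)
  also have "\<dots> = (\<Prod>t<n. c ^ (?p - 1))"
  proof (rule prod.cong[OF refl])
    fix t
    have "(\<Prod>j\<in>{t * ?p..<t * ?p + ?p}. if ?p dvd j then 1 else c) =
      (\<Prod>j<?p. if ?p dvd j + t * ?p then 1 else c)"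
      using prod.shift_bounds_nat_ivl[of "\<lambda>j. if ?p dvd j then 1 else c" 0 "t * ?p" ?p]
      by (simp add: atLeast0LessThan add.commute)
    also have "\<dots> = (\<Prod>j\<in>{..<?p} - {0}. c)"
      by (rule prod.mono_neutral_cong_right) (auto dest: nat_dvd_not_less)
    also have "\<dots> = c ^ (?p - 1)" by simp
    finally show "(\<Prod>j\<in>{t * ?p..<t * ?p + ?p}. if ?p dvd j then 1 else c) = c ^ (?p - 1)" .
  qed
  also have "\<dots> = c ^ ((?p - 1) * n)" by (simp add: power_mult)
  finally show ?thesis by (simp add: mult.commute)
qed

text \<open>Approximants of \<open>r / (p - 1)\<close>, converging p-adically, below which the units can be counted.\<close>

fun quotient_approx :: "nat \<Rightarrow> nat \<Rightarrow> nat \<Rightarrow> nat" where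
  "quotient_approx p r 0 = 1"
| "quotient_approx p r (Suc k) = p * quotient_approx p r k - r"

text \<open>The map from \<open>N\<close> to \<open>p N - r\<close> fixes \<open>r / (p - 1)\<close>
  and multiplies the distance to it by \<open>p\<close>, which gives the closed form. The lower
  bound keeps the natural subtraction from being cut off at 0.\<close>

lemma quotient_approx:
  assumes "r \<le> p - 1" "p > 1"
  shows "quotient_approx p r k \<ge> 1 \<and> (p - 1) * quotient_approx p r k = (p - 1 - r) * p ^ k + r"
proof (induction k)
  case 0
  then show ?case using assms by simp
next
  case (Suc k)
  let ?n = "quotient_approx p r k"
  have "p * 1 \<le> p * ?n" using Suc by (intro mult_le_mono2) simp
  then have ge: "r < p * ?n" using assms by linarith
  have "(p - 1) * (p * ?n - r) + (p - 1) * r = p * ((p - 1) * ?n)"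
    using ge by (simp add: mult.left_commute flip: distrib_left)
  also have "\<dots> = p * ((p - 1 - r) * p ^ k + r)" using Suc by simp
  also have "\<dots> = (p - 1 - r) * p ^ Suc k + r + (p - 1) * r"
  proof -
    obtain t where "p - 1 = r + t" using assms(1) le_Suc_ex by blast
    then have "p = Suc (r + t)" using assms(2) by simp
    then show ?thesis by (simp add: algebra_simps)
  qed
  finally show ?case using ge by simp
qed

text \<open>The formula for natural numbers is applied along the approximants \<open>N k\<close> of
  \<open>x = r / (p - 1)\<close>. There are \<open>(p - 1 - r) p ^ k\<close> numbers prime to
  \<open>p\<close> below \<open>N (k + 1)\<close>, so the powers of \<open>m\<close> converge to the
  Teichmueller representative to the power \<open>p - 1 - r\<close>.\<close>

lemma padic_Gamma_multiplication:
  fixes w x :: "'p padic_int"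
  assumes w: "of_nat m * w = 1" and m: "\<not> CARD('p) dvd m"
    and x: "of_nat (CARD('p) - 1) * x = of_nat r" and r: "r < CARD('p) - 1"
  shows "(\<Prod>i<m. padic_Gamma ((x + of_nat i) * w)) =
    (\<Prod>i<m. padic_Gamma (of_nat i * w)) * padic_Gamma x * teichmuller (of_nat m :: 'p mod_ring) ^ r"
proof -
  let ?p = "CARD('p)" let ?q = "CARD('p) - 1" and ?t = "teichmuller (of_nat m :: 'p mod_ring)"
  define N where "N = quotient_approx ?p r"
  have N: "N k \<ge> 1" "?q * N k = (?q - r) * ?p ^ k + r" for k
    using quotient_approx[of r ?p k] r CARD_prime_gt_1[where 'p='p] by (simp_all add: N_def)
  have m0: "m > 0" using m by (cases m) auto
  have m': "of_nat m \<noteq> (0 :: 'p mod_ring)"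
    using m of_nat_0_mod_ring_dvd by blast
  have qunit: "(of_nat ?q :: 'p padic_int) dvd 1"
    unfolding of_nat_unit_padic_int_iff using CARD_prime_gt_1[where 'p='p]
      by (intro nat_dvd_not_less) auto
  have Nx: "padic_nth (of_nat (N k) :: 'p padic_int) k = padic_nth x k" for k
  proof (rule padic_nth_cancel_unit[OF _ qunit])
    have "of_nat ?q * of_nat (N k) - of_nat ?q * x = of_nat ?p ^ k * (of_nat (?q - r) :: 'p padic_int)"
      unfolding x of_nat_mult[symmetric] N(2) by simp
    then have "of_nat ?p ^ k dvd of_nat ?q * of_nat (N k) - of_nat ?q * x" by simp
    then show "padic_nth (of_nat ?q * of_nat (N k) :: 'p padic_int) k = padic_nth (of_nat ?q * x) k"
      by (simp only: padic_nth_eq_iff_dvd)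
  qed
  have units: "(\<Prod>j<N (Suc k). if ?p dvd j then 1 else of_nat m) =
    ((of_nat m :: 'p padic_int) ^ ?p ^ k) ^ (?q - r)" for k
  proof -
    have "?p * 1 \<le> ?p * N k" using N by (intro mult_le_mono2) simp
    then have "r \<le> ?p * N k" using r by linarith
    then have Suc: "N (Suc k) + r = ?p * N k" by (simp add: N_def)
    have "(\<Prod>j<?p * N k. if ?p dvd j then 1 else of_nat m :: 'p padic_int) =
       (\<Prod>j<N (Suc k). if ?p dvd j then 1 else of_nat m) *
         (\<Prod>j\<in>{N (Suc k)..<N (Suc k) + r}. if ?p dvd j then 1 else of_nat m)"
      unfolding Suc[symmetric] by (subst prod.union_disjoint[symmetric]) (auto intro!: prod.cong)
    also have "(\<Prod>j\<in>{N (Suc k)..<N (Suc k) + r}. if ?p dvd j then 1 else of_nat m :: 'p padic_int) =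
      (\<Prod>j\<in>{N (Suc k)..<N (Suc k) + r}. of_nat m)"
    proof (rule prod.cong[OF refl])
      fix j assume j: "j \<in> {N (Suc k)..<N (Suc k) + r}"
      \<comment> \<open>\<open>j\<close> lies at most \<open>r < p\<close> below the multiple
        \<open>p N k\<close> of \<open>p\<close>, and is not equal to it.\<close>
      have "\<not> ?p dvd j"
      proof
        assume "?p dvd j"
        then have "?p dvd ?p * N k - j" by simp
        moreover have "0 < ?p * N k - j" "?p * N k - j < ?p" using j Suc r by auto
        ultimately show False using nat_dvd_not_less by blast
      qed
      then show "(if ?p dvd j then 1 else of_nat m :: 'p padic_int) = of_nat m" by simp
    qed
    finally have A: "(of_nat m :: 'p padic_int) ^ (?q * N k) =
      (\<Prod>j<N (Suc k). if ?p dvd j then 1 else of_nat m) * of_nat m ^ r"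
      by (simp add: prod_units_power)
    have B: "(of_nat m :: 'p padic_int) ^ (?q * N k) = ((of_nat m) ^ ?p ^ k) ^ (?q - r) * of_nat m ^ r"
      unfolding N(2) by (simp only: power_add power_mult mult.commute[of "?q - r"])
    have nz: "(of_nat m :: 'p padic_int) ^ r \<noteq> 0" using m0 by simp
    show ?thesis using A[unfolded B] unfolding mult_right_cancel[OF nz] by (rule sym)
  qed
  have "(\<Prod>i<m. padic_Gamma ((x + of_nat i) * w)) * ?t ^ (?q - r) =
    (\<Prod>i<m. padic_Gamma (of_nat i * w)) * padic_Gamma x"
    unfolding padic_int_eq_iff
  proof
    fix k
    let ?k = "Suc k"
    have "padic_nth ((\<Prod>i<m. padic_Gamma ((x + of_nat i) * w)) * ?t ^ (?q - r)) ?k =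
        padic_nth ((\<Prod>i<m. padic_Gamma ((of_nat (N ?k) + of_nat i) * w)) *
          ((of_nat m) ^ ?p ^ k) ^ (?q - r)) ?k"
      by (intro padic_nth_mult_cong padic_nth_prod_cong padic_Gamma_cong padic_nth_add_cong
        padic_nth_power_cong
          Nx[symmetric] teichmuller_approx[OF m', symmetric] refl)
    also have "\<dots> = padic_nth ((\<Prod>i<m. padic_Gamma (of_nat i * w)) * padic_Gamma (of_nat (N ?k))) ?k"
      using padic_Gamma_multiplication_nat[OF w m0, of "N ?k"] by (simp only: units)
    also have "\<dots> = padic_nth ((\<Prod>i<m. padic_Gamma (of_nat i * w)) * padic_Gamma x) ?k"
      by (intro padic_nth_mult_cong padic_Gamma_cong Nx refl)
    finally have "padic_nth ((\<Prod>i<m. padic_Gamma ((x + of_nat i) * w)) * ?t ^ (?q - r)) ?k =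
      padic_nth ((\<Prod>i<m. padic_Gamma (of_nat i * w)) * padic_Gamma x) ?k" .
    then show "padic_nth ((\<Prod>i<m. padic_Gamma ((x + of_nat i) * w)) * ?t ^ (?q - r)) k =
      padic_nth ((\<Prod>i<m. padic_Gamma (of_nat i * w)) * padic_Gamma x) k"
      by (rule padic_nth_eq_mono[rotated]) simp
  qed
  note eq = this
  have inv: "?t ^ (?q - r) * ?t ^ r = 1"
    using r teichmuller_power[OF m'] by (simp flip: power_add)
  have "(\<Prod>i<m. padic_Gamma ((x + of_nat i) * w)) =
      ((\<Prod>i<m. padic_Gamma ((x + of_nat i) * w)) * ?t ^ (?q - r)) * ?t ^ r"
    by (simp only: mult.assoc inv mult_1_right)
  then show ?thesis by (simp only: eq)
qed

end

unbundle fps_syntax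

section \<open>Dwork's exponential\<close>

text \<open>The series \<open>exp(u y + v y^p)\<close>. The two parameters are independent so that
  the family is closed under products and contains \<open>exp(- y^p / p)\<close> and
  \<open>exp(z (p y + y^p))\<close> along with \<open>E(c y)\<close>.\<close>

definition dwork_exp :: "'p::prime_card padic \<Rightarrow> 'p padic \<Rightarrow> 'p padic fps" where
  "dwork_exp u v = fps_exp u * (fps_exp v oo fps_X ^ CARD('p))"

lemma dwork_exp_mult:
  "dwork_exp u v * dwork_exp u' v' = dwork_exp (u + u') (v + v' :: 'p::prime_card padic)"
  by (simp add: dwork_exp_def fps_exp_add_mult fps_compose_mult_distrib mult_ac)

lemma dwork_exp_0_right: "dwork_exp u 0 = fps_exp (u :: 'p::prime_card padic)"
  by (simp add: dwork_exp_def)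

lemma dwork_exp_deriv:
  fixes u v :: "'p::prime_card padic"
  shows "fps_deriv (dwork_exp u v) =
    (fps_const u + fps_const (of_nat CARD('p) * v) * fps_X ^ (CARD('p) - 1)) * dwork_exp u v"
  by (simp add: dwork_exp_def fps_compose_deriv fps_deriv_power' fps_const_mult[symmetric]
      fps_compose_mult_distrib algebra_simps fps_of_nat del: fps_const_mult)

definition dwork_coeff :: "nat \<Rightarrow> 'p::prime_card padic" where
  "dwork_coeff n = dwork_exp 1 (1 / of_nat CARD('p)) $ n"

lemma dwork_exp_nth:
  "dwork_exp u v $ n =
    (\<Sum>i\<le>n. u ^ i / fact i * (if CARD('p) dvd n -
      i then v ^ ((n - i) div CARD('p)) / fact ((n - i) div CARD('p)) else 0))"
  for u v :: "'p::prime_card padic"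
  by (simp add: dwork_exp_def fps_mult_nth fps_nth_compose_X_power atMost_atLeast0 if_distrib cong:
    if_cong)

text \<open>The left-hand series is \<open>E(c y)\<close>. For a Teichmueller representative
  \<open>c\<close> its second parameter is just \<open>c / p\<close>.\<close>

lemma dwork_exp_scale:
  fixes c :: "'p::prime_card padic"
  shows "dwork_exp c (c ^ CARD('p) / of_nat CARD('p)) $ n = dwork_coeff n * c ^ n"
proof -
  have "c ^ i / fact i * (if CARD('p) dvd n - i then (c ^ CARD('p) /
    of_nat CARD('p)) ^ ((n - i) div CARD('p)) / fact ((n - i) div CARD('p)) else 0) =
    1 ^ i / fact i * (if CARD('p) dvd n - i then (1 / of_nat CARD('p)) ^ ((n - i) div CARD('p)) /
      fact ((n - i) div CARD('p)) else 0) * c ^ n"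
    if "i \<le> n" for i
  proof (cases "CARD('p) dvd n - i")
    case True
    then obtain k where k: "n - i = CARD('p) * k" ..
    then have "n = i + CARD('p) * k" using that by simp
    then show ?thesis using k by (simp add: power_divide power_add power_mult)
  qed simp
  then show ?thesis
    unfolding dwork_coeff_def dwork_exp_nth sum_distrib_right by (intro sum.cong) auto
qed

text \<open>Extension by 0 to negative indices lets the recursion and the matrix of Frobenius be
  stated without boundary cases.\<close>

definition dwork_coeff_int :: "int \<Rightarrow> 'p::prime_card padic" where
  "dwork_coeff_int n = (if n < 0 then 0 else dwork_coeff (nat n))"

lemma dwork_coeff_int_of_nat [simp]: "dwork_coeff_int (int n) = dwork_coeff n"
  by (simp add: dwork_coeff_int_def)

text \<open>Coefficient comparison in the differential equation
  \<open>E' = (1 + y^(p-1)) E\<close>.\<close>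

lemma dwork_coeff_rec:
  "of_int n * dwork_coeff_int n = dwork_coeff_int (n - 1) +
    (dwork_coeff_int (n - int CARD('p)) :: 'p::prime_card padic)"
proof (cases "n \<le> 0")
  case True
  then show ?thesis
    using CARD_prime_gt_1[where 'p='p] by (auto simp: dwork_coeff_int_def)
next
  case False
  then obtain m where m: "n = int (Suc m)" by (metis not_le zero_less_imp_eq_int gr0_implies_Suc
    of_nat_0_less_iff)
  have "of_nat (Suc m) * dwork_coeff (Suc m) =
    fps_deriv (dwork_exp 1 (1 / of_nat CARD('p) :: 'p padic)) $ m"
    by (simp add: dwork_coeff_def)
  also have "\<dots> = dwork_coeff m + (if m < CARD('p) - 1 then 0 else dwork_coeff (m - (CARD('p) - 1)))"
    by (simp add: dwork_exp_deriv distrib_right dwork_coeff_def fps_X_power_mult_nth)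
  also have "(if m < CARD('p) - 1 then 0 else dwork_coeff (m - (CARD('p) - 1)) :: 'p padic) =
    dwork_coeff_int (n - int CARD('p))"
  proof (cases "m < CARD('p) - 1")
    case True
    then show ?thesis by (simp add: dwork_coeff_int_def m)
  next
    case False
    then have "n - int CARD('p) = int (m - (CARD('p) - 1))"
      using CARD_prime_gt_1[where 'p='p] by (simp add: m of_nat_diff)
    then show ?thesis using False by (simp only: dwork_coeff_int_of_nat if_False)
  qed
  finally show ?thesis
    using dwork_coeff_int_of_nat[of "Suc m", where 'a='p] dwork_coeff_int_of_nat[of m, where 'a='p]
    by (simp only: m of_int_of_nat_eq) simp
qed

lemma of_nat_div_eq:
  assumes "a < p" "i \<le> a + p * z" "p dvd (a + p * z) - i" "(p::nat) > 0"
  shows "\<exists>j\<le>z. i = a + p * j"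
proof -
  obtain k where k: "a + p * z - i = p * k" using assms(3) ..
  then have e: "a + p * z = i + p * k" using assms(2) by linarith
  have "k \<le> z"
  proof (rule ccontr)
    assume "\<not> k \<le> z"
    then have "p * Suc z \<le> p * k" by (intro mult_le_mono2) simp
    then show False using e assms(1) by simp
  qed
  then have "i = a + p * (z - k)" using e by (simp add: diff_mult_distrib2)
  then show ?thesis by (intro exI[of _ "z - k"]) simp
qed

lemma inverse_fact_dwork:
  assumes "a < CARD('p)"
  shows "1 / fact (a + CARD('p) * z) =
    (\<Sum>j\<le>z. dwork_coeff (a + CARD('p) * j) * ((- 1 / of_nat CARD('p)) ^ (z - j) /
      fact (z - j)) :: 'p::prime_card padic)"
proof -
  let ?p = "CARD('p)" and ?n = "a + CARD('p) * z"
  have "fps_exp 1 = dwork_exp 1 (1 / of_nat ?p) * dwork_exp 0 (- 1 / of_nat ?p :: 'p padic)"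
    by (simp add: dwork_exp_mult dwork_exp_0_right)
  then have "1 / fact ?n = (dwork_exp 1 (1 / of_nat ?p) *
    dwork_exp 0 (- 1 / of_nat ?p :: 'p padic)) $ ?n"
    using fps_exp_nth[of "1 :: 'p padic" ?n] by (simp only: power_one of_nat_fact)
  also have "\<dots> = (\<Sum>i\<le>?n. dwork_coeff i * (if ?p dvd ?n -
    i then (- 1 / of_nat ?p) ^ ((?n - i) div ?p) / fact ((?n - i) div ?p) else 0))"
    by (simp add: fps_mult_nth dwork_coeff_def dwork_exp_def[of 0] fps_nth_compose_X_power
      atMost_atLeast0 cong: if_cong)
  also have "\<dots> = (\<Sum>i\<in>(\<lambda>j. a + ?p * j) ` {..z}. dwork_coeff i *
    ((- 1 / of_nat ?p) ^ ((?n - i) div ?p) / fact ((?n - i) div ?p)))"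
  proof (rule sum.mono_neutral_cong_right)
    show "\<forall>i\<in>{..?n} - (\<lambda>j. a + ?p * j) ` {..z}. dwork_coeff i *
      (if ?p dvd ?n - i then (- 1 / of_nat ?p) ^ ((?n - i) div ?p) /
      fact ((?n - i) div ?p) else 0 :: 'p padic) = 0"
      using of_nat_div_eq[OF assms, of _ z] by fastforce
  next
    fix i assume "i \<in> (\<lambda>j. a + ?p * j) ` {..z}"
    then obtain j where "j \<le> z" "i = a + ?p * j" by auto
    then have "?p dvd ?n - i" by (simp flip: diff_mult_distrib2)
    then show "dwork_coeff i * (if ?p dvd ?n -
      i then (- 1 / of_nat ?p) ^ ((?n - i) div ?p) / fact ((?n - i) div ?p) else 0) =
        (dwork_coeff i * ((- 1 / of_nat ?p) ^ ((?n - i) div ?p) / fact ((?n - i) div ?p)) :: 'p padic)"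
          by simp
  qed auto
  also have "\<dots> = (\<Sum>j\<le>z. dwork_coeff (a + ?p * j) * ((- 1 / of_nat ?p) ^ (z - j) / fact (z - j)))"
    by (subst sum.reindex) (auto intro!: inj_onI sum.cong simp flip: diff_mult_distrib2)
  finally show ?thesis .
qed

context
  assumes odd: "odd CARD('p::prime_card)"
begin

section \<open>Gamma at negative integers and the size of factorials\<close>

lemma CARD_ge_3: "CARD('p) \<ge> 3"
  using CARD_prime_gt_1[where 'p='p] odd by (cases "CARD('p) = 2") auto

text \<open>The numbers up to \<open>n\<close> prime to \<open>p\<close> multiply to
  \<open>n!\<close> divided by \<open>p^k k!\<close> with \<open>k = n div p\<close>. This formula
  links gamma with the coefficients \<open>1 / n!\<close> of the exponential series.\<close>

lemma padic_Gamma_minus_nat: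
  "to_fract (padic_Gamma (- of_nat n)) =
    ((- of_nat CARD('p)) ^ (n div CARD('p)) * fact (n div CARD('p)) / fact n :: 'p padic)"
proof (induction n)
  case 0
  then show ?case by (simp add: padic_Gamma_0[OF odd])
next
  case (Suc n)
  let ?p = "CARD('p)" and ?x = "- of_nat (Suc n) :: 'p padic_int"
  have x: "?x + 1 = - of_nat n" by simp
  have dvd: "of_nat ?p dvd ?x \<longleftrightarrow> ?p dvd Suc n"
    unfolding dvd_minus_iff by (rule of_nat_dvd_padic_int_iff)
  have eq: "to_fract (padic_Gamma (- of_nat n)) =
      - (if ?p dvd Suc n then 1 else - of_nat (Suc n)) * (to_fract (padic_Gamma ?x) :: 'p padic)"
    using padic_Gamma_plus_1[OF odd, of ?x] unfolding x dvd
    by (simp add: to_fract_of_nat)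
  show ?case
  proof (cases "?p dvd Suc n")
    case True
    then obtain k where k: "Suc n = ?p * k" ..
    then obtain k' where k': "k = Suc k'" by (cases k) auto
    have "n = ?p * k' + (?p - 1)" using k k' CARD_prime_gt_1[where 'p='p] by simp
    then have "n div ?p = k'" using CARD_prime_gt_1[where 'p='p]
      by (subst \<open>n = _\<close>, subst div_mult_self4) auto
    moreover have "Suc n div ?p = k" using k by simp
    moreover have "(of_nat (Suc n) :: 'p padic) = of_nat ?p * of_nat k" unfolding k by simp
    moreover have "to_fract (padic_Gamma ?x) = - (to_fract (padic_Gamma (- of_nat n)) :: 'p padic)"
      using eq True by simp
    ultimately show ?thesis
      using Suc by (simp only: k' fact_Suc power_Suc) (simp add: field_simps del: of_nat_Suc)
  next
    case False
    then have "Suc n div ?p = n div ?p" by (simp add: div_Suc dvd_eq_mod_eq_0)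
    moreover have "to_fract (padic_Gamma ?x) =
      (to_fract (padic_Gamma (- of_nat n)) / of_nat (Suc n) :: 'p padic)"
      using eq False by (simp add: field_simps del: of_nat_Suc)
    ultimately show ?thesis using Suc by simp
  qed
qed

lemma minus_power_cancel:
  assumes "x \<noteq> 0"
  shows "(- x) ^ m * ((- 1) ^ m * x powi (- int m)) = (1 :: 'a::field)"
proof -
  have "(- x) ^ m * (- 1) ^ m = x ^ m" by (simp flip: power_mult_distrib)
  then show ?thesis using assms by (simp add: power_int_minus flip: mult.assoc)
qed

text \<open>Legendre's bound. By the previous formula \<open>n!\<close> is a unit times
  \<open>p^m m!\<close> with \<open>m = n div p\<close>, and the induction runs over
  \<open>m\<close>.\<close>

lemma vge_inverse_fact:
  assumes "n \<ge> 1"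
  shows "vge (- (real n - 1) / (real CARD('p) - 1)) (1 / fact n :: 'p padic)"
  using assms
proof (induction n rule: less_induct)
  case (less n)
  let ?p = "CARD('p)" and ?m = "n div CARD('p)"
  have p: "real ?p > 1" using CARD_prime_gt_1[where 'p='p] by simp
  have eq: "1 / fact n = to_fract (padic_Gamma (- of_nat n)) *
    ((- 1) ^ ?m * ((of_nat ?p powi (- int ?m)) * (1 / fact ?m) :: 'p padic))"
  proof -
    have "(- of_nat ?p) ^ ?m * fact ?m / fact n *
      ((- 1) ^ ?m * (of_nat ?p powi (- int ?m) * (1 / fact ?m))) =
      ((- of_nat ?p) ^ ?m * ((- 1) ^ ?m * of_nat ?p powi (- int ?m))) *
        ((fact ?m * (1 / fact ?m)) * (1 / fact n) :: 'p padic)"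
      by (simp only: divide_inverse mult_ac mult_1_left mult_1_right)
    then show ?thesis
      unfolding padic_Gamma_minus_nat minus_power_cancel[OF CARD_padic_nonzero] by simp
  qed
  have sgn: "vge 0 ((- 1) ^ ?m :: 'p padic)"
    using vge_power[of 0 "- 1 :: 'p padic" ?m] by simp
  show ?case
  proof (cases "?m = 0")
    case True
    have "vge 0 (1 / fact n :: 'p padic)" unfolding eq using True by simp
    then show ?thesis by (rule vge_mono) (use less.prems p in \<open>simp add: divide_le_0_iff\<close>)
  next
    case False
    then have m: "?m \<ge> 1" by simp
    have "?m < n" using CARD_prime_gt_1[where 'p='p] less.prems by (intro div_less_dividend) auto
    then have "vge (- (real ?m - 1) / (real ?p - 1)) (1 / fact ?m :: 'p padic)" using less.IH m by blast
    then have B: "vge (- real ?m + - (real ?m - 1) / (real ?p - 1)) (of_nat ?p powi (- int ?m) *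
      (1 / fact ?m) :: 'p padic)"
      by (intro vge_mult vge_CARD_powi) simp_all
    have *: "vge (0 + (0 + (- real ?m + - (real ?m - 1) / (real ?p - 1)))) (1 / fact n :: 'p padic)"
      unfolding eq by (rule vge_mult[OF vge_to_fract vge_mult[OF sgn B]]) simp
    have "real ?p * real ?m \<le> real n"
      using times_div_less_eq_dividend[of ?p n] by (simp flip: of_nat_mult)
    then have "- (real n - 1) / (real ?p - 1) \<le> - (real ?p * real ?m - 1) / (real ?p - 1)"
      using p by (intro divide_right_mono) auto
    also have "\<dots> = - real ?m + - (real ?m - 1) / (real ?p - 1)"
      using p by (simp add: divide_simps) (simp add: algebra_simps)
    finally have "- (real n - 1) / (real ?p - 1) \<le> - real ?m + - (real ?m - 1) / (real ?p - 1)" .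
    then show ?thesis using * by (auto intro: vge_mono)
  qed
qed

lemma vge_inverse_fact': "vge (- real n / (real CARD('p) - 1)) (1 / fact n :: 'p padic)"
proof (cases "n = 0")
  case False
  have "vge (- (real n - 1) / (real CARD('p) - 1)) (1 / fact n :: 'p padic)"
    using False by (intro vge_inverse_fact) simp
  then show ?thesis
    by (rule vge_mono) (use CARD_ge_3 in \<open>intro divide_right_mono, auto\<close>)
qed simp

section \<open>Differences of the p-adic gamma function\<close>

definition fdiff :: "(int \<Rightarrow> 'p padic) \<Rightarrow> int \<Rightarrow> 'p padic" where
  "fdiff f z = f (z + 1) - f z"

lemma fdiff_iter_Suc: "(fdiff ^^ Suc j) f = (fdiff ^^ j) (fdiff f)"
  by (simp add: funpow_swap1)

lemma fdiff_iter_add: "(fdiff ^^ j) (\<lambda>z. f z + g z) = (\<lambda>z. (fdiff ^^ j) f z + (fdiff ^^ j) g z)"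
  by (induction j) (simp_all add: fdiff_def fun_eq_iff)

lemma fdiff_iter_shift: "(fdiff ^^ j) (\<lambda>z. f (z + 1)) z = (fdiff ^^ j) f (z + 1)"
  by (induction j arbitrary: z) (simp_all add: fdiff_def)

lemma fdiff_mult: "fdiff (\<lambda>z. f z * g z) = (\<lambda>z. fdiff f z * g (z + 1) + f z * fdiff g z)"
  by (simp add: fdiff_def fun_eq_iff algebra_simps)

text \<open>The Leibniz rule for differences, kept as an estimate. The bounds on the factors are
  uniform in \<open>z\<close> because each application shifts the argument of one factor.\<close>

lemma fdiff_iter_mult_vge:
  assumes "\<And>i z. i \<le> j \<Longrightarrow> vge (hf i) ((fdiff ^^ i) f z)"
    and "\<And>i z. i \<le> j \<Longrightarrow> vge (hg i) ((fdiff ^^ i) g z)"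
    and "\<And>i. i \<le> j \<Longrightarrow> r \<le> hf i + hg (j - i)"
  shows "vge r ((fdiff ^^ j) (\<lambda>z. f z * g z) z)"
  using assms
proof (induction j arbitrary: f g hf hg z)
  case 0
  have "vge (hf 0) (f z)" "vge (hg 0) (g z)" using 0(1,2)[of 0] by simp_all
  then show ?case using 0(3)[of 0] by (simp add: vge_mult')
next
  case (Suc j)
  have "vge r ((fdiff ^^ j) (\<lambda>z. fdiff f z * g (z + 1)) z)"
  proof (rule Suc.IH)
    show "vge (hf (Suc i)) ((fdiff ^^ i) (fdiff f) z)" if "i \<le> j" for i z
      using Suc.prems(1)[of "Suc i" z] that unfolding fdiff_iter_Suc by simp
    show "vge (hg i) ((fdiff ^^ i) (\<lambda>z. g (z + 1)) z)" if "i \<le> j" for i z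
      using Suc.prems(2)[of i "z + 1"] that unfolding fdiff_iter_shift by simp
    show "r \<le> hf (Suc i) + hg (j - i)" if "i \<le> j" for i
      using Suc.prems(3)[of "Suc i"] that by simp
  qed
  moreover have "vge r ((fdiff ^^ j) (\<lambda>z. f z * fdiff g z) z)"
  proof (rule Suc.IH)
    show "vge (hf i) ((fdiff ^^ i) f z)" if "i \<le> j" for i z
      using Suc.prems(1)[of i z] that by simp
    show "vge (hg (Suc i)) ((fdiff ^^ i) (fdiff g) z)" if "i \<le> j" for i z
      using Suc.prems(2)[of "Suc i" z] that unfolding fdiff_iter_Suc by simp
    show "r \<le> hf i + hg (Suc (j - i))" if "i \<le> j" for i
      using Suc.prems(3)[of i] that by (simp add: Suc_diff_le)
  qed
  ultimately show ?case
    unfolding fdiff_iter_Suc fdiff_mult fdiff_iter_add by (rule vge_add)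
qed

text \<open>At \<open>n = 0\<close> only \<open>c j\<close> survives, so the Newton coefficients can
  be bounded through iterated differences.\<close>

lemma fdiff_iter_newton:
  assumes "\<And>n. f (int n) = (\<Sum>j\<le>n. c j * of_nat (n choose j))"
  shows "(fdiff ^^ j) f (int n) = (\<Sum>i\<le>n. c (i + j) * of_nat (n choose i))"
proof (induction j arbitrary: n)
  case 0
  then show ?case using assms by simp
next
  case (Suc j)
  let ?c = "\<lambda>i. c (i + j)"
  have ext: "(\<Sum>i\<le>n. ?c i * of_nat (n choose i)) = (\<Sum>i\<le>Suc n. ?c i * of_nat (n choose i))" by simp
  have "(fdiff ^^ Suc j) f (int n) = (fdiff ^^ j) f (int (Suc n)) - (fdiff ^^ j) f (int n)"
    by (simp add: fdiff_def add.commute)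
  also have "\<dots> = (\<Sum>i\<le>Suc n. ?c i * of_nat (Suc n choose i)) - (\<Sum>i\<le>Suc n. ?c i * of_nat (n choose i))"
    by (simp only: Suc ext)
  also have "\<dots> = (\<Sum>i\<le>n. ?c (Suc i) * of_nat (n choose i))"
    unfolding sum.atMost_Suc_shift by (simp add: algebra_simps sum.distrib)
  finally show ?case by simp
qed

section \<open>Congruences for gamma along an arithmetic progression of step p\<close>

lemma sum_inverse_mod_ring: "(\<Sum>c\<in>UNIV - {0}. inverse c) = (0 :: 'p mod_ring)"
proof -
  let ?S = "\<Sum>c\<in>UNIV - {0}. inverse c :: 'p mod_ring"
  have "bij_betw uminus (UNIV - {0}) (UNIV - {0 :: 'p mod_ring})"
    by (rule bij_betwI[of _ _ _ uminus]) auto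
  then have "?S = (\<Sum>c\<in>UNIV - {0}. inverse (- c))"
    using sum.reindex_bij_betw[of uminus "UNIV - {0 :: 'p mod_ring}" "UNIV - {0}" inverse] by simp
  also have "\<dots> = - ?S" by (simp add: inverse_minus_eq sum_negf)
  finally have "?S + ?S = 0" by (rule iffD1[OF eq_neg_iff_add_eq_0])
  then have "of_nat 2 * ?S = 0" by (simp only: of_nat_numeral mult_2)
  moreover have "of_nat 2 \<noteq> (0 :: 'p mod_ring)"
  proof
    assume "of_nat 2 = (0 :: 'p mod_ring)"
    then have "CARD('p) dvd 2" by (rule of_nat_0_mod_ring_dvd)
    from dvd_imp_le[OF this] show False using CARD_ge_3 by simp
  qed
  ultimately show ?thesis by simp
qed

lemma prod_unit_shift_mod_square:
  fixes u v :: "'i \<Rightarrow> 'p padic_int"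
  assumes "\<And>i. i \<in> I \<Longrightarrow> u i * v i = 1"
  shows "of_nat CARD('p) ^ 2 dvd (\<Prod>i\<in>I. u i - of_nat CARD('p) * y) -
    (\<Prod>i\<in>I. u i) * (1 - of_nat CARD('p) * y * (\<Sum>i\<in>I. v i))"
  using assms
proof (induction I rule: infinite_finite_induct)
  case (insert x I)
  let ?p = "of_nat CARD('p) :: 'p padic_int"
  let ?P = "\<Prod>i\<in>I. u i - ?p * y" and ?U = "\<Prod>i\<in>I. u i" and ?V = "\<Sum>i\<in>I. v i"
  obtain c where c: "?P - ?U * (1 - ?p * y * ?V) = ?p ^ 2 * c" using insert by (auto elim: dvdE)
  then have P: "?P = ?U * (1 - ?p * y * ?V) + ?p ^ 2 * c" by (simp add: algebra_simps)
  have e: "u x * v x * w = w" for w using insert.prems[of x] by simp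
  have "(u x - ?p * y) * ?P - (u x * ?U) * (1 - ?p * y * (v x + ?V)) =
      ?p ^ 2 * ((u x - ?p * y) * c + ?U * y ^ 2 * ?V) + (u x * v x * (?U * ?p * y) - ?U * ?p * y)"
    unfolding P by (simp add: algebra_simps power2_eq_square)
  then have "(u x - ?p * y) * ?P - (u x * ?U) * (1 - ?p * y * (v x + ?V)) =
    ?p ^ 2 * ((u x - ?p * y) * c + ?U * y ^ 2 * ?V)"
    unfolding e by simp
  then have "?p ^ 2 dvd (u x - ?p * y) * ?P - (u x * ?U) * (1 - ?p * y * (v x + ?V))" by simp
  then show ?case using insert.hyps by simp
qed simp_all

context
  fixes a :: nat
  assumes a: "a < CARD('p)"
begin

text \<open>The factor produced by \<open>p\<close> steps of the functional equation starting from
  \<open>- (a + p y)\<close>. The argument is divisible by \<open>p\<close> exactly at step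
  \<open>i = a\<close>, which contributes only a sign.\<close>

definition gamma_block :: "'p padic_int \<Rightarrow> 'p padic_int" where
  "gamma_block y = (\<Prod>i<CARD('p). - (if i = a then 1 else of_nat i - of_nat a - of_nat CARD('p) * y))"

lemma residue_diff_nat_eq_0_iff:
  assumes "i < CARD('p)"
  shows "(of_nat i - of_nat a :: 'p mod_ring) = 0 \<longleftrightarrow> i = a"
proof
  assume "(of_nat i - of_nat a :: 'p mod_ring) = 0"
  then have eq: "(of_nat i :: 'p mod_ring) = of_nat a" by simp
  show "i = a"
  proof (rule ccontr)
    assume "i \<noteq> a"
    then consider "i < a" | "a < i" by linarith
    then show False
    proof cases
      case 1
      then have "of_nat (a - i) = (0 :: 'p mod_ring)" using eq by (simp add: of_nat_diff)
      then have "CARD('p) dvd a - i" by (rule of_nat_0_mod_ring_dvd)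
      then show False using 1 a by (auto dest: dvd_imp_le)
    next
      case 2
      then have "of_nat (i - a) = (0 :: 'p mod_ring)" using eq by (simp add: of_nat_diff)
      then have "CARD('p) dvd i - a" by (rule of_nat_0_mod_ring_dvd)
      then show False using 2 assms by (auto dest: dvd_imp_le)
    qed
  qed
qed simp

lemma padic_Gamma_block:
  fixes y :: "'p padic_int"
  shows "padic_Gamma (- (of_nat a + of_nat CARD('p) * (y - 1))) =
    gamma_block y * padic_Gamma (- (of_nat a + of_nat CARD('p) * y))"
proof -
  let ?x = "- (of_nat a + of_nat CARD('p) * y)"
  have "padic_Gamma (?x + of_nat n) = (\<Prod>i<n. -
    (if i = a then 1 else of_nat i - of_nat a - of_nat CARD('p) * y)) * padic_Gamma ?x"
    if "n \<le> CARD('p)" for n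
    using that
  proof (induction n)
    case (Suc n)
    have e1: "?x + of_nat n = of_nat n - of_nat a - of_nat CARD('p) * y" by simp
    have e2: "?x + of_nat (Suc n) = (?x + of_nat n) + 1" by simp
    have "padic_residue (?x + of_nat n) = of_nat n - of_nat a"
      unfolding e1 padic_residue_diff padic_residue_mult padic_residue_of_nat by simp
    then have dv: "of_nat CARD('p) dvd ?x + of_nat n \<longleftrightarrow> n = a"
      using residue_diff_nat_eq_0_iff[of n] Suc.prems
      by (simp only: padic_residue_eq_0_iff[symmetric] Suc_le_eq)
    have IH: "padic_Gamma (?x + of_nat n) = (\<Prod>i<n. -
      (if i = a then 1 else of_nat i - of_nat a - of_nat CARD('p) * y)) * padic_Gamma ?x"
      using Suc by simp
    show ?case
      unfolding e2 padic_Gamma_plus_1[OF odd] dv IH unfolding e1 prod.lessThan_Suc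
        by (simp only: mult_ac)
  qed simp
  from this[of "CARD('p)"] show ?thesis
    by (simp add: gamma_block_def algebra_simps)
qed

text \<open>Modulo \<open>p^2\<close> the block is affine in \<open>y\<close>, with linear
  coefficient \<open>p\<close> times the sum of the inverses of \<open>i - a\<close>. Modulo
  \<open>p\<close> these run through the inverses of all nonzero residues, whose sum vanishes, so
  the dependence on \<open>y\<close> disappears.\<close>

lemma gamma_block_mod_square:
  "of_nat CARD('p) ^ 2 dvd gamma_block y - gamma_block y'"
proof -
  let ?p = "of_nat CARD('p) :: 'p padic_int" and ?I = "{..<CARD('p)} - {a}"
  let ?u = "\<lambda>i. of_nat i - of_nat a :: 'p padic_int"
  have "\<exists>v. ?u i * v = 1" if "i \<in> ?I" for i
  proof -
    have "?u i dvd 1"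
      using residue_diff_nat_eq_0_iff[of i] that by (simp add: padic_int_unit_iff padic_residue_diff)
    then show ?thesis by (metis dvdE)
  qed
  then obtain v where v: "\<And>i. i \<in> ?I \<Longrightarrow> ?u i * v i = 1" by metis
  have res: "padic_residue (v i) = inverse (of_nat i - of_nat a)" if "i \<in> ?I" for i
  proof -
    have "(of_nat i - of_nat a) * padic_residue (v i) = 1"
      using v[OF that] by (metis padic_residue_1 padic_residue_diff padic_residue_mult
        padic_residue_of_nat)
    then show ?thesis by (simp add: inverse_unique)
  qed
  have bij: "bij_betw (\<lambda>i. of_nat i - of_nat a :: 'p mod_ring) ?I (UNIV - {0})"
    unfolding bij_betw_def
  proof
    show inj: "inj_on (\<lambda>i. of_nat i - of_nat a :: 'p mod_ring) ?I"
    proof (rule inj_onI)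
      fix i j assume "i \<in> ?I" "j \<in> ?I" "(of_nat i - of_nat a :: 'p mod_ring) = of_nat j - of_nat a"
      then have "(of_nat i :: 'p mod_ring) = of_nat j" "i < CARD('p)" "j < CARD('p)" by simp_all
      then have "int i mod int CARD('p) = int j mod int CARD('p)"
        by (metis of_int_of_nat_eq of_int_of_int_mod_ring to_int_mod_ring_of_int_mod_ring of_nat_0_le_iff
          of_nat_less_iff)
      then show "i = j" using \<open>i < CARD('p)\<close> \<open>j < CARD('p)\<close> by simp
    qed
    show "(\<lambda>i. of_nat i - of_nat a :: 'p mod_ring) ` ?I = UNIV - {0}"
    proof (rule card_subset_eq)
      show "(\<lambda>i. of_nat i - of_nat a :: 'p mod_ring) ` ?I \<subseteq> UNIV - {0}"
        using residue_diff_nat_eq_0_iff by auto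
      show "card ((\<lambda>i. of_nat i - of_nat a :: 'p mod_ring) ` ?I) = card (UNIV - {0 :: 'p mod_ring})"
        using a by (simp add: card_image[OF inj] card_Diff_singleton)
    qed simp
  qed
  have "padic_residue (\<Sum>i\<in>?I. v i) = (\<Sum>i\<in>?I. inverse (of_nat i - of_nat a))"
    by (simp add: padic_residue_sum res)
  also have "\<dots> = 0"
    using sum.reindex_bij_betw[OF bij, of inverse] sum_inverse_mod_ring by simp
  finally have "?p dvd (\<Sum>i\<in>?I. v i)" by (simp add: padic_residue_eq_0_iff)
  then obtain s where s: "(\<Sum>i\<in>?I. v i) = ?p * s" ..
  have "?p ^ 2 dvd (\<Prod>i\<in>?I. ?u i - ?p * y) - (\<Prod>i\<in>?I. ?u i)" for y
  proof -
    have "(\<Prod>i\<in>?I. ?u i - ?p * y) - (\<Prod>i\<in>?I. ?u i) =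
      ((\<Prod>i\<in>?I. ?u i - ?p * y) - (\<Prod>i\<in>?I. ?u i) * (1 - ?p * y * (\<Sum>i\<in>?I. v i))) +
        ?p ^ 2 * (- (\<Prod>i\<in>?I. ?u i) * y * s)"
      unfolding s by (simp add: algebra_simps power2_eq_square)
    moreover have "?p ^ 2 dvd (\<Prod>i\<in>?I. ?u i - ?p * y) - (\<Prod>i\<in>?I. ?u i) * (1 - ?p * y * (\<Sum>i\<in>?I. v i))"
      by (rule prod_unit_shift_mod_square) (rule v)
    ultimately show ?thesis by (metis dvd_add dvd_triv_left)
  qed
  from dvd_diff[OF this[of y] this[of y']]
  have D: "?p ^ 2 dvd (\<Prod>i\<in>?I. ?u i - ?p * y) - (\<Prod>i\<in>?I. ?u i - ?p * y')" by simp
  have gb: "gamma_block y = - (\<Prod>i\<in>?I. ?u i - ?p * y)" for y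
  proof -
    have "gamma_block y = (\<Prod>i<CARD('p). - 1) * (\<Prod>i<CARD('p). if i = a then 1 else ?u i - ?p * y)"
      unfolding gamma_block_def prod.distrib[symmetric] by (intro prod.cong) auto
    also have "(\<Prod>i<CARD('p). if i = a then 1 else ?u i - ?p * y) = (\<Prod>i\<in>?I. ?u i - ?p * y)"
      by (rule prod.mono_neutral_cong_right) auto
    finally show ?thesis using odd by simp
  qed
  have "gamma_block y - gamma_block y' = - ((\<Prod>i\<in>?I. ?u i - ?p * y) - (\<Prod>i\<in>?I. ?u i - ?p * y'))"
    by (simp only: gb) simp
  then show ?thesis using D by (simp only: dvd_minus_iff)
qed

definition gamma_fun :: "int \<Rightarrow> 'p padic" where
  "gamma_fun z = to_fract (padic_Gamma (- (of_nat a + of_nat CARD('p) * of_int z)))"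

definition block_fun :: "int \<Rightarrow> 'p padic" where
  "block_fun z = to_fract (gamma_block (of_int z))"

lemma gamma_fun_rec: "gamma_fun z = block_fun (z + 1) * gamma_fun (z + 1)"
  using padic_Gamma_block[of "of_int (z + 1)"]
  by (simp add: gamma_fun_def block_fun_def)

lemma fdiff_const: "(fdiff ^^ j) (\<lambda>z. c) = (\<lambda>z. if j = 0 then c else 0)"
  by (induction j) (simp_all add: fdiff_def fun_eq_iff)

text \<open>Each factor is affine in \<open>z\<close> with slope 0 or \<open>p\<close>, so every
  difference gains a \<open>p\<close>; the Leibniz estimate passes this to the product.\<close>

lemma block_fun_vge: "vge (real j) ((fdiff ^^ j) block_fun z)"
proof -
  define g where "g = (\<lambda>i z. to_fract (- (if i =
    a then 1 else of_nat i - of_nat a - of_nat CARD('p) * of_int z)) :: 'p padic)"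
  have lin: "vge (real j) ((fdiff ^^ j) (g i) z)" for i j z
  proof (cases j)
    case (Suc k)
    have "fdiff (g i) = (\<lambda>z. if i = a then 0 else of_nat CARD('p))"
      by (simp add: g_def fdiff_def fun_eq_iff to_fract_of_nat to_fract_of_int algebra_simps)
    moreover have "vge 1 (of_nat CARD('p) :: 'p padic)" using vge_CARD_power[of 1 1, where 'p='p] by simp
    ultimately show ?thesis
      unfolding Suc fdiff_iter_Suc by (simp only:) (simp add: fdiff_const)
  qed (simp add: g_def)
  have "vge (real j) ((fdiff ^^ j) (\<lambda>z. \<Prod>i\<in>I. g i z) z)" for I j z
  proof (induction I arbitrary: j z rule: infinite_finite_induct)
    case (insert x I)
    have "vge (real j) ((fdiff ^^ j) (\<lambda>z. g x z * (\<Prod>i\<in>I. g i z)) z)"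
      by (rule fdiff_iter_mult_vge[of j real _ real]) (use lin insert.IH in auto)
    then show ?case using insert.hyps by simp
  qed (simp_all add: fdiff_const)
  moreover have "block_fun = (\<lambda>z. \<Prod>i<CARD('p). g i z)"
    by (simp add: block_fun_def gamma_block_def g_def to_fract_prod fun_eq_iff)
  ultimately show ?thesis by simp
qed

text \<open>By \<open>gamma_fun_rec\<close> a difference of \<open>gamma_fun\<close> is, after a
  shift, \<open>gamma_fun\<close> times \<open>q = 1 - block_fun\<close>. If the \<open>i\<close>-th
  difference of \<open>q\<close> is bounded by \<open>h i\<close>, the Leibniz estimate yields every
  slope \<open>c\<close> with \<open>c (i + 1) \<le> h i\<close> for all \<open>i\<close>. The
  values of \<open>h\<close> are 1, 2, 2, 3, ..., so \<open>i = 2\<close> dictates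
  \<open>c = 2 / 3\<close>. The entry 2 at \<open>i = 1\<close> is the congruence modulo
  \<open>p^2\<close>; with 1 there, \<open>c\<close> would drop to \<open>1 / 2\<close>.\<close>

lemma gamma_fun_vge: "vge (2 / 3 * real j) ((fdiff ^^ j) gamma_fun z)"
proof (induction j arbitrary: z rule: less_induct)
  case (less j)
  show ?case
  proof (cases j)
    case 0
    then show ?thesis by (simp add: gamma_fun_def)
  next
    case (Suc k)
    define q where "q = (\<lambda>z. 1 - block_fun z)"
    define h where "h = (\<lambda>i::nat. if i = 0 then 1 else if i = 1 then 2 else real i)"
    have fd: "fdiff gamma_fun = (\<lambda>z. gamma_fun (z + 1) * q (z + 1))"
    proof
      fix z
      show "fdiff gamma_fun z = gamma_fun (z + 1) * q (z + 1)"
        unfolding fdiff_def q_def by (subst (2) gamma_fun_rec) (simp add: algebra_simps)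
    qed
    have q0: "vge 1 (q z)" for z
    proof -
      let ?x = "- (of_nat a + of_nat CARD('p) * of_int z) :: 'p padic_int"
      let ?y = "- (of_nat a + of_nat CARD('p) * (of_int z - 1)) :: 'p padic_int"
      have "?x - ?y = of_nat CARD('p) ^ 1 * (- 1)" by (simp add: algebra_simps)
      then have "padic_nth ?x 1 = padic_nth ?y 1" unfolding padic_nth_eq_iff_dvd by (metis dvd_triv_left)
      from padic_Gamma_cong[OF odd this]
      have "vge (real 1) (to_fract (padic_Gamma ?x) - to_fract (padic_Gamma ?y) :: 'p padic)"
        by (simp only: vge_diff_to_fract_iff)
      then have *: "vge 1 (gamma_fun z - gamma_fun (z - 1))" by (simp add: gamma_fun_def)
      have nz: "gamma_fun z \<noteq> 0"
        using padic_Gamma_unit[OF odd, of ?x] by (auto simp: gamma_fun_def)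
      have "gamma_fun (z - 1) = block_fun z * gamma_fun z" using gamma_fun_rec[of "z - 1"] by simp
      then have "q z = (gamma_fun z - gamma_fun (z - 1)) * inverse (gamma_fun z)"
        using nz by (simp add: q_def field_simps)
      moreover have "vge 0 (inverse (gamma_fun z))"
        unfolding gamma_fun_def by (rule vge_inverse_unit) (rule padic_Gamma_unit[OF odd])
      ultimately show ?thesis using vge_mult'[OF *, of 0 "inverse (gamma_fun z)" 1] by simp
    qed
    have q1: "vge 2 (fdiff q z)" for z
    proof -
      have "of_nat CARD('p) ^ 2 dvd gamma_block (of_int z) - gamma_block (of_int (z + 1))"
        by (rule gamma_block_mod_square)
      then have "vge (real 2) (to_fract (gamma_block (of_int z) -
        gamma_block (of_int (z + 1))) :: 'p padic)"
        by (simp only: vge_to_fract_iff)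
      then show ?thesis by (simp add: fdiff_def q_def block_fun_def)
    qed
    have qj: "(fdiff ^^ i) q z = - (fdiff ^^ i) block_fun z" if "i \<ge> 1" for i z
    proof -
      have "(fdiff ^^ n) (\<lambda>z. - f z) z = - (fdiff ^^ n) f z" for n f z
        by (induction n arbitrary: z) (simp_all add: fdiff_def)
      moreover have "(fdiff ^^ i) q = (\<lambda>z. (fdiff ^^ i) (\<lambda>z. 1) z + (fdiff ^^ i) (\<lambda>z. - block_fun z) z)"
        unfolding fdiff_iter_add[symmetric] by (simp add: q_def)
      ultimately show ?thesis using that by (simp add: fdiff_const)
    qed
    have hq: "vge (h i) ((fdiff ^^ i) q z)" for i z
    proof -
      consider "i = 0" | "i = 1" | "i \<ge> 2" by linarith
      then show ?thesis
      proof cases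
        case 3
        then show ?thesis using block_fun_vge[of i z] by (simp add: h_def qj)
      qed (simp_all add: h_def q0 q1)
    qed
    have "vge (2 / 3 * real j) ((fdiff ^^ k) (\<lambda>z. gamma_fun z * q z) (z + 1))"
    proof (rule fdiff_iter_mult_vge[of k "\<lambda>i. 2 / 3 * real i" _ h])
      show "vge (2 / 3 * real i) ((fdiff ^^ i) gamma_fun z)" if "i \<le> k" for i z
        using less.IH[of i z] that Suc by simp
      show "2 / 3 * real j \<le> 2 / 3 * real i + h (k - i)" if "i \<le> k" for i
      proof -
        have "real k = real i + real (k - i)" using that by simp
        moreover have "2 / 3 * (real (k - i) + 1) \<le> h (k - i)"
          by (auto simp: h_def)
        ultimately show ?thesis unfolding Suc of_nat_Suc by argo
      qed
    qed (rule hq)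
    then show ?thesis
      unfolding Suc fdiff_iter_Suc fd using fdiff_iter_shift[of k "\<lambda>z. gamma_fun z * q z"] by simp
  qed
qed

lemma gamma_fun_newton:
  "gamma_fun (int z) = (\<Sum>j\<le>z. dwork_coeff (a + CARD('p) * j) * (- of_nat CARD('p)) ^ j * fact j *
    of_nat (z choose j))"
proof -
  let ?p = "CARD('p)"
  have "gamma_fun (int z) = to_fract (padic_Gamma (- of_nat (a + ?p * z)))" by (simp add: gamma_fun_def)
  also have "\<dots> = (- of_nat ?p) ^ z * fact z * (1 / fact (a + ?p * z))"
    using a unfolding padic_Gamma_minus_nat by simp
  also have "\<dots> = (\<Sum>j\<le>z. dwork_coeff (a + ?p * j) *
    ((- of_nat ?p) ^ z * fact z * ((- 1 / of_nat ?p) ^ (z - j) / fact (z - j))))"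
    unfolding inverse_fact_dwork[OF a] sum_distrib_left by (simp add: mult_ac)
  also have "\<dots> = (\<Sum>j\<le>z. dwork_coeff (a + ?p * j) * (- of_nat ?p) ^ j * fact j * of_nat (z choose j))"
  proof (rule sum.cong[OF refl])
    fix j assume "j \<in> {..z}"
    then have j: "j \<le> z" by simp
    have "(- of_nat ?p :: 'p padic) ^ z * (- 1 / of_nat ?p) ^ (z - j) =
      (- of_nat ?p) ^ j * ((- of_nat ?p) * (- 1 / of_nat ?p)) ^ (z - j)"
      using j by (simp only: power_mult_distrib mult.assoc[symmetric] power_add[symmetric]) simp
    then have *: "(- of_nat ?p :: 'p padic) ^ z * (- 1 / of_nat ?p) ^ (z - j) = (- of_nat ?p) ^ j"
      by simp
    have "(fact z :: 'p padic) / fact (z - j) = fact j * of_nat (z choose j)"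
      using j by (simp add: binomial_fact field_simps)
    then have "(- of_nat ?p) ^ z * fact z * ((- 1 / of_nat ?p) ^ (z - j) / fact (z - j)) =
      (- of_nat ?p) ^ j * (fact j * of_nat (z choose j) :: 'p padic)"
      unfolding *[symmetric] by (simp add: field_simps)
    then show "dwork_coeff (a + ?p * j) * ((- of_nat ?p) ^ z * fact z *
      ((- 1 / of_nat ?p) ^ (z - j) / fact (z - j))) =
        dwork_coeff (a + ?p * j) * (- of_nat ?p) ^ j * fact j * (of_nat (z choose j) :: 'p padic)"
      by (simp add: mult.assoc)
  qed
  finally show ?thesis .
qed

end

text \<open>With \<open>j = n div p\<close>, the \<open>j\<close>-th difference of
  \<open>gamma_fun\<close> at 0 is \<open>dwork_coeff n * (- p)^j * j!\<close>. Division leaves the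
  slope \<open>2 / 3 - 1 - 1 / (p - 1)\<close>, which is at least \<open>- 5 / 6\<close> since
  \<open>p \<ge> 3\<close>.\<close>

lemma dwork_coeff_vge: "vge (- 5 / 6 * real (n div CARD('p))) (dwork_coeff n :: 'p padic)"
proof -
  let ?p = "CARD('p)"
  define j where "j = n div ?p"
  define a where "a = n mod ?p"
  have a: "a < ?p" and n: "n = a + ?p * j" by (simp_all add: a_def j_def)
  have "(fdiff ^^ j) (gamma_fun a) (int 0) = (\<Sum>i\<le>0. dwork_coeff (a + ?p * (i + j)) *
    (- of_nat ?p) ^ (i + j) * fact (i + j) * of_nat (0 choose i))"
    by (rule fdiff_iter_newton) (rule gamma_fun_newton[OF a])
  then have "(fdiff ^^ j) (gamma_fun a) 0 = dwork_coeff n * (- of_nat ?p) ^ j * fact j"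
    by (simp add: n)
  then have "dwork_coeff n = (fdiff ^^ j) (gamma_fun a) 0 *
    ((- 1) ^ j * (of_nat ?p powi (- int j) * (1 / fact j)))"
  proof -
    have "dwork_coeff n * (- of_nat ?p) ^ j * fact j *
      ((- 1) ^ j * (of_nat ?p powi (- int j) * (1 / fact j))) =
      ((- of_nat ?p) ^ j * ((- 1) ^ j * of_nat ?p powi (- int j))) *
        ((fact j * (1 / fact j)) * dwork_coeff n :: 'p padic)"
      by (simp only: mult_ac)
    then show ?thesis
      unfolding \<open>(fdiff ^^ j) (gamma_fun a) 0 = _\<close> minus_power_cancel[OF CARD_padic_nonzero] by simp
  qed
  moreover have "vge (2 / 3 * real j + (0 + (- real j + - real j / (real ?p - 1))))
      ((fdiff ^^ j) (gamma_fun a) 0 * ((- 1) ^ j * (of_nat ?p powi (- int j) * (1 / fact j))))"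
    using vge_power[of 0 "- 1 :: 'p padic" j]
    by (intro vge_mult gamma_fun_vge[OF a] vge_CARD_powi vge_inverse_fact') simp_all
  moreover have "- 5 / 6 * real j \<le> 2 / 3 * real j + (0 + (- real j + - real j / (real ?p - 1)))"
  proof -
    have "real j / (real ?p - 1) \<le> real j / 2" using CARD_ge_3 by (intro divide_left_mono) auto
    then show ?thesis by simp
  qed
  ultimately show ?thesis unfolding j_def[symmetric] by (metis vge_mono)
qed

end

section \<open>The trace of Frobenius\<close>

text \<open>For the operator \<open>D x^k = (k - z) x^k + x^(k+1)\<close> these are the coefficients
  in \<open>x^l = w_l + D (sum over m of trace_kernel z l m * x^m)\<close>, where the constant
  \<open>w_l\<close> is the product of \<open>z - i\<close> over \<open>i < l\<close>. The recursion
  is \<open>x^(l+1) = D x^l - (l - z) x^l\<close>.\<close>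

fun trace_kernel :: "'a::comm_ring_1 \<Rightarrow> nat \<Rightarrow> nat \<Rightarrow> 'a" where
  "trace_kernel z 0 m = 0"
| "trace_kernel z (Suc l) m = (if m = l then 1 else 0) - (of_nat l - z) * trace_kernel z l m"

lemma trace_kernel_eq_0: "l \<le> m \<Longrightarrow> trace_kernel z l m = 0"
  by (induction l) auto

text \<open>The coefficient of \<open>x^m\<close> in that decomposition of
  \<open>x^l\<close>.\<close>

lemma trace_kernel_left:
  "(of_nat m - z) * trace_kernel z l m + (if m = 0 then 0 else trace_kernel z l (m - 1)) =
    (if m = l then 1 else 0) - (if m = 0 then \<Prod>i<l. z - of_nat i else 0)"
proof (induction l)
  case (Suc l)
  let ?k = "trace_kernel z l" and ?w = "\<Prod>i<l. z - of_nat i"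
  let ?d = "\<lambda>b. if b then 1 else 0 :: 'a"
  have shift: "(if m = 0 then 0 else trace_kernel z (Suc l) (m - 1)) =
    ?d (m = Suc l) - (of_nat l - z) * (if m = 0 then 0 else ?k (m - 1))"
    by (cases m) auto
  have "(of_nat m - z) * trace_kernel z (Suc l) m +
    (if m = 0 then 0 else trace_kernel z (Suc l) (m - 1)) =
    (of_nat m - z) * ?d (m = l) + ?d (m = Suc l) -
      (of_nat l - z) * ((of_nat m - z) * ?k m + (if m = 0 then 0 else ?k (m - 1)))"
    unfolding shift by (simp add: algebra_simps)
  also have "\<dots> = (of_nat m - z) * ?d (m = l) + ?d (m = Suc l) -
    (of_nat l - z) * (?d (m = l) - (if m = 0 then ?w else 0))"
    unfolding Suc ..
  also have "\<dots> = ?d (m = Suc l) - (if m = 0 then \<Prod>i<Suc l. z - of_nat i else 0)"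
    by (auto simp: algebra_simps)
  finally show ?case .
qed simp

text \<open>
  If \<open>D\<close> is the operator with \<open>D x\<^sup>k = (k - z) x\<^sup>k + x\<^sup>k\<^sup>+\<^sup>1\<close>, the hypothesis says that the operator \<open>\<alpha>\<close>
  with matrix \<open>A\<close> satisfies \<open>\<alpha> D = p D \<alpha>\<close>. The cokernel of \<open>D\<close> is spanned by \<open>1\<close>, on which \<open>\<alpha>\<close> acts
  through the second sum, so its trace is that eigenvalue plus \<open>p\<close> times the trace itself, up to truncation.
\<close>

lemma truncated_trace:
  fixes A :: "nat \<Rightarrow> nat \<Rightarrow> 'a::comm_ring_1"
  assumes rec: "\<And>l m. p * ((of_nat l - z) * A l m + (if l = 0 then 0 else A (l - 1) m)) =
    (of_nat m - z) * A l m + A l (Suc m)"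
  shows "(\<Sum>l<Suc L. A l l) = (\<Sum>l<Suc L. A l 0 * (\<Prod>i<l. z - of_nat i)) + p * (\<Sum>l<Suc L. A l l)
    - p * (\<Sum>m<Suc L. trace_kernel z (Suc L) m * A L m)"
proof -
  let ?k = "trace_kernel z" and ?w = "\<lambda>l. \<Prod>i<l. z - of_nat i"
  \<comment> \<open>\<open>A l m\<close> is the coefficient of \<open>x^l\<close> in the image of
    \<open>x^m\<close>. Here \<open>x^l\<close> is decomposed by \<open>trace_kernel\<close> and the
    image of each \<open>D x^m\<close> is replaced by the commutation relation.\<close>
  have row: "A l l = p * (\<Sum>m<Suc L. ?k l m * ((of_nat l - z) * A l m +
    (if l = 0 then 0 else A (l - 1) m))) + A l 0 * ?w l"
    if "l < Suc L" for l
  proof -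
    have "A l l = (\<Sum>m<Suc L. A l m * (if m = l then 1 else 0))"
      using that by (simp add: sum.delta' if_distrib cong: if_cong)
    also have "\<dots> = (\<Sum>m<Suc L. (of_nat m - z) * A l m * ?k l m +
      A l m * (if m = 0 then 0 else ?k l (m - 1)) + (if m = 0 then A l 0 * ?w l else 0))"
    proof (rule sum.cong[OF refl])
      fix m
      have d: "(if m = l then 1 else 0) = (of_nat m - z) * ?k l m + (if m = 0 then 0 else ?k l (m - 1)) +
        (if m = 0 then ?w l else 0)"
        using trace_kernel_left[of m z l] by (simp add: algebra_simps)
      show "A l m * (if m = l then 1 else 0) =
        (of_nat m - z) * A l m * ?k l m + A l m * (if m = 0 then 0 else ?k l (m - 1)) +
        (if m = 0 then A l 0 * ?w l else 0)"
        unfolding d by (simp add: algebra_simps)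
    qed
    also have "\<dots> = (\<Sum>m<Suc L. (of_nat m - z) * A l m * ?k l m) +
      (\<Sum>m<Suc L. A l m * (if m = 0 then 0 else ?k l (m - 1))) + A l 0 * ?w l"
      by (simp only: sum.distrib) (simp add: sum.lessThan_Suc_shift del: sum.lessThan_Suc)
    also have "(\<Sum>m<Suc L. A l m * (if m = 0 then 0 else ?k l (m - 1))) = (\<Sum>m<L. A l (Suc m) * ?k l m)"
      by (simp add: sum.lessThan_Suc_shift del: sum.lessThan_Suc)
    also have "\<dots> = (\<Sum>m<Suc L. A l (Suc m) * ?k l m)"
      using trace_kernel_eq_0[of l L z] that by simp
    also have "(\<Sum>m<Suc L. (of_nat m - z) * A l m * ?k l m) + (\<Sum>m<Suc L. A l (Suc m) * ?k l m) =
      (\<Sum>m<Suc L. ?k l m * ((of_nat m - z) * A l m + A l (Suc m)))"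
      by (simp only: sum.distrib[symmetric] distrib_left mult_ac)
    also have "\<dots> = p * (\<Sum>m<Suc L. ?k l m * ((of_nat l - z) * A l m +
      (if l = 0 then 0 else A (l - 1) m)))"
      unfolding rec[symmetric] sum_distrib_left by (simp only: mult_ac)
    finally show ?thesis .
  qed
  \<comment> \<open>Summation by parts in \<open>l\<close>: the recursion of the kernel collapses
    the sum to the diagonal entry, and the shift of the index leaves one boundary term at
    \<open>Suc L\<close>.\<close>
  have col: "(\<Sum>l<Suc L. ?k l m * ((of_nat l - z) * A l m + (if l = 0 then 0 else A (l - 1) m))) =
    A m m - ?k (Suc L) m * A L m"
    if "m < Suc L" for m
  proof -
    have "(\<Sum>l<Suc L. ?k l m * (if l = 0 then 0 else A (l - 1) m)) = (\<Sum>l<L. ?k (Suc l) m * A l m)"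
      by (simp add: sum.lessThan_Suc_shift del: sum.lessThan_Suc trace_kernel.simps(2))
    also have "\<dots> = (\<Sum>l<Suc L. ?k (Suc l) m * A l m) - ?k (Suc L) m * A L m"
      by (simp del: trace_kernel.simps(2))
    finally have "(\<Sum>l<Suc L. ?k l m * ((of_nat l - z) * A l m + (if l = 0 then 0 else A (l - 1) m))) =
      (\<Sum>l<Suc L. ?k l m * ((of_nat l - z) * A l m) + ?k (Suc l) m * A l m) - ?k (Suc L) m * A L m"
      by (simp only: distrib_left sum.distrib) simp
    also have "(\<Sum>l<Suc L. ?k l m * ((of_nat l - z) * A l m) + ?k (Suc l) m * A l m) =
      (\<Sum>l<Suc L. if m = l then A l m else 0)"
      by (intro sum.cong refl) (auto simp: algebra_simps)
    also have "\<dots> = A m m" using that by (simp add: sum.delta' del: sum.lessThan_Suc)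
    finally show ?thesis .
  qed
  have "(\<Sum>l<Suc L. A l l) = (\<Sum>l<Suc L. p * (\<Sum>m<Suc L. ?k l m *
    ((of_nat l - z) * A l m + (if l = 0 then 0 else A (l - 1) m))) + A l 0 * ?w l)"
    by (intro sum.cong refl row) simp
  also have "\<dots> = p * (\<Sum>l<Suc L. \<Sum>m<Suc L. ?k l m *
    ((of_nat l - z) * A l m + (if l = 0 then 0 else A (l - 1) m))) + (\<Sum>l<Suc L. A l 0 * ?w l)"
    by (simp only: sum.distrib sum_distrib_left[symmetric])
  also have "(\<Sum>l<Suc L. \<Sum>m<Suc L. ?k l m * ((of_nat l - z) * A l m +
    (if l = 0 then 0 else A (l - 1) m))) =
    (\<Sum>m<Suc L. \<Sum>l<Suc L. ?k l m * ((of_nat l - z) * A l m + (if l = 0 then 0 else A (l - 1) m)))"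
    by (rule sum.swap)
  also have "\<dots> =
    (\<Sum>m<Suc L. A m m - ?k (Suc L) m * A L m)"
    by (intro sum.cong refl col) simp
  finally show ?thesis by (simp only: sum_subtractf right_diff_distrib) (simp only: algebra_simps)
qed

section \<open>Gamma as a truncated trace\<close>

lemma prod_falling_of_nat:
  "(\<Prod>i<j. of_nat n - of_nat i) = fact j * (of_nat (n choose j) :: 'a::field_char_0)"
  by (simp add: binomial_gbinomial gbinomial_mult_fact atLeast0LessThan)

context
  assumes odd: "odd CARD('p::prime_card)"
begin

text \<open>The sixth left over from \<open>1 - 5 / 6\<close> is what makes the series for gamma and
  the truncated traces converge.\<close>

lemma dwork_coeff_vge_le:
  assumes "n div CARD('p) \<le> l" "l \<le> k"
  shows "vge (real k / 6) (dwork_coeff n * (- of_nat CARD('p)) ^ k :: 'p padic)"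
proof (rule vge_mult'[OF dwork_coeff_vge[OF odd] vge_minus_CARD_power[OF order_refl]])
  have "real (n div CARD('p)) \<le> real k" using assms by (simp only: of_nat_le_iff)
  then show "real k / 6 \<le> - 5 / 6 * real (n div CARD('p)) + real k" by simp
qed

text \<open>The expansion is exact at natural numbers and passes to \<open>y\<close> by
  approximating \<open>y\<close> modulo \<open>p ^ N\<close>. The truncation point must not depend
  on the approximating number, so the omitted terms are bounded through their coefficients.\<close>

lemma gamma_series:
  fixes y :: "'p padic_int"
  assumes a: "a < CARD('p)" and L: "6 * N \<le> L"
  shows "vge (real N) (to_fract (padic_Gamma (- (of_nat a + of_nat CARD('p) * y))) -
    (\<Sum>j<L. dwork_coeff (a + CARD('p) * j) * (- of_nat CARD('p)) ^ j * to_fract (\<Prod>i<j. y - of_nat i)))"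
proof -
  let ?c = "\<lambda>j. dwork_coeff (a + CARD('p) * j) * (- of_nat CARD('p)) ^ j :: 'p padic"
  let ?w = "\<lambda>y j. to_fract (\<Prod>i<j. y - of_nat i :: 'p padic_int)"
  let ?g = "\<lambda>y. to_fract (padic_Gamma (- (of_nat a + of_nat CARD('p) * y))) :: 'p padic"
  have c: "vge (real j / 6) (?c j)" for j
    using a by (intro dwork_coeff_vge_le[of _ j]) simp_all
  obtain n where n: "padic_nth (of_nat n :: 'p padic_int) N = padic_nth y N"
    using padic_int_of_nat_approx by blast
  have "vge (real N) (?g y - ?g (of_nat n))"
    unfolding vge_diff_to_fract_iff
    by (intro padic_Gamma_cong[OF odd] padic_nth_uminus_cong padic_nth_add_cong padic_nth_mult_cong refl
      n[symmetric])
  moreover have "vge (real N) (?g (of_nat n) - (\<Sum>j<L. ?c j * ?w (of_nat n) j))"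
  proof -
    define M where "M = max L (Suc n)"
    have "?g (of_nat n) = (\<Sum>j\<le>n. ?c j * ?w (of_nat n) j)"
      using gamma_fun_newton[OF odd a, of n]
      by (simp add: gamma_fun_def[OF odd a] to_fract_prod to_fract_of_nat prod_falling_of_nat mult.assoc)
    also have "\<dots> = (\<Sum>j<M. ?c j * ?w (of_nat n) j)"
    proof (rule sum.mono_neutral_left)
      show "\<forall>i\<in>{..<M} - {..n}. ?c i * ?w (of_nat n) i = 0"
        by (simp add: to_fract_prod to_fract_of_nat prod_falling_of_nat binomial_eq_0)
    qed (auto simp: M_def)
    also have "\<dots> = (\<Sum>j<L. ?c j * ?w (of_nat n) j) + (\<Sum>j\<in>{L..<M}. ?c j * ?w (of_nat n) j)"
      by (subst sum.union_disjoint[symmetric]) (auto intro!: sum.cong simp: M_def)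
    finally have "?g (of_nat n) - (\<Sum>j<L. ?c j * ?w (of_nat n) j) = (\<Sum>j\<in>{L..<M}. ?c j * ?w (of_nat n) j)"
      by simp
    moreover have "vge (real N) (\<Sum>j\<in>{L..<M}. ?c j * ?w (of_nat n) j)"
    proof (rule vge_sum)
      fix j assume "j \<in> {L..<M}"
      then have "real (6 * N) \<le> real j" using L by (simp only: of_nat_le_iff) simp
      then show "vge (real N) (?c j * ?w (of_nat n) j)"
        by (intro vge_mult'[OF c vge_to_fract[OF order_refl]]) simp
    qed
    ultimately show ?thesis by simp
  qed
  moreover have "vge (real N) ((\<Sum>j<L. ?c j * ?w (of_nat n) j) - (\<Sum>j<L. ?c j * ?w y j))"
    unfolding sum_subtractf[symmetric] right_diff_distrib[symmetric]
  proof (rule vge_sum)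
    fix j
    have "vge (real N) (?w (of_nat n) j - ?w y j)"
      unfolding vge_diff_to_fract_iff by (intro padic_nth_prod_cong padic_nth_diff_cong refl n)
    then show "vge (real N) (?c j * (?w (of_nat n) j - ?w y j))"
      by (rule vge_mult'[OF c]) simp
  qed
  ultimately show ?thesis by (meson vge_diff_trans)
qed

text \<open>The choice \<open>z = - x = - a / (p - 1)\<close> serves twice:
  \<open>- (a + p z)\<close> becomes \<open>x\<close> itself, and the recursion of the
  \<open>b_n\<close> becomes the commutation relation of \<open>truncated_trace\<close>. The extra 1
  in the bound on \<open>L\<close> is there because the last row has index
  \<open>L - 1\<close>.\<close>

lemma gamma_trace:
  fixes x :: "'p padic_int"
  assumes x: "of_nat (CARD('p) - 1) * x = of_nat a" and a: "a < CARD('p)" and L: "6 * N + 1 \<le> L"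
  shows "vge (real N) (to_fract (padic_Gamma x) -
    (1 - of_nat CARD('p)) * (\<Sum>k<L. dwork_coeff (a + (CARD('p) - 1) * k) * (- of_nat CARD('p)) ^ k))"
proof -
  let ?p = "CARD('p)"
  define z :: "'p padic" where "z = to_fract (- x)"
  obtain M where M: "L = Suc M" "6 * N \<le> M" using L by (cases L) auto
  \<comment> \<open>The entry is the coefficient of \<open>y^(a + p l)\<close> in
    \<open>y^m E(y)\<close>, scaled by \<open>(- p)^l\<close>. Integer indices keep the recursion
    free of cases.\<close>
  define A :: "int \<Rightarrow> int \<Rightarrow> 'p padic" where
    "A = (\<lambda>l m. (- of_nat ?p) powi l * dwork_coeff_int (int a + int ?p * l - m))"
  define A' where "A' = (\<lambda>l m. A (int l) (int m))"
  have az: "of_nat a = - (of_nat ?p - 1) * z"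
  proof -
    have "(of_nat ?p - 1) * to_fract x = (of_nat a :: 'p padic)"
      using arg_cong[OF x, of to_fract] CARD_prime_gt_1[where 'p='p]
      by (simp add: to_fract_of_nat of_nat_diff)
    then show ?thesis by (simp only: z_def to_fract_uminus minus_mult_minus)
  qed
  have rec: "of_nat ?p * ((of_int l - z) * A l m + A (l - 1) m) = (of_int m - z) * A l m + A l (m + 1)"
    for l m
  proof -
    define n where "n = int a + int ?p * l - m"
    let ?P = "(- of_nat ?p :: 'p padic) powi l"
    have P: "(- of_nat ?p :: 'p padic) powi l = - of_nat ?p * (- of_nat ?p) powi (l - 1)"
      using power_int_add_1[of "- of_nat ?p :: 'p padic" "l - 1"] by simp
    have 1: "A l m = ?P * dwork_coeff_int n" "A l (m + 1) = ?P * dwork_coeff_int (n - 1)"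
      by (simp_all add: A_def n_def algebra_simps)
    have "n - int ?p = int a + int ?p * (l - 1) - m" by (simp add: n_def algebra_simps)
    then have 2: "of_nat ?p * A (l - 1) m = - ?P * dwork_coeff_int (n - int ?p)"
      unfolding P by (simp add: A_def)
    have "of_int n = of_nat ?p * (of_int l - z) - (of_int m - z)"
      by (simp add: n_def az algebra_simps)
    then have "(of_nat ?p * (of_int l - z) - (of_int m - z)) * (?P * dwork_coeff_int n) =
      ?P * (dwork_coeff_int (n - 1) + dwork_coeff_int (n - int ?p))"
      using dwork_coeff_rec[of n, where 'p='p] by (metis mult.left_commute)
    then show ?thesis using 2 unfolding 1 by (simp add: algebra_simps)
  qed
  \<comment> \<open>Because \<open>a < p\<close>, the row -1 vanishes, which supplies the boundary
    case \<open>l = 0\<close> of the relation over the natural numbers.\<close>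
  have neg: "A (- 1) (int m) = 0" for m
    using a by (simp add: A_def dwork_coeff_int_def)
  have rec': "of_nat ?p * ((of_nat l - z) * A' l m + (if l = 0 then 0 else A' (l - 1) m)) =
    (of_nat m - z) * A' l m + A' l (Suc m)" for l m
    using rec[of "int l" "int m"] neg[of m]
    by (cases l) (simp_all add: A'_def add.commute)
  have A'_vge: "vge (real l / 6) (A' l m)" for l m
  proof (cases "a + ?p * l < m")
    case True
    then have "int a + int ?p * int l - int m < 0" by (simp flip: of_nat_mult of_nat_add)
    then show ?thesis by (simp add: A'_def A_def dwork_coeff_int_def)
  next
    case False
    then have "int a + int ?p * int l - int m = int (a + ?p * l - m)" by (simp add: of_nat_diff)
    then have "A' l m = dwork_coeff (a + ?p * l - m) * (- of_nat ?p) ^ l"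
      by (simp add: A'_def A_def mult.commute)
    moreover have "(a + ?p * l - m) div ?p \<le> (a + ?p * l) div ?p" by (rule div_le_mono) simp
    then have "(a + ?p * l - m) div ?p \<le> l" using a by simp
    ultimately show ?thesis using dwork_coeff_vge_le[of _ l l] by simp
  qed
  have k0: "vge 0 (trace_kernel z l m)" for l m
  proof (induction l)
    case (Suc l)
    have "vge 0 ((of_nat l - z) * trace_kernel z l m)"
      using Suc by (intro vge_mult'[of 0 _ 0] vge_diff) (simp_all add: z_def)
    then show ?case by (auto intro!: vge_diff vge_uminus)
  qed simp
  define T where "T = (\<Sum>l<L. A' l l)"
  have T: "T = (\<Sum>k<L. dwork_coeff (a + (?p - 1) * k) * (- of_nat ?p) ^ k)"
  proof -
    have "int a + int ?p * int k - int k = int (a + (?p - 1) * k)" for k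
    proof -
      obtain r where "?p = Suc r" using CARD_prime_pos[where 'p='p] gr0_implies_Suc by blast
      then show ?thesis by (simp add: algebra_simps)
    qed
    then show ?thesis
      unfolding T_def A'_def A_def by (simp only: dwork_coeff_int_of_nat power_int_of_nat mult.commute)
  qed
  have "T = (\<Sum>l<L. A' l 0 * (\<Prod>i<l. z - of_nat i)) + of_nat ?p * T -
    of_nat ?p * (\<Sum>m<L. trace_kernel z L m * A' M m)"
    using truncated_trace[of "of_nat ?p" z A' M, OF rec'] unfolding T_def M by blast
  moreover have "(\<Sum>l<L. A' l 0 * (\<Prod>i<l. z - of_nat i)) =
    (\<Sum>j<L. dwork_coeff (a + ?p * j) * (- of_nat ?p) ^ j * to_fract (\<Prod>i<j. - x - of_nat i))"
  proof (rule sum.cong[OF refl])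
    fix j
    have "int a + int ?p * int j - int 0 = int (a + ?p * j)" by simp
    then have "A' j 0 = dwork_coeff (a + ?p * j) * (- of_nat ?p) ^ j"
      unfolding A'_def A_def by (simp only: dwork_coeff_int_of_nat power_int_of_nat mult.commute)
    then show "A' j 0 * (\<Prod>i<j. z - of_nat i) =
      dwork_coeff (a + ?p * j) * (- of_nat ?p) ^ j * to_fract (\<Prod>i<j. - x - of_nat i)"
      by (simp add: z_def to_fract_prod to_fract_of_nat)
  qed
  moreover have "- (of_nat a + of_nat ?p * (- x)) = x"
    using CARD_prime_gt_1[where 'p='p] unfolding x[symmetric] by (simp add: of_nat_diff algebra_simps)
  moreover have "vge (real N) (to_fract (padic_Gamma (- (of_nat a + of_nat ?p * (- x)))) -
      (\<Sum>j<L. dwork_coeff (a + ?p * j) * (- of_nat ?p) ^ j * to_fract (\<Prod>i<j. - x - of_nat i)))"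
    using L by (intro gamma_series a) simp
  moreover have "vge (real N) (of_nat ?p * (\<Sum>m<L. trace_kernel z L m * A' M m))"
  proof (rule vge_mult'[of 0 _ "real N"])
    show "vge (real N) (\<Sum>m<L. trace_kernel z L m * A' M m)"
    proof (rule vge_sum)
      fix m
      have "vge (real M / 6) (trace_kernel z L m * A' M m)" by (rule vge_mult'[OF k0 A'_vge]) simp
      moreover have "real N \<le> real M / 6" using M(2) by simp
      ultimately show "vge (real N) (trace_kernel z L m * A' M m)" by (rule vge_mono)
    qed
  qed simp_all
  ultimately have *: "vge (real N) (to_fract (padic_Gamma x) -
    (T - of_nat ?p * T + of_nat ?p * (\<Sum>m<L. trace_kernel z L m * A' M m)))"
    "vge (real N) (of_nat ?p * (\<Sum>m<L. trace_kernel z L m * A' M m))"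
    by (simp_all add: algebra_simps)
  from vge_add[OF this] have "vge (real N) (to_fract (padic_Gamma x) - (1 - of_nat ?p) * T)"
    by (simp add: algebra_simps)
  then show ?thesis unfolding T .
qed

end

section \<open>Powers of the Teichmueller character\<close>

lemma teichmuller_bar_pow_altdef:
  "teichmuller_bar_pow j t = (if t = 0 then 0 else inverse (to_fract (teichmuller t)) ^ j)"
  by (simp add: teichmuller_bar_pow_def to_fract_def)

lemma to_fract_teichmuller_nonzero: "t \<noteq> 0 \<Longrightarrow> to_fract (teichmuller t) \<noteq> 0"
  by (simp add: teichmuller_nonzero)

lemma to_fract_teichmuller_power:
  "t \<noteq> 0 \<Longrightarrow> to_fract (teichmuller t) ^ (CARD('p) - 1) = 1" for t :: "'p::prime_card mod_ring"
  using teichmuller_power[of t] by (metis to_fract_1 to_fract_power)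

lemma teichmuller_bar_pow_0 [simp]: "teichmuller_bar_pow j 0 = 0"
  by (simp add: teichmuller_bar_pow_altdef)

lemma teichmuller_bar_pow_1 [simp]: "teichmuller_bar_pow j 1 = 1"
  by (simp add: teichmuller_bar_pow_altdef)

lemma teichmuller_bar_pow_mult: "teichmuller_bar_pow j (s * t) =
  teichmuller_bar_pow j s * teichmuller_bar_pow j t"
  by (auto simp: teichmuller_bar_pow_altdef teichmuller_mult power_mult_distrib)

lemma teichmuller_bar_pow_power: "n > 0 \<Longrightarrow> teichmuller_bar_pow j (t ^ n) = teichmuller_bar_pow (j * n) t"
  by (auto simp: teichmuller_bar_pow_altdef teichmuller_pow to_fract_power power_inverse mult.commute
    simp flip: power_mult)

lemma teichmuller_bar_pow_add: "teichmuller_bar_pow (i + j) t =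
  teichmuller_bar_pow i t * teichmuller_bar_pow j t"
  by (simp add: teichmuller_bar_pow_altdef power_add)

lemma teichmuller_bar_pow_period:
  fixes t :: "'p::prime_card mod_ring"
  shows "t \<noteq> 0 \<Longrightarrow> teichmuller_bar_pow ((CARD('p) - 1) * k) t = 1"
  using to_fract_teichmuller_power[of t] by (simp add: teichmuller_bar_pow_altdef power_mult
    power_inverse)

lemma teichmuller_bar_pow_mod:
  fixes t :: "'p::prime_card mod_ring"
  shows "teichmuller_bar_pow (j mod (CARD('p) - 1)) t = teichmuller_bar_pow j t"
proof (cases "t = 0")
  case False
  have "teichmuller_bar_pow j t = teichmuller_bar_pow (j mod (CARD('p) - 1) +
    (CARD('p) - 1) * (j div (CARD('p) - 1))) t"
    by simp
  also have "\<dots> = teichmuller_bar_pow (j mod (CARD('p) - 1)) t"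
    unfolding teichmuller_bar_pow_add using teichmuller_bar_pow_period[OF False] by simp
  finally show ?thesis ..
qed simp

lemma sum_teichmuller_power:
  "(\<Sum>x\<in>UNIV - {0 :: 'p::prime_card mod_ring}. to_fract (teichmuller x) ^ n) =
    (if (CARD('p) - 1) dvd n then of_nat (CARD('p) - 1) else 0)"
proof (cases "(CARD('p) - 1) dvd n")
  case True
  then obtain k where k: "n = (CARD('p) - 1) * k" ..
  have "(\<Sum>x\<in>UNIV - {0 :: 'p mod_ring}. to_fract (teichmuller x) ^ n) = (\<Sum>x\<in>UNIV - {0 :: 'p mod_ring}. 1)"
  proof (rule sum.cong[OF refl])
    fix x :: "'p mod_ring" assume "x \<in> UNIV - {0}"
    then have "to_fract (teichmuller x) ^ (CARD('p) - 1) = 1" by (intro to_fract_teichmuller_power) simp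
    then show "to_fract (teichmuller x) ^ n = 1" by (simp only: k power_mult power_one)
  qed
  also have "\<dots> = of_nat (CARD('p) - 1)" by (simp add: card_Diff_singleton)
  finally show ?thesis using True by simp
next
  case False
  let ?q = "CARD('p) - 1" let ?r = "n mod ?q"
  have r: "0 < ?r" "?r < ?q"
    using False CARD_prime_gt_1[where 'p='p] by (auto simp: mod_greater_zero_iff_not_dvd)
  \<comment> \<open>Otherwise \<open>x ^ r - 1\<close>, of degree \<open>r < p - 1\<close>, would
    vanish at all \<open>p - 1\<close> units.\<close>
  have "\<exists>a :: 'p mod_ring. a \<noteq> 0 \<and> a ^ n \<noteq> 1"
  proof (rule ccontr)
    assume "\<not> ?thesis"
    then have all: "a ^ n = 1" if "a \<noteq> 0" for a :: "'p mod_ring" using that by blast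
    let ?P = "monom 1 ?r - 1 :: 'p mod_ring poly"
    have "a ^ ?r = 1" if "a \<noteq> 0" for a :: "'p mod_ring"
    proof -
      have "a ^ n = a ^ (?q * (n div ?q) + ?r)" by simp
      also have "\<dots> = (a ^ ?q) ^ (n div ?q) * a ^ ?r" by (simp only: power_add power_mult)
      finally show ?thesis using all[OF that] mod_ring_fermat[OF that] by simp
    qed
    then have "UNIV - {0} \<subseteq> {x. poly ?P x = 0}" by (auto simp: poly_monom)
    then have "card (UNIV - {0 :: 'p mod_ring}) \<le> card {x. poly ?P x = 0}"
      by (intro card_mono) simp_all
    moreover have "?P \<noteq> 0"
    proof
      assume "?P = 0"
      then have "coeff ?P ?r = 0" by simp
      then show False using r(1) by simp
    qed
    then have "card {x. poly ?P x = 0} \<le> degree ?P" by (rule card_poly_roots_bound)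
    moreover have "degree ?P \<le> ?r" by (intro degree_diff_le degree_monom_le) simp
    moreover have "card (UNIV - {0 :: 'p mod_ring}) = ?q" by (simp add: card_Diff_singleton)
    ultimately show False using r by simp
  qed
  then obtain a :: "'p mod_ring" where a: "a \<noteq> 0" "a ^ n \<noteq> 1" by blast
  let ?S = "\<Sum>x\<in>UNIV - {0 :: 'p mod_ring}. to_fract (teichmuller x) ^ n"
  have "bij_betw ((*) a) (UNIV - {0}) (UNIV - {0})"
    by (rule bij_betwI[where g="\<lambda>x. x / a"]) (use a in auto)
  from sum.reindex_bij_betw[OF this, of "\<lambda>x. to_fract (teichmuller x) ^ n"]
  have "?S = (\<Sum>x\<in>UNIV - {0}. to_fract (teichmuller (a * x)) ^ n)" by simp
  also have "\<dots> = to_fract (teichmuller a) ^ n * ?S"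
    unfolding sum_distrib_left by (intro sum.cong refl) (simp add: teichmuller_mult a power_mult_distrib)
  finally have "(to_fract (teichmuller a) ^ n - 1) * ?S = 0" by (simp add: algebra_simps)
  moreover have "to_fract (teichmuller a) ^ n \<noteq> 1"
  proof
    assume "to_fract (teichmuller a) ^ n = 1"
    then have "teichmuller (a ^ n) = teichmuller 1"
      using teichmuller_pow[OF a(1)] by (metis to_fract_power to_fract_1 to_fract_eq_iff teichmuller_1)
    then show False using a teichmuller_inj[of "a ^ n" 1] by simp
  qed
  ultimately show ?thesis using False by simp
qed

lemma teichmuller_bar_pow_eq_power:
  fixes x :: "'p::prime_card mod_ring"
  assumes "x \<noteq> 0" "a \<le> CARD('p) - 1"
  shows "teichmuller_bar_pow a x = to_fract (teichmuller x) ^ (CARD('p) - 1 - a)"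
proof -
  let ?w = "to_fract (teichmuller x)"
  have "?w ^ (CARD('p) - 1 - a) * ?w ^ a = 1"
    using to_fract_teichmuller_power[OF assms(1)] assms(2)
      by (simp only: power_add[symmetric] le_add_diff_inverse2)
  then have "inverse (?w ^ a) = ?w ^ (CARD('p) - 1 - a)"
    by (metis inverse_unique mult.commute)
  then show ?thesis using assms(1) by (simp add: teichmuller_bar_pow_altdef power_inverse)
qed

lemma sum_teichmuller_orthogonal:
  assumes "a < CARD('p) - 1" "i < CARD('p) - 1"
  shows "(\<Sum>x\<in>UNIV - {0 :: 'p::prime_card mod_ring}. teichmuller_bar_pow a x *
    to_fract (teichmuller x) ^ i) =
    (if i = a then of_nat (CARD('p) - 1) else 0)"
proof -
  let ?q = "CARD('p) - 1"
  have "(\<Sum>x\<in>UNIV - {0 :: 'p mod_ring}. teichmuller_bar_pow a x * to_fract (teichmuller x) ^ i) =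
    (\<Sum>x\<in>UNIV - {0 :: 'p mod_ring}. to_fract (teichmuller x) ^ (?q - a + i))"
  proof (rule sum.cong[OF refl])
    fix x :: "'p mod_ring" assume "x \<in> UNIV - {0}"
    then have "teichmuller_bar_pow a x = to_fract (teichmuller x) ^ (?q - a)"
      using assms by (intro teichmuller_bar_pow_eq_power) simp_all
    then show "teichmuller_bar_pow a x * to_fract (teichmuller x) ^ i =
      to_fract (teichmuller x) ^ (?q - a + i)"
      by (simp only: power_add)
  qed
  also have "\<dots> = (if ?q dvd ?q - a + i then of_nat ?q else 0)"
    by (rule sum_teichmuller_power)
  also have "?q dvd ?q - a + i \<longleftrightarrow> i = a"
  proof
    assume "?q dvd ?q - a + i"
    then obtain k where k: "?q - a + i = ?q * k" ..
    have "k = 1"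
    proof (rule ccontr)
      assume "k \<noteq> 1"
      then consider "k = 0" | "k \<ge> 2" by linarith
      then show False
      proof cases
        case 2
        then have "?q * 2 \<le> ?q * k" by (intro mult_le_mono2)
        then show False using k assms by linarith
      qed (use k assms in simp)
    qed
    then show "i = a" using k assms by simp
  qed (use assms in simp)
  finally show ?thesis .
qed

lemma sum_teichmuller_bar_pow_exponents:
  fixes x :: "'p::prime_card mod_ring"
  shows "(\<Sum>j<CARD('p) - 1. teichmuller_bar_pow j x) = (if x = 1 then of_nat (CARD('p) - 1) else 0)"
proof -
  consider "x = 0" | "x = 1" | "x \<noteq> 0" "x \<noteq> 1" by blast
  then show ?thesis
  proof cases
    case 3
    let ?r = "inverse (to_fract (teichmuller x))"
    have "to_fract (teichmuller x) \<noteq> 1"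
      using 3 teichmuller_inj[of x 1] by simp (metis to_fract_1 to_fract_eq_iff)
    then have "?r \<noteq> 1" by simp
    then have "(\<Sum>j<CARD('p) - 1. ?r ^ j) = (?r ^ (CARD('p) - 1) - 1) / (?r - 1)" by (rule geometric_sum)
    moreover have "?r ^ (CARD('p) - 1) = 1"
      using to_fract_teichmuller_power[OF 3(1)] by (simp only: power_inverse inverse_1)
    ultimately have "(\<Sum>j<CARD('p) - 1. ?r ^ j) = 0"
      by simp
    then show ?thesis using 3 by (simp add: teichmuller_bar_pow_altdef)
  qed simp_all
qed

section \<open>Evaluation of power series at a root of \<open>y\<^sup>p\<^sup>-\<^sup>1 = - p\<close>\<close>

text \<open>
  Modulo \<open>y\<^sup>p\<^sup>-\<^sup>1 + p\<close> the monomial \<open>y\<^sup>n\<close> is \<open>ev_coeff m n y\<^sup>m\<close> for the one \<open>m < p - 1\<close> congruent to \<open>n\<close>; working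
  with the coordinates of the residue avoids the ramified extension containing the roots.
\<close>

definition ev_coeff :: "nat \<Rightarrow> nat \<Rightarrow> 'p::prime_card padic" where
  "ev_coeff m n = (if n mod (CARD('p) - 1) = m then (- of_nat CARD('p)) ^ (n div (CARD('p) - 1)) else 0)"

definition ev_sum :: "nat \<Rightarrow> 'p::prime_card padic fps \<Rightarrow> nat \<Rightarrow> 'p padic" where
  "ev_sum m f X = (\<Sum>n<X. f $ n * ev_coeff m n)"

definition ev_tends :: "nat \<Rightarrow> 'p::prime_card padic fps \<Rightarrow> 'p padic \<Rightarrow> bool" where
  "ev_tends m f v \<longleftrightarrow> (\<forall>N::nat. \<exists>X0. \<forall>X\<ge>X0. vge (real N) (v - ev_sum m f X))"

text \<open>The real quotient \<open>n / p\<close> in place of \<open>n div p\<close> makes the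
  bound additive in \<open>n\<close>, hence stable under products.\<close>

definition overconv :: "'p::prime_card padic fps \<Rightarrow> bool" where
  "overconv f \<longleftrightarrow> (\<forall>n. vge (- 5 / 6 * (real n / real CARD('p))) (f $ n))"

lemma ev_tends_unique:
  assumes "ev_tends m f v" "ev_tends m f w"
  shows "v = w"
proof -
  have "vge (real N) (v - w)" for N
  proof -
    obtain X0 X1 where "\<And>X. X \<ge> X0 \<Longrightarrow> vge (real N) (v - ev_sum m f X)"
      "\<And>X. X \<ge> X1 \<Longrightarrow> vge (real N) (w - ev_sum m f X)"
      using assms unfolding ev_tends_def by metis
    then have "vge (real N) (v - ev_sum m f (max X0 X1))" "vge (real N) (ev_sum m f (max X0 X1) - w)"
      by (simp_all add: vge_diff_commute[of _ _ w])
    then show ?thesis by (rule vge_diff_trans)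
  qed
  then show ?thesis using vge_all_eq_0[of "v - w"] by simp
qed

lemma ev_tends_add:
  assumes "ev_tends m f v" "ev_tends m g w"
  shows "ev_tends m (f + g) (v + w)"
  unfolding ev_tends_def
proof
  fix N
  obtain X0 X1 where "\<And>X. X \<ge> X0 \<Longrightarrow> vge (real N) (v - ev_sum m f X)"
    "\<And>X. X \<ge> X1 \<Longrightarrow> vge (real N) (w - ev_sum m g X)"
    using assms unfolding ev_tends_def by metis
  then have "vge (real N) ((v - ev_sum m f X) + (w - ev_sum m g X))" if "X \<ge> max X0 X1" for X
    using that by (intro vge_add) simp_all
  moreover have "(v - ev_sum m f X) + (w - ev_sum m g X) = v + w - ev_sum m (f + g) X" for X
    by (simp add: ev_sum_def sum.distrib algebra_simps)
  ultimately show "\<exists>X0. \<forall>X\<ge>X0. vge (real N) (v + w - ev_sum m (f + g) X)" by metis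
qed

lemma ev_tends_1: "ev_tends m 1 (if m = 0 then 1 else 0)"
  unfolding ev_tends_def
proof (intro allI exI[of _ 1] impI)
  fix N X :: nat assume "1 \<le> X"
  then obtain Y where X: "X = Suc Y" by (cases X) auto
  have "ev_sum m 1 X = (if m = 0 then 1 else 0 :: 'a padic)"
    unfolding ev_sum_def X sum.lessThan_Suc_shift by (simp add: ev_coeff_def)
  then show "vge (real N) ((if m = 0 then 1 else 0) - ev_sum m (1 :: 'a padic fps) X)" by simp
qed

context
  assumes odd: "odd CARD('p::prime_card)"
begin

lemma ev_coeff_vge: "vge (real n / real CARD('p) - 1) (ev_coeff m n :: 'p padic)"
proof (cases "n mod (CARD('p) - 1) = m")
  case True
  let ?q = "CARD('p) - 1"
  have q: "?q > 0" using CARD_prime_gt_1[where 'p='p] by simp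
  have "n < ?q * (n div ?q) + ?q"
    using mod_less_divisor[OF q, of n] by (metis add_less_cancel_left mult_div_mod_eq)
  then have "real n < real ?q * (real (n div ?q) + 1)"
    by (simp add: distrib_left del: of_nat_diff flip: of_nat_mult of_nat_add)
  also have "\<dots> \<le> real CARD('p) * (real (n div ?q) + 1)"
    by (intro mult_right_mono) simp_all
  finally have "real n / real CARD('p) - 1 \<le> real (n div ?q)"
    by (simp add: field_simps)
  then show ?thesis using True by (simp add: ev_coeff_def vge_minus_CARD_power)
qed (simp add: ev_coeff_def)

lemma ev_coeff_vge_0: "vge 0 (ev_coeff m n :: 'p padic)"
  by (simp add: ev_coeff_def vge_minus_CARD_power)

text \<open>The identity \<open>y^k y^l = y^(k+l)\<close> in coordinates modulo
  \<open>y^(p-1) + p\<close>.\<close>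

lemma ev_coeff_add:
  assumes "m < CARD('p) - 1"
  shows "(\<Sum>i<CARD('p) - 1. \<Sum>j<CARD('p) - 1. ev_coeff i k * ev_coeff j l * ev_coeff m (i + j)) =
    (ev_coeff m (k + l) :: 'p padic)"
proof -
  let ?q = "CARD('p) - 1"
  have q: "?q > 0" using CARD_prime_gt_1[where 'p='p] by simp
  let ?c = "\<lambda>i j. (- of_nat CARD('p)) ^ (k div ?q) * (- of_nat CARD('p)) ^ (l div ?q) *
    (ev_coeff m (i + j) :: 'p padic)"
  have "(\<Sum>i<?q. \<Sum>j<?q. ev_coeff i k * ev_coeff j l * ev_coeff m (i + j)) =
    (\<Sum>i<?q. \<Sum>j<?q. if i = k mod ?q then (if j = l mod ?q then ?c i j else 0) else 0)"
    by (intro sum.cong refl) (simp add: ev_coeff_def[of _ k] ev_coeff_def[of _ l])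
  also have "\<dots> = (\<Sum>i<?q. if i = k mod ?q then (\<Sum>j<?q. if j = l mod ?q then ?c i j else 0) else 0)"
    by (intro sum.cong refl) simp
  also have "\<dots> = ?c (k mod ?q) (l mod ?q)"
    using mod_less_divisor[OF q] by (subst sum.delta, simp) (subst sum.delta, simp_all)
  also have "\<dots> = ev_coeff m (k + l)"
  proof -
    have "(k mod ?q + l mod ?q) mod ?q = (k + l) mod ?q" by (rule mod_add_eq)
    moreover have "(k + l) div ?q = k div ?q + l div ?q + (k mod ?q + l mod ?q) div ?q"
      by (rule div_add1_eq)
    ultimately show ?thesis by (simp only: ev_coeff_def power_add) (simp add: mult_ac)
  qed
  finally show ?thesis .
qed

lemma overconv_term_vge:
  assumes "overconv (f :: 'p padic fps)"
  shows "vge (real n / (6 * real CARD('p)) - 1) (f $ n * ev_coeff m n)"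
  using assms unfolding overconv_def
  by (intro vge_mult'[OF _ ev_coeff_vge, of "- 5 / 6 * (real n / real CARD('p))"])
    (auto simp: field_simps)

lemma ev_bound_real:
  fixes n N :: nat
  assumes "6 * CARD('p) * (N + 1) \<le> n"
  shows "real N \<le> real n / (6 * real CARD('p)) - 1"
proof -
  have "real (6 * CARD('p) * (N + 1)) \<le> real n" using assms by (simp only: of_nat_le_iff)
  then show ?thesis by (simp add: field_simps)
qed

lemma ev_sum_tail:
  assumes "overconv (f :: 'p padic fps)" "6 * CARD('p) * (N + 1) \<le> X" "X \<le> Y"
  shows "vge (real N) (ev_sum m f Y - ev_sum m f X)"
proof -
  have "ev_sum m f Y = ev_sum m f X + (\<Sum>n\<in>{X..<Y}. f $ n * ev_coeff m n)"
    unfolding ev_sum_def by (subst sum.union_disjoint[symmetric])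
      (use assms(3) in \<open>auto intro!: sum.cong\<close>)
  then have "ev_sum m f Y - ev_sum m f X = (\<Sum>n\<in>{X..<Y}. f $ n * ev_coeff m n)" by simp
  moreover have "vge (real N) (\<Sum>n\<in>{X..<Y}. f $ n * ev_coeff m n)"
  proof (rule vge_sum)
    fix n assume "n \<in> {X..<Y}"
    then have "real N \<le> real n / (6 * real CARD('p)) - 1" using assms(2) by (intro ev_bound_real) simp
    then show "vge (real N) (f $ n * ev_coeff m n)" by (rule vge_mono[OF overconv_term_vge[OF assms(1)]])
  qed
  ultimately show ?thesis by simp
qed

lemma ev_sum_vge: "overconv (f :: 'p padic fps) \<Longrightarrow> vge (- 1) (ev_sum m f X)"
  unfolding ev_sum_def by (rule vge_sum) (rule vge_mono[OF overconv_term_vge], simp_all)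

lemma overconv_mult:
  fixes f g :: "'p padic fps"
  assumes "overconv f" "overconv g"
  shows "overconv (f * g)"
  unfolding overconv_def fps_mult_nth
proof (intro allI vge_sum)
  fix n i :: nat assume i: "i \<in> {0..n}"
  show "vge (- 5 / 6 * (real n / real CARD('p))) (f $ i * g $ (n - i))"
    by (rule vge_mult'[OF assms(1)[unfolded overconv_def, rule_format, of i]
      assms(2)[unfolded overconv_def, rule_format, of "n - i"]])
       (use i in \<open>simp add: of_nat_diff field_simps\<close>)
qed

text \<open>The product of the truncations differs from the truncation of the product by the pairs
  with \<open>k, l < X \<le> k + l\<close>. The coefficient bounds of both factors add up, so these
  terms are as small as a tail.\<close>

lemma ev_sum_mult:
  fixes f g :: "'p padic fps"
  assumes f: "overconv f" and g: "overconv g" and m: "m < CARD('p) - 1" and X: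
    "6 * CARD('p) * (N + 1) \<le> X"
  shows "vge (real N) ((\<Sum>i<CARD('p) - 1. \<Sum>j<CARD('p) -
    1. ev_sum i f X * ev_sum j g X * ev_coeff m (i + j)) - ev_sum m (f * g) X)"
proof -
  let ?q = "CARD('p) - 1"
  let ?t = "\<lambda>k l. f $ k * g $ l * ev_coeff m (k + l)"
  let ?A = "{(k, l). k + l < X}" and ?B = "{..<X} \<times> {..<X}"
  have "(\<Sum>i<?q. \<Sum>j<?q. ev_sum i f X * ev_sum j g X * ev_coeff m (i + j)) =
     (\<Sum>i<?q. \<Sum>j<?q. \<Sum>k<X. \<Sum>l<X. f $ k * g $ l * (ev_coeff i k * ev_coeff j l * ev_coeff m (i + j)))"
    unfolding ev_sum_def sum_product unfolding sum_distrib_right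
      by (intro sum.cong refl) (simp only: mult_ac)
  also have "\<dots> = (\<Sum>k<X. \<Sum>l<X. \<Sum>i<?q. \<Sum>j<?q. f $ k * g $ l *
    (ev_coeff i k * ev_coeff j l * ev_coeff m (i + j)))"
    by (subst (2) sum.swap, subst (3) sum.swap, subst (1) sum.swap, subst (2) sum.swap) simp
  also have "\<dots> = (\<Sum>k<X. \<Sum>l<X. ?t k l)"
    by (simp only: sum_distrib_left[symmetric] ev_coeff_add[OF m])
  also have "\<dots> = (\<Sum>(k, l)\<in>?B. ?t k l)" by (simp add: sum.cartesian_product)
  also have "\<dots> = (\<Sum>(k, l)\<in>?A. ?t k l) + (\<Sum>(k, l)\<in>?B - ?A. ?t k l)"
    by (subst sum.subset_diff[of ?A ?B]) auto
  also have "(\<Sum>(k, l)\<in>?A. ?t k l) = ev_sum m (f * g) X"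
    unfolding sum.triangle_reindex ev_sum_def fps_mult_nth sum_distrib_right
    by (intro sum.cong) (auto simp: atMost_atLeast0)
  finally have "(\<Sum>i<?q. \<Sum>j<?q. ev_sum i f X * ev_sum j g X * ev_coeff m (i + j)) - ev_sum m (f * g) X =
    (\<Sum>(k, l)\<in>?B - ?A. ?t k l)"
    by simp
  moreover have "vge (real N) (\<Sum>(k, l)\<in>?B - ?A. ?t k l)"
  proof (rule vge_sum)
    fix x assume "x \<in> ?B - ?A"
    then obtain k l where x: "x = (k, l)" "X \<le> k + l" by auto
    have *: "vge (- 5 / 6 * (real k / real CARD('p)) + - 5 / 6 * (real l / real CARD('p)) +
      (real (k + l) / real CARD('p) - 1)) (?t k l)"
      using f g unfolding overconv_def by (intro vge_mult ev_coeff_vge) blast+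
    have "real N \<le> real (k + l) / (6 * real CARD('p)) - 1" using x X by (intro ev_bound_real) simp
    also have "\<dots> = - 5 / 6 * (real k / real CARD('p)) + - 5 / 6 * (real l / real CARD('p)) +
      (real (k + l) / real CARD('p) - 1)"
      by (simp add: field_simps)
    finally show "vge (real N) (case x of (k, l) \<Rightarrow> ?t k l)" using * unfolding x by (simp add: vge_mono)
  qed
  ultimately show ?thesis by simp
qed

lemma ev_tends_vge:
  assumes "overconv (f :: 'p padic fps)" "ev_tends m f v"
  shows "vge (- 1) v"
proof -
  obtain X where "vge (real 0) (v - ev_sum m f X)" using assms(2) unfolding ev_tends_def by blast
  then have "vge (- 1) (v - ev_sum m f X)" by (rule vge_mono) simp
  from vge_add[OF this ev_sum_vge[OF assms(1), of m X]] show ?thesis by simp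
qed

lemma ev_tends_mult:
  fixes f g :: "'p padic fps"
  assumes f: "overconv f" and g: "overconv g" and m: "m < CARD('p) - 1"
    and F: "\<And>i. i < CARD('p) - 1 \<Longrightarrow> ev_tends i f (F i)" and G: "\<And>i. i < CARD('p) - 1 \<Longrightarrow> ev_tends i g (G i)"
  shows "ev_tends m (f * g) (\<Sum>i<CARD('p) - 1. \<Sum>j<CARD('p) - 1. F i * G j * ev_coeff m (i + j))"
  unfolding ev_tends_def
proof
  fix N
  let ?q = "CARD('p) - 1"
  \<comment> \<open>The additional digit pays for the limits and partial sums, whose valuation is
    only known to be at least -1.\<close>
  have "\<exists>X0. \<forall>i<?q. \<forall>X\<ge>X0. vge (real (N + 1)) (F i - ev_sum i f X)"
  proof -
    have "\<forall>i. \<exists>h. i < ?q \<longrightarrow> (\<forall>X\<ge>h. vge (real (N + 1)) (F i - ev_sum i f X))"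
      using F unfolding ev_tends_def by blast
    from choice[OF this] obtain h where "\<And>i X. i < ?q \<Longrightarrow> X \<ge> h i \<Longrightarrow>
      vge (real (N + 1)) (F i - ev_sum i f X)"
      by blast
    then show ?thesis by (intro exI[of _ "\<Sum>i<?q. h i"])
      (meson finite_lessThan lessThan_iff member_le_sum order_trans zero_le)
  qed
  then obtain X0 where X0: "\<And>i X. i < ?q \<Longrightarrow> X \<ge> X0 \<Longrightarrow> vge (real (N + 1)) (F i - ev_sum i f X)" by blast
  have "\<exists>X0. \<forall>i<?q. \<forall>X\<ge>X0. vge (real (N + 1)) (G i - ev_sum i g X)"
  proof -
    have "\<forall>i. \<exists>h. i < ?q \<longrightarrow> (\<forall>X\<ge>h. vge (real (N + 1)) (G i - ev_sum i g X))"
      using G unfolding ev_tends_def by blast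
    from choice[OF this] obtain h where "\<And>i X. i < ?q \<Longrightarrow> X \<ge> h i \<Longrightarrow>
      vge (real (N + 1)) (G i - ev_sum i g X)"
      by blast
    then show ?thesis by (intro exI[of _ "\<Sum>i<?q. h i"])
      (meson finite_lessThan lessThan_iff member_le_sum order_trans zero_le)
  qed
  then obtain X1 where X1: "\<And>i X. i < ?q \<Longrightarrow> X \<ge> X1 \<Longrightarrow> vge (real (N + 1)) (G i - ev_sum i g X)" by blast
  define X2 where "X2 = max (max X0 X1) (6 * CARD('p) * (N + 1))"
  have "vge (real N) ((\<Sum>i<?q. \<Sum>j<?q. F i * G j * ev_coeff m (i + j)) - ev_sum m (f * g) X)" if X:
    "X \<ge> X2" for X
  proof (rule vge_diff_trans)
    show "vge (real N) ((\<Sum>i<?q. \<Sum>j<?q. ev_sum i f X * ev_sum j g X * ev_coeff m (i + j)) -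
      ev_sum m (f * g) X)"
      using X by (intro ev_sum_mult f g m) (simp add: X2_def)
    show "vge (real N) ((\<Sum>i<?q. \<Sum>j<?q. F i * G j * ev_coeff m (i + j)) -
      (\<Sum>i<?q. \<Sum>j<?q. ev_sum i f X * ev_sum j g X * ev_coeff m (i + j)))"
      unfolding sum_subtractf[symmetric]
    proof (intro vge_sum)
      fix i j assume "i \<in> {..<?q}" "j \<in> {..<?q}"
      then have ij: "i < ?q" "j < ?q" by simp_all
      have "vge (real N) (F i * (G j - ev_sum j g X) + (F i - ev_sum i f X) * ev_sum j g X)"
      proof (rule vge_add)
        show "vge (real N) (F i * (G j - ev_sum j g X))"
          by (rule vge_mult'[OF ev_tends_vge[OF f F[OF ij(1)]] X1[OF ij(2)]])
            (use X in \<open>simp_all add: X2_def\<close>)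
        show "vge (real N) ((F i - ev_sum i f X) * ev_sum j g X)"
          by (rule vge_mult'[OF X0[OF ij(1)] ev_sum_vge[OF g]]) (use X in \<open>simp_all add: X2_def\<close>)
      qed
      then have "vge (real N) ((F i * (G j - ev_sum j g X) + (F i - ev_sum i f X) * ev_sum j g X) *
        ev_coeff m (i + j))"
        by (rule vge_mult'[OF _ ev_coeff_vge_0]) simp
      moreover have "(F i * (G j - ev_sum j g X) + (F i - ev_sum i f X) * ev_sum j g X) *
        ev_coeff m (i + j) =
        F i * G j * ev_coeff m (i + j) - ev_sum i f X * ev_sum j g X * ev_coeff m (i + j)"
        by (simp add: algebra_simps)
      ultimately show "vge (real N) (F i * G j * ev_coeff m (i + j) -
        ev_sum i f X * ev_sum j g X * ev_coeff m (i + j))" by simp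
    qed
  qed
  then show "\<exists>X0. \<forall>X\<ge>X0. vge (real N) ((\<Sum>i<?q. \<Sum>j<?q. F i * G j * ev_coeff m (i + j)) -
    ev_sum m (f * g) X)" by blast
qed

text \<open>\<open>p y + y^p\<close> is \<open>y\<close> times the modulus
  \<open>y^(p-1) + p\<close>. With the factor \<open>y\<close> absorbed into \<open>g\<close>,
  multiplication by \<open>y^(p-1)\<close> shifts the partial sums by \<open>p - 1\<close> places
  and multiplies them by \<open>- p\<close>, so only \<open>p\<close> times a tail of
  \<open>g\<close> remains.\<close>

lemma ev_tends_kernel:
  fixes h :: "'p padic fps"
  assumes h: "overconv h"
  shows "ev_tends m ((fps_const (of_nat CARD('p)) * fps_X + fps_X ^ CARD('p)) * h) 0"
  unfolding ev_tends_def
proof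
  fix N
  let ?q = "CARD('p) - 1" let ?p = "of_nat CARD('p) :: 'p padic"
  define g where "g = fps_X * h"
  have q: "?q > 0" "CARD('p) = Suc ?q" using CARD_prime_gt_1[where 'p='p] by simp_all
  have g: "overconv g"
    unfolding overconv_def
  proof
    fix n
    have "vge (- 5 / 6 * (real (n - 1) / real CARD('p))) (h $ (n - 1))" using h unfolding overconv_def
      by blast
    moreover have "- 5 / 6 * (real n / real CARD('p)) \<le> - 5 / 6 * (real (n - 1) / real CARD('p))"
      by (simp add: divide_right_mono)
    ultimately show "vge (- 5 / 6 * (real n / real CARD('p))) (g $ n)"
      by (auto simp: g_def intro: vge_mono)
  qed
  have eq: "(fps_const ?p * fps_X + fps_X ^ CARD('p)) * h = fps_const ?p * g + fps_X ^ ?q * g"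
    unfolding g_def by (subst (2) q(2)) (simp only: power_Suc2, simp only: algebra_simps)
  have "ev_sum m (fps_const ?p * g + fps_X ^ ?q * g) (?q + X) =
    ?p * (ev_sum m g (?q + X) - ev_sum m g X)" for X
  proof -
    have e: "ev_coeff m (n + ?q) = - ?p * ev_coeff m n" for n
    proof -
      have "(n + ?q) div ?q = n div ?q + 1" using div_add_self2[of ?q n] q(1)
        by (simp only: less_not_refl2 not_False_eq_True)
      then show ?thesis unfolding ev_coeff_def mod_add_self2
        by (simp only: power_add power_one_right) simp
    qed
    have "ev_sum m (fps_X ^ ?q * g) (?q + X) =
      (\<Sum>n<?q + X. if n < ?q then 0 else g $ (n - ?q) * ev_coeff m n)"
      unfolding ev_sum_def by (intro sum.cong refl) (simp add: fps_X_power_mult_nth)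
    also have "\<dots> = (\<Sum>n\<in>{0 + ?q..<X + ?q}. g $ (n - ?q) * ev_coeff m n)"
      by (rule sum.mono_neutral_cong_right) auto
    also have "\<dots> = (\<Sum>n<X. g $ n * ev_coeff m (n + ?q))"
      unfolding sum.shift_bounds_nat_ivl by (simp add: atLeast0LessThan)
    also have "\<dots> = - ?p * ev_sum m g X"
      unfolding e ev_sum_def sum_distrib_left by (simp add: mult_ac)
    finally have "ev_sum m (fps_X ^ ?q * g) (?q + X) = - ?p * ev_sum m g X" .
    moreover have "ev_sum m (fps_const ?p * g) (?q + X) = ?p * ev_sum m g (?q + X)"
      unfolding ev_sum_def sum_distrib_left by (simp add: mult_ac)
    moreover have "ev_sum m (fps_const ?p * g + fps_X ^ ?q * g) (?q + X) =
      ev_sum m (fps_const ?p * g) (?q + X) + ev_sum m (fps_X ^ ?q * g) (?q + X)"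
      unfolding ev_sum_def by (simp add: sum.distrib distrib_right)
    ultimately show ?thesis by (simp add: right_diff_distrib)
  qed
  note ev = this
  have "vge (real N) (0 - ev_sum m (fps_const ?p * g + fps_X ^ ?q * g) X)" if X:
    "X \<ge> ?q + 6 * CARD('p) * (N + 1)" for X
  proof -
    have "?q \<le> X" using X by (rule add_leD1)
    then obtain Y where Y1: "X = ?q + Y" using le_Suc_ex by blast
    from X have "6 * CARD('p) * (N + 1) \<le> Y" unfolding Y1 by (simp only: add_le_cancel_left)
    note Y = Y1 this
    have "vge (real N) (ev_sum m g (?q + Y) - ev_sum m g Y)"
      by (rule ev_sum_tail[OF g Y(2) le_add2])
    then have "vge (real N) (?p * (ev_sum m g (?q + Y) - ev_sum m g Y))"
      by (rule vge_mult'[OF vge_of_nat[OF order_refl]]) simp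
    then show ?thesis unfolding Y(1) ev by simp
  qed
  then show "\<exists>X0. \<forall>X\<ge>X0. vge (real N) (0 - ev_sum m ((fps_const ?p * fps_X + fps_X ^ CARD('p)) * h) X)"
    unfolding eq by blast
qed

end

section \<open>Gamma at fractions with denominator p - 1\<close>

lemma padic_int_of_rat_eqI:
  "to_fract x = of_rat r \<Longrightarrow> padic_int_of_rat r = (x :: 'p::prime_card padic_int)"
  unfolding padic_int_of_rat_def to_fract_def[symmetric] by (rule the_equality) (metis to_fract_eq_iff)+

lemma padic_int_of_rat_divide:
  assumes "\<not> CARD('p) dvd b"
  obtains x :: "'p::prime_card padic_int" where "of_nat b * x = of_nat a"
    "padic_int_of_rat (of_nat a / of_nat b) = x"
proof -
  have "(of_nat b :: 'p padic_int) dvd 1" using assms by (simp add: of_nat_unit_padic_int_iff)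
  then obtain w where w: "1 = (of_nat b :: 'p padic_int) * w" ..
  define x where "x = of_nat a * w"
  have "of_nat b * x = of_nat a * (of_nat b * w)" by (simp add: x_def mult_ac)
  then have x: "of_nat b * x = of_nat a" using w by simp
  have "b \<noteq> 0" using assms by (intro notI) simp
  have "of_nat b * to_fract x = (of_nat a :: 'p padic)"
    using arg_cong[OF x, of to_fract] by (simp add: to_fract_of_nat)
  then have "to_fract x = (of_nat a / of_nat b :: 'p padic)"
    using \<open>b \<noteq> 0\<close> by (simp add: field_simps)
  then have "to_fract x = (of_rat (of_nat a / of_nat b) :: 'p padic)"
    by (simp add: of_rat_divide)
  then show ?thesis using that[OF x] padic_int_of_rat_eqI by blast
qed

lemma not_dvd_CARD_minus_1: "\<not> CARD('p::prime_card) dvd CARD('p) - 1"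
  using CARD_prime_gt_1[where 'p='p] by (intro nat_dvd_not_less) auto

definition gamma_frac :: "nat \<Rightarrow> 'p::prime_card padic" where
  "gamma_frac a = padic_Gamma_rat (of_nat a / of_nat (CARD('p) - 1))"

lemma gamma_frac_eq:
  obtains x :: "'p::prime_card padic_int"
  where "of_nat (CARD('p) - 1) * x = of_nat a" "gamma_frac a = to_fract (padic_Gamma x)"
proof -
  obtain x :: "'p padic_int" where "of_nat (CARD('p) - 1) * x = of_nat a"
    "padic_int_of_rat (of_nat a / of_nat (CARD('p) - 1)) = x"
    using padic_int_of_rat_divide[OF not_dvd_CARD_minus_1] by blast
  then show ?thesis by (intro that[of x]) (simp_all only: gamma_frac_def padic_Gamma_rat_def
    to_fract_def)
qed

section \<open>Additivity of Dwork's exponential\<close>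

text \<open>\<open>y\<close> times the modulus \<open>y^(p-1) + p\<close>, so that its multiples
  evaluate to 0.\<close>

definition dwork_kernel :: "'p::prime_card padic fps" where
  "dwork_kernel = fps_const (of_nat CARD('p)) * fps_X + fps_X ^ CARD('p)"

lemma dwork_kernel_nth:
  "dwork_kernel $ n = (if n = 1 then of_nat CARD('p) else if n =
    CARD('p) then 1 else (0 :: 'p::prime_card padic))"
  using CARD_prime_gt_1[where 'p='p] by (auto simp: dwork_kernel_def fps_X_power_nth)

lemma dwork_kernel_power_nth_eq_0:
  "CARD('p) * k < n \<Longrightarrow> (dwork_kernel :: 'p::prime_card padic fps) ^ k $ n = 0"
proof (induction k arbitrary: n)
  case (Suc k)
  have "dwork_kernel $ i * (dwork_kernel :: 'p padic fps) ^ k $ (n - i) = 0" for i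
  proof (cases "i \<le> CARD('p)")
    case True
    then have "CARD('p) * k < n - i" using Suc.prems by simp
    then show ?thesis using Suc.IH by simp
  qed (use CARD_prime_gt_1[where 'p='p] in \<open>simp add: dwork_kernel_nth\<close>)
  then show ?case unfolding power_Suc fps_mult_nth by (intro sum.neutral) blast
qed simp

text \<open>\<open>exp(z T) - 1\<close> is divisible by \<open>T\<close>, and here
  \<open>T = p y + y^p\<close>. That the composed exponential is the given \<open>dwork_exp\<close>
  follows from the differential equations: its product with the inverse \<open>?g\<close> has
  derivative 0 and constant term 1.\<close>

lemma dwork_exp_kernel:
  fixes z :: "'p::prime_card padic"
  shows "dwork_exp (of_nat CARD('p) * z) z = 1 +
    dwork_kernel * (Abs_fps (\<lambda>n. z ^ Suc n / fact (Suc n)) oo dwork_kernel)"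
proof -
  let ?L = "dwork_kernel :: 'p padic fps" and ?p = "of_nat CARD('p) :: 'p padic"
  have L0: "?L $ 0 = 0" using CARD_prime_gt_1[where 'p='p] by (simp add: dwork_kernel_nth)
  have "fps_exp z = 1 + fps_X * Abs_fps (\<lambda>n. z ^ Suc n / fact (Suc n))"
  proof (rule fps_ext)
    fix n
    show "fps_exp z $ n = (1 + fps_X * Abs_fps (\<lambda>n. z ^ Suc n / fact (Suc n))) $ n"
      by (cases n) (simp_all del: fact_Suc)
  qed
  then have E: "fps_exp z oo ?L = 1 + ?L * (Abs_fps (\<lambda>n. z ^ Suc n / fact (Suc n)) oo ?L)"
    by (simp add: fps_compose_add_distrib fps_compose_mult_distrib[OF L0] L0)
  let ?f = "fps_exp z oo ?L" and ?g = "dwork_exp (- (?p * z)) (- z)"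
  have dL: "fps_deriv ?L = fps_const ?p + fps_const ?p * fps_X ^ (CARD('p) - 1)"
    by (simp add: dwork_kernel_def fps_deriv_power' fps_of_nat)
  have "fps_deriv ?f = fps_const z * ?f * fps_deriv ?L"
    by (simp add: fps_compose_deriv[OF L0] fps_compose_mult_distrib[OF L0])
  then have df: "fps_deriv ?f = (fps_const (?p * z) + fps_const (?p * z) * fps_X ^ (CARD('p) - 1)) * ?f"
    unfolding dL by (simp add: algebra_simps fps_const_mult[symmetric] del: fps_const_mult)
  have dg: "fps_deriv ?g = - ((fps_const (?p * z) + fps_const (?p * z) * fps_X ^ (CARD('p) - 1)) * ?g)"
    unfolding dwork_exp_deriv by (simp add: algebra_simps fps_const_neg[symmetric] del: fps_const_neg)
  have "fps_deriv (?f * ?g) = 0"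
    unfolding fps_deriv_mult df dg by (simp add: algebra_simps)
  then have "?f * ?g = fps_const ((?f * ?g) $ 0)" by (simp only: fps_deriv_eq_0_iff)
  also have "(?f * ?g) $ 0 = 1" by (simp add: dwork_exp_nth)
  finally have fg: "?f * ?g = 1" by simp
  have Dg: "dwork_exp (?p * z) z * ?g = 1" by (simp add: dwork_exp_mult dwork_exp_0_right)
  have "?f = ?f * (dwork_exp (?p * z) z * ?g)" by (simp only: Dg mult_1_right)
  also have "\<dots> = dwork_exp (?p * z) z * (?f * ?g)" by (simp only: mult_ac)
  also have "\<dots> = dwork_exp (?p * z) z" by (simp only: fg mult_1_right)
  finally have "?f = dwork_exp (?p * z) z" .
  then show ?thesis using E by simp
qed

context
  assumes odd: "odd CARD('p::prime_card)"
begin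

text \<open>Give \<open>y\<close> the valuation \<open>1 / (p - 1)\<close>. Both terms of
  \<open>p y + y^p\<close> then have valuation \<open>p / (p - 1)\<close>, and the bound follows for
  powers because these weighted valuations add up.\<close>

lemma dwork_kernel_power_vge:
  "vge ((real CARD('p) * real k - real n) / (real CARD('p) -
    1)) ((dwork_kernel :: 'p padic fps) ^ k $ n)"
proof (induction k arbitrary: n)
  case 0
  have "- real n / (real CARD('p) - 1) \<le> 0"
    using CARD_ge_3[OF odd] by (simp add: divide_nonpos_pos)
  then show ?case by simp
next
  case (Suc k)
  have q: "real CARD('p) - 1 > 0" using CARD_ge_3[OF odd] by simp
  have L: "vge ((real CARD('p) - real i) / (real CARD('p) - 1)) (dwork_kernel $ i :: 'p padic)" for i
  proof -
    have "vge 1 (of_nat CARD('p) :: 'p padic)" using vge_CARD_power[of 1 1, where 'p='p] by simp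
    then show ?thesis using q by (simp add: dwork_kernel_nth)
  qed
  show ?case
    unfolding power_Suc fps_mult_nth
  proof (rule vge_sum)
    fix i assume "i \<in> {0..n}"
    then have "real (n - i) = real n - real i" by simp
    then show "vge ((real CARD('p) * real (Suc k) - real n) / (real CARD('p) - 1)) (dwork_kernel $ i *
      (dwork_kernel :: 'p padic fps) ^ k $ (n - i))"
      by (intro vge_mult'[OF L Suc[of "n - i"]]) (simp add: add_divide_distrib[symmetric] algebra_simps)
  qed
qed

text \<open>Terms with \<open>n > p k\<close> vanish by degree. In the others
  \<open>1 / (k + 1)!\<close> costs only \<open>k / (p - 1)\<close>, which leaves
  \<open>k - n / (p - 1)\<close>; by \<open>k \<ge> n / p\<close> and \<open>p \<ge> 3\<close> this
  is at least \<open>- n / (2 p)\<close>.\<close>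

lemma overconv_dwork_quotient:
  fixes z :: "'p padic"
  assumes z: "vge 0 z"
  shows "overconv (Abs_fps (\<lambda>n. z ^ Suc n / fact (Suc n)) oo dwork_kernel)"
  unfolding overconv_def fps_compose_nth
proof (intro allI vge_sum)
  fix n k :: nat
  let ?P = "real CARD('p)"
  have P: "?P \<ge> 3" using CARD_ge_3[OF odd] by simp
  have "vge (- real k / (?P - 1)) (1 / fact (Suc k) :: 'p padic)"
    using vge_inverse_fact[OF odd, of "Suc k"] by simp
  moreover have "vge 0 (z ^ Suc k)" using vge_power[OF z, of "Suc k"] by simp
  ultimately have "vge (0 + - real k / (?P - 1)) (z ^ Suc k * (1 / fact (Suc k)))" by (intro vge_mult)
  then have H: "vge (- real k / (?P - 1)) (z ^ Suc k / fact (Suc k))" by simp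
  show "vge (- 5 / 6 * (real n / ?P)) (Abs_fps (\<lambda>n. z ^ Suc n / fact (Suc n)) $ k *
    dwork_kernel ^ k $ n)"
  proof (cases "CARD('p) * k < n")
    case False
    have "vge (- real k / (?P - 1) + (?P * real k - real n) / (?P - 1)) (z ^ Suc k / fact (Suc k) *
      dwork_kernel ^ k $ n)"
      by (intro vge_mult H dwork_kernel_power_vge)
    moreover have "- 5 / 6 * (real n / ?P) \<le> - real k / (?P - 1) + (?P * real k - real n) / (?P - 1)"
    proof -
      have "n \<le> CARD('p) * k" using False by simp
      then have "real n \<le> ?P * real k" by (simp flip: of_nat_mult)
      then have 1: "real n / ?P \<le> real k" using P by (simp add: field_simps)
      have 2: "- real k / (?P - 1) + (?P * real k - real n) / (?P - 1) = real k - real n / (?P - 1)"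
      proof -
        have "- real k + (?P * real k - real n) = real k * (?P - 1) - real n"
          by (simp add: algebra_simps)
        then show ?thesis
          using P by (simp only: add_divide_distrib[symmetric]) (simp add: diff_divide_distrib)
      qed
      have "real n / (?P - 1) \<le> real n / (2 / 3 * ?P)"
        using P by (intro divide_left_mono) auto
      also have "\<dots> = 3 / 2 * (real n / ?P)" by simp
      also have "\<dots> \<le> real k + 5 / 6 * (real n / ?P)"
        using 1 by simp
      finally show ?thesis unfolding 2 by simp
    qed
    ultimately show ?thesis by (simp add: vge_mono)
  qed (simp add: dwork_kernel_power_nth_eq_0)
qed

text \<open>
  By the trace formula this is the Gauss sum of the \<open>m\<close>-th power of the inverse Teichmueller character, divided
  by \<open>p - 1\<close> and by the \<open>m\<close>-th power of a root of \<open>y\<^sup>p\<^sup>-\<^sup>1 = - p\<close>.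
\<close>

definition gross_koblitz :: "nat \<Rightarrow> 'p padic" where
  "gross_koblitz m = gamma_frac m / (1 - of_nat CARD('p))"

lemma dwork_exp_teichmuller_nth:
  assumes "t ^ (CARD('p) - 1) = (1 :: 'p padic_int)"
  shows "dwork_exp (to_fract t) (to_fract t / of_nat CARD('p)) $ n = dwork_coeff n * to_fract t ^ n"
proof -
  have "t ^ CARD('p) = t" using power_card_power_eq[OF assms, of 1] by simp
  then have "to_fract t ^ CARD('p) = to_fract t" by (metis to_fract_power)
  then show ?thesis using dwork_exp_scale[of "to_fract t" n] by simp
qed

lemma overconv_dwork_exp:
  assumes "t ^ (CARD('p) - 1) = (1 :: 'p padic_int)"
  shows "overconv (dwork_exp (to_fract t) (to_fract t / of_nat CARD('p)))"
  unfolding overconv_def dwork_exp_teichmuller_nth[OF assms]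
proof
  fix n
  have "real (n div CARD('p)) \<le> real n / real CARD('p)"
    using times_div_less_eq_dividend[of "CARD('p)" n]
    by (simp add: field_simps flip: of_nat_mult)
  then show "vge (- 5 / 6 * (real n / real CARD('p))) (dwork_coeff n * to_fract t ^ n)"
    using vge_power[of 0 "to_fract t" n] by (intro vge_mult'[OF dwork_coeff_vge[OF odd], of 0]) simp_all
qed

text \<open>Only indices congruent to \<open>m\<close> modulo \<open>p - 1\<close> contribute, and
  there the power of \<open>t\<close> is constantly \<open>t ^ m\<close>. A truncation at a multiple
  of \<open>p - 1\<close> is thus \<open>t ^ m\<close> times the truncated trace of
  \<open>gamma_trace\<close>; other truncations differ from it by a tail.\<close>

lemma ev_tends_dwork_exp:
  assumes t: "t ^ (CARD('p) - 1) = (1 :: 'p padic_int)" and m: "m < CARD('p) - 1"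
  shows "ev_tends m (dwork_exp (to_fract t) (to_fract t / of_nat CARD('p))) (to_fract t ^ m *
    gross_koblitz m)"
  unfolding ev_tends_def
proof
  fix N
  let ?q = "CARD('p) - 1" and ?p = "of_nat CARD('p) :: 'p padic" and ?c = "to_fract t"
  let ?f = "dwork_exp ?c (?c / ?p)"
  have q: "?q > 0" using m by simp
  obtain x where x: "of_nat ?q * x = (of_nat m :: 'p padic_int)"
    "gamma_frac m = to_fract (padic_Gamma x)"
    using gamma_frac_eq by blast
  have sum: "ev_sum m ?f (K * ?q) = ?c ^ m * (\<Sum>k<K. dwork_coeff (m + ?q * k) * (- ?p) ^ k)" for K
  proof -
    have "ev_sum m ?f (K * ?q) = (\<Sum>k<K. \<Sum>n\<in>{k * ?q..<k * ?q + ?q}. ?f $ n * ev_coeff m n)"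
      unfolding ev_sum_def by (rule sum.nat_group[symmetric])
    also have "\<dots> = (\<Sum>k<K. ?c ^ m * (dwork_coeff (m + ?q * k) * (- ?p) ^ k))"
    proof (rule sum.cong[OF refl])
      fix k
      have c: "?c ^ (m + k * ?q) = ?c ^ m"
      proof -
        have "?c ^ ?q = 1" using t by (metis to_fract_power to_fract_1)
        then show ?thesis by (simp only: power_add power_mult mult.commute[of k] power_one mult_1_right)
      qed
      have e: "ev_coeff m (r + k * ?q) = (if r = m then (- ?p) ^ k else 0)" if "r < ?q" for r
        using that by (simp add: ev_coeff_def del: diff_Suc_1)
      have "(\<Sum>n\<in>{k * ?q..<k * ?q + ?q}. ?f $ n * ev_coeff m n) =
        (\<Sum>r<?q. ?f $ (r + k * ?q) * ev_coeff m (r + k * ?q))"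
        using sum.shift_bounds_nat_ivl[of "\<lambda>n. ?f $ n * ev_coeff m n" 0 "k * ?q" ?q]
        by (simp only: add_0_left atLeast0LessThan add.commute[of ?q])
      also have "\<dots> = (\<Sum>r<?q. if r = m then ?f $ (m + k * ?q) * (- ?p) ^ k else 0)"
        by (intro sum.cong refl) (simp only: e lessThan_iff, simp)
      also have "\<dots> = ?f $ (m + k * ?q) * (- ?p) ^ k" using m
        by (simp only: sum.delta finite_lessThan lessThan_iff if_True)
      also have "\<dots> = ?c ^ m * (dwork_coeff (m + ?q * k) * (- ?p) ^ k)"
        unfolding dwork_exp_teichmuller_nth[OF t] c by (simp only: mult_ac)
      finally show "(\<Sum>n\<in>{k * ?q..<k * ?q + ?q}. ?f $ n * ev_coeff m n) =
        ?c ^ m * (dwork_coeff (m + ?q * k) * (- ?p) ^ k)" .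
    qed
    finally show ?thesis by (simp only: sum_distrib_left)
  qed
  have main: "vge (real N) (?c ^ m * gross_koblitz m - ev_sum m ?f (K * ?q))" if K: "K \<ge> 6 * N + 1" for K
  proof -
    let ?S = "\<Sum>k<K. dwork_coeff (m + ?q * k) * (- ?p) ^ k"
    have "vge (real N) (gamma_frac m - (1 - ?p) * ?S)"
      unfolding x(2) by (rule gamma_trace[OF odd x(1) _ K]) (use m in simp)
    moreover have "vge 0 (inverse (1 - ?p))"
    proof -
      have "(of_nat ?q :: 'p padic_int) dvd 1"
        unfolding of_nat_unit_padic_int_iff by (rule not_dvd_CARD_minus_1)
      then have "vge 0 (inverse (to_fract (of_nat ?q :: 'p padic_int)))" by (rule vge_inverse_unit)
      moreover have "1 - ?p = - to_fract (of_nat ?q)"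
        using CARD_prime_gt_1[where 'p='p] by (simp add: to_fract_of_nat of_nat_diff)
      ultimately show ?thesis by (simp only: inverse_minus_eq vge_uminus_iff)
    qed
    ultimately have "vge (real N) ((gamma_frac m - (1 - ?p) * ?S) * inverse (1 - ?p))"
      by (rule vge_mult') simp
    moreover have "1 - ?p \<noteq> 0"
    proof
      assume "1 - ?p = 0"
      then have "of_nat CARD('p) = (of_nat 1 :: 'p padic)" by simp
      then have "CARD('p) = 1" by (simp only: of_nat_eq_iff)
      then show False using CARD_prime_gt_1[where 'p='p] by simp
    qed
    ultimately have "vge (real N) (gross_koblitz m - ?S)"
      by (simp add: gross_koblitz_def field_simps)
    moreover have "vge 0 (?c ^ m)" using vge_power[of 0 ?c m] by simp
    ultimately have "vge (real N) (?c ^ m * (gross_koblitz m - ?S))"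
      by (intro vge_mult'[of 0 _ "real N"]) simp_all
    then show ?thesis unfolding sum by (simp only: right_diff_distrib)
  qed
  \<comment> \<open>The first summand makes the tail from the preceding multiple of
    \<open>p - 1\<close> negligible, the second meets the bound of the trace formula.\<close>
  define X0 where "X0 = (6 * CARD('p) * (N + 1) + (6 * N + 1)) * ?q"
  have "vge (real N) (?c ^ m * gross_koblitz m - ev_sum m ?f X)" if X: "X \<ge> X0" for X
  proof (rule vge_diff_trans)
    have K: "6 * CARD('p) * (N + 1) + (6 * N + 1) \<le> X div ?q"
      using X q by (simp only: X0_def less_eq_div_iff_mult_less_eq)
    then show "vge (real N) (?c ^ m * gross_koblitz m - ev_sum m ?f (X div ?q * ?q))"
      by (intro main) linarith
    have "6 * CARD('p) * (N + 1) \<le> X div ?q" using K by linarith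
    also have "X div ?q \<le> X div ?q * ?q"
    proof -
      have "1 \<le> ?q" using q by simp
      from mult_le_mono2[OF this, of "X div ?q"] show ?thesis by (simp only: mult_1_right)
    qed
    finally have "vge (real N) (ev_sum m ?f X - ev_sum m ?f (X div ?q * ?q))"
      by (intro ev_sum_tail[OF odd overconv_dwork_exp[OF t]] div_times_less_eq_dividend)
    then show "vge (real N) (ev_sum m ?f (X div ?q * ?q) - ev_sum m ?f X)"
      by (simp only: vge_diff_commute)
  qed
  then show "\<exists>X0. \<forall>X\<ge>X0. vge (real N) (?c ^ m * gross_koblitz m - ev_sum m ?f X)" by blast
qed

text \<open>Both sides are the \<open>m\<close>-th coordinate of \<open>E(t1 y) E(t2 y)\<close>: on
  the left through the product of the coordinates, on the right after discarding a multiple of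
  \<open>dwork_kernel\<close>. The value \<open>t3 = 0\<close> represents the residue 0, where
  \<open>E(t3 y)\<close> is 1.\<close>

lemma dwork_exp_additive:
  assumes t: "t1 ^ (CARD('p) - 1) = 1" "t2 ^ (CARD('p) - 1) = 1" "t3 = 0 \<or> t3 ^ (CARD('p) - 1) = 1"
    and z: "t1 + t2 = t3 + of_nat CARD('p) * (z :: 'p padic_int)" and m: "m < CARD('p) - 1"
  shows "(\<Sum>i<CARD('p) - 1. \<Sum>j<CARD('p) - 1. (to_fract t1 ^ i * gross_koblitz i) *
    (to_fract t2 ^ j * gross_koblitz j) * ev_coeff m (i + j)) =
    (if t3 = 0 then if m = 0 then 1 else 0 else to_fract t3 ^ m * gross_koblitz m)"
proof -
  let ?p = "of_nat CARD('p) :: 'p padic"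
  let ?E = "\<lambda>t. dwork_exp (to_fract t) (to_fract t / ?p)"
  let ?h = "Abs_fps (\<lambda>n. to_fract z ^ Suc n / fact (Suc n)) oo dwork_kernel"
  have "to_fract t1 + to_fract t2 = to_fract t3 + ?p * to_fract z"
    using arg_cong[OF z, of to_fract] by (simp add: to_fract_of_nat)
  moreover from this have "to_fract t1 / ?p + to_fract t2 / ?p = to_fract t3 / ?p + to_fract z"
    by (simp add: field_simps)
  ultimately have "?E t1 * ?E t2 = ?E t3 * dwork_exp (?p * to_fract z) (to_fract z)"
    by (simp only: dwork_exp_mult)
  also have "\<dots> = ?E t3 + dwork_kernel * (?h * ?E t3)"
    unfolding dwork_exp_kernel by (simp add: algebra_simps)
  finally have eq: "?E t1 * ?E t2 = ?E t3 + dwork_kernel * (?h * ?E t3)" .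
  have E0: "?E t3 = 1" if "t3 = 0" by (simp add: that dwork_exp_0_right)
  have "overconv (1 :: 'p padic fps)" by (auto simp: overconv_def)
  then have "overconv (?E t3)"
  proof (cases "t3 = 0")
    case True
    show ?thesis unfolding E0[OF True] by fact
  next
    case False
    then show ?thesis using t(3) overconv_dwork_exp[of t3] by simp
  qed
  then have "overconv (?h * ?E t3)"
    by (intro overconv_mult[OF odd] overconv_dwork_quotient) simp_all
  then have "ev_tends m (dwork_kernel * (?h * ?E t3)) 0"
    unfolding dwork_kernel_def by (rule ev_tends_kernel[OF odd])
  moreover have "ev_tends m (?E t3) (if t3 = 0 then if m =
    0 then 1 else 0 else to_fract t3 ^ m * gross_koblitz m)"
  proof (cases "t3 = 0")
    case True
    show ?thesis unfolding E0[OF True] using ev_tends_1[of m] by (simp only: True simp_thms if_True)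
  next
    case False
    then show ?thesis using t(3) ev_tends_dwork_exp[OF _ m, of t3] by simp
  qed
  ultimately have "ev_tends m (?E t1 * ?E t2) ((if t3 = 0 then if m =
    0 then 1 else 0 else to_fract t3 ^ m * gross_koblitz m) + 0)"
    unfolding eq by (intro ev_tends_add)
  from this[unfolded add_0_right] have A: "ev_tends m (?E t1 * ?E t2) (if t3 = 0 then if m =
    0 then 1 else 0 else to_fract t3 ^ m * gross_koblitz m)" .
  have B: "ev_tends m (?E t1 * ?E t2) (\<Sum>i<CARD('p) - 1. \<Sum>j<CARD('p) -
    1. (to_fract t1 ^ i * gross_koblitz i) * (to_fract t2 ^ j * gross_koblitz j) * ev_coeff m (i + j))"
    by (intro ev_tends_mult[OF odd] overconv_dwork_exp ev_tends_dwork_exp t m)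
  show ?thesis by (rule ev_tends_unique[OF B A])
qed

end

section \<open>Jacobi sums\<close>

definition jacobi_sum :: "'p::prime_card itself \<Rightarrow> nat \<Rightarrow> nat \<Rightarrow> 'p padic" where
  "jacobi_sum _ a b = (\<Sum>x\<in>UNIV. teichmuller_bar_pow a x * teichmuller_bar_pow b (1 - x :: 'p mod_ring))"

lemma sum_UNIV_nonzero:
  fixes f :: "'p::prime_card mod_ring \<Rightarrow> 'a::comm_monoid_add"
  shows "f 0 = 0 \<Longrightarrow> (\<Sum>x\<in>UNIV. f x) = (\<Sum>x\<in>UNIV - {0}. f x)"
  by (rule sum.mono_neutral_right) auto

lemma teichmuller_bar_pow_uminus:
  assumes "odd CARD('p)"
  shows "teichmuller_bar_pow b (- x :: 'p::prime_card mod_ring) = (- 1) ^ b * teichmuller_bar_pow b x"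
  using assms
  by (simp add: teichmuller_bar_pow_altdef teichmuller_uminus inverse_minus_eq power_minus[of
    "inverse _"])

lemma sum_shifted_product:
  fixes s :: "'p::prime_card mod_ring"
  assumes odd: "odd CARD('p)"
  shows "(\<Sum>x\<in>UNIV. teichmuller_bar_pow a x * teichmuller_bar_pow b (s - x)) =
    (if s = 0 then if (CARD('p) - 1) dvd a + b then (- 1) ^ b * of_nat (CARD('p) - 1) else 0
     else teichmuller_bar_pow (a + b) s * jacobi_sum TYPE('p) a b)"
proof (cases "s = 0")
  case True
  have "(\<Sum>x\<in>UNIV. teichmuller_bar_pow a x * teichmuller_bar_pow b (s - x)) =
    (\<Sum>x\<in>UNIV. (- 1) ^ b * teichmuller_bar_pow (a + b) (x :: 'p mod_ring))"
    using True by (intro sum.cong refl) (simp add: teichmuller_bar_pow_uminus[OF odd]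
      teichmuller_bar_pow_add)
  also have "\<dots> = (- 1) ^ b * (\<Sum>x\<in>UNIV. teichmuller_bar_pow (a + b) (x :: 'p mod_ring))"
    by (simp only: sum_distrib_left)
  also have "(\<Sum>x\<in>UNIV. teichmuller_bar_pow (a + b) (x :: 'p mod_ring)) =
    (if (CARD('p) - 1) dvd a + b then of_nat (CARD('p) - 1) else 0)"
  proof -
    let ?q = "CARD('p) - 1" and ?r = "(a + b) mod (CARD('p) - 1)"
    have q: "?q > 0" using CARD_prime_gt_1[where 'p='p] by simp
    have r: "?r < ?q" using q by (rule mod_less_divisor)
    have "(\<Sum>x\<in>UNIV. teichmuller_bar_pow (a + b) (x :: 'p mod_ring)) =
      (\<Sum>x\<in>UNIV - {0}. teichmuller_bar_pow (a + b) (x :: 'p mod_ring))"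
      by (rule sum_UNIV_nonzero) simp
    also have "\<dots> = (\<Sum>x\<in>UNIV - {0 :: 'p mod_ring}. teichmuller_bar_pow ?r x *
      to_fract (teichmuller x) ^ 0)"
      by (simp only: power_0 mult_1_right teichmuller_bar_pow_mod)
    also have "\<dots> = (if 0 = ?r then of_nat ?q else 0)"
      by (rule sum_teichmuller_orthogonal[OF r q])
    also have "0 = ?r \<longleftrightarrow> ?q dvd a + b" by (simp only: dvd_eq_mod_eq_0 eq_commute)
    finally show ?thesis .
  qed
  finally show ?thesis using True by simp
next
  case False
  have bij: "bij_betw ((*) s) UNIV UNIV"
    by (rule bij_betwI[where g="\<lambda>x. x / s"]) (use False in auto)
  have "(\<Sum>x\<in>UNIV. teichmuller_bar_pow a x * teichmuller_bar_pow b (s - x)) =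
    (\<Sum>x\<in>UNIV. teichmuller_bar_pow a (s * x) * teichmuller_bar_pow b (s - s * x))"
    using sum.reindex_bij_betw[OF bij, of "\<lambda>x. teichmuller_bar_pow a x * teichmuller_bar_pow b (s - x)"]
      by (rule sym)
  also have "\<dots> = (\<Sum>x\<in>UNIV. teichmuller_bar_pow (a + b) s *
    (teichmuller_bar_pow a x * teichmuller_bar_pow b (1 - x)))"
  proof (rule sum.cong[OF refl])
    fix x
    have "s - s * x = s * (1 - x)" by (simp add: algebra_simps)
    then show "teichmuller_bar_pow a (s * x) * teichmuller_bar_pow b (s - s * x) =
      teichmuller_bar_pow (a + b) s * (teichmuller_bar_pow a x * teichmuller_bar_pow b (1 - x))"
      by (simp only: teichmuller_bar_pow_mult teichmuller_bar_pow_add mult_ac)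
  qed
  also have "\<dots> = teichmuller_bar_pow (a + b) s * jacobi_sum TYPE('p) a b"
    by (simp only: jacobi_sum_def sum_distrib_left)
  finally show ?thesis using False by simp
qed

lemma jacobi_sum_mod:
  "jacobi_sum TYPE('p::prime_card) (a mod (CARD('p) - 1)) (b mod (CARD('p) - 1)) =
    jacobi_sum TYPE('p) a b"
  by (simp only: jacobi_sum_def teichmuller_bar_pow_mod)

text \<open>The Gross-Koblitz formula, in terms of Jacobi sums, where the powers of the uniformiser cancel.\<close>

theorem jacobi_sum_gamma:
  fixes a b :: nat
  assumes odd: "odd CARD('p::prime_card)" and a: "a < CARD('p) - 1" and b: "b < CARD('p) - 1"
  defines "m \<equiv> (a + b) mod (CARD('p) - 1)"
  shows "jacobi_sum TYPE('p) a b * gamma_frac m =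
    (if m = 0 then (- 1) ^ b * of_nat (CARD('p) - 1) else 0) -
    (- of_nat CARD('p)) ^ ((a + b) div (CARD('p) - 1)) * gamma_frac a * gamma_frac b"
proof -
  let ?q = "CARD('p) - 1"
  let ?Q = "of_nat ?q :: 'p padic"
  let ?w = "\<lambda>x :: 'p mod_ring. to_fract (teichmuller x)"
  let ?\<chi> = "teichmuller_bar_pow :: nat \<Rightarrow> 'p mod_ring \<Rightarrow> 'p padic"
  let ?G = "gross_koblitz :: nat \<Rightarrow> 'p padic"
  \<comment> \<open>The \<open>m\<close>-th coordinate of the substitute
    \<open>E(\<omega>(s) y)\<close> for an additive character at \<open>s\<close>.\<close>
  define R where "R = (\<lambda>s. if s = 0 then if m = 0 then 1 else 0 else ?w s ^ m * ?G m)"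
  have q: "?q > 0" using a by simp
  have m: "m < ?q" unfolding m_def using q by (rule mod_less_divisor)
  have add: "(\<Sum>i<?q. \<Sum>j<?q. (?w x ^ i * ?G i) * (?w y ^ j * ?G j) * ev_coeff m (i + j)) = R (x + y)"
    if "x \<noteq> 0" "y \<noteq> 0" for x y
  proof -
    define t where "t = (if x + y = 0 then 0 else teichmuller (x + y) :: 'p padic_int)"
    have t: "t = 0 \<or> t ^ ?q = 1" using teichmuller_power[of "x + y"] by (auto simp: t_def)
    have t0: "t = 0 \<longleftrightarrow> x + y = 0" using teichmuller_nonzero[of "x + y"] by (auto simp: t_def)
    have "padic_residue t = x + y" using teichmuller_residue[of "x + y"] by (auto simp: t_def)
    then have "padic_residue (teichmuller x + teichmuller y - t) = 0"
      by (simp only: padic_residue_add padic_residue_diff teichmuller_residue[OF that(1)]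
        teichmuller_residue[OF that(2)] diff_self)
    then obtain z where "teichmuller x + teichmuller y - t = of_nat CARD('p) * z"
      unfolding padic_residue_eq_0_iff by (elim dvdE)
    then have z: "teichmuller x + teichmuller y = t + of_nat CARD('p) * z" by (simp add: algebra_simps)
    have "R (x + y) = (if t = 0 then if m = 0 then 1 else 0 else to_fract t ^ m * ?G m)"
      unfolding R_def t0 by (simp add: t_def)
    then show ?thesis
      using dwork_exp_additive[OF odd teichmuller_power[OF that(1)] teichmuller_power[OF that(2)] t z m]
        by simp
  qed
  \<comment> \<open>The double sum is the \<open>m\<close>-th coordinate of a product of two Gauss
    sums and is computed twice: here by orthogonality in \<open>x\<close> and \<open>y\<close>,
    below by collecting the terms with the same \<open>s = x + y\<close>.\<close>
  have "(\<Sum>x\<in>UNIV - {0}. \<Sum>y\<in>UNIV - {0}. ?\<chi> a x * ?\<chi> b y * R (x + y)) =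
    (\<Sum>x\<in>UNIV - {0}. \<Sum>y\<in>UNIV - {0}. \<Sum>i<?q. \<Sum>j<?q. (?G i * ?G j * ev_coeff m (i + j)) *
      ((?\<chi> a x * ?w x ^ i) * (?\<chi> b y * ?w y ^ j)))"
  proof (intro sum.cong refl)
    fix x y :: "'p mod_ring" assume "x \<in> UNIV - {0}" "y \<in> UNIV - {0}"
    then have "R (x + y) = (\<Sum>i<?q. \<Sum>j<?q. (?w x ^ i * ?G i) * (?w y ^ j * ?G j) * ev_coeff m (i + j))"
      using add[of x y] by simp
    then show "?\<chi> a x * ?\<chi> b y * R (x + y) =
      (\<Sum>i<?q. \<Sum>j<?q. (?G i * ?G j * ev_coeff m (i + j)) * ((?\<chi> a x * ?w x ^ i) * (?\<chi> b y * ?w y ^ j)))"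
      by (simp only: sum_distrib_left) (simp only: mult_ac)
  qed
  also have "\<dots> = (\<Sum>i<?q. \<Sum>j<?q. \<Sum>x\<in>UNIV - {0}. \<Sum>y\<in>UNIV -
    {0}. (?G i * ?G j * ev_coeff m (i + j)) * ((?\<chi> a x * ?w x ^ i) * (?\<chi> b y * ?w y ^ j)))"
    by (subst (2) sum.swap, subst (3) sum.swap, subst (1) sum.swap, subst (2) sum.swap) simp
  also have "\<dots> = (\<Sum>i<?q. \<Sum>j<?q. (?G i * ?G j * ev_coeff m (i + j)) *
    ((\<Sum>x\<in>UNIV - {0}. ?\<chi> a x * ?w x ^ i) * (\<Sum>y\<in>UNIV - {0}. ?\<chi> b y * ?w y ^ j)))"
    by (simp only: sum_distrib_left[symmetric] sum_product)
  also have "\<dots> = (\<Sum>i<?q. \<Sum>j<?q. if i = a then if j =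
    b then ?G a * ?G b * ev_coeff m (a + b) * (?Q * ?Q) else 0 else 0)"
    using a b by (intro sum.cong refl) (simp only: sum_teichmuller_orthogonal lessThan_iff, simp)
  also have "\<dots> = (\<Sum>i<?q. if i = a then \<Sum>j<?q. if j =
    b then ?G a * ?G b * ev_coeff m (a + b) * (?Q * ?Q) else 0 else 0)"
    by (intro sum.cong refl) simp
  also have "\<dots> = ?G a * ?G b * ev_coeff m (a + b) * (?Q * ?Q)"
    using a b by (simp only: sum.delta finite_lessThan lessThan_iff if_True)
  also have "(ev_coeff m (a + b) :: 'p padic) = (- of_nat CARD('p)) ^ ((a + b) div ?q)"
    by (simp only: ev_coeff_def m_def if_True simp_thms)
  finally have L: "(\<Sum>x\<in>UNIV - {0}. \<Sum>y\<in>UNIV - {0}. ?\<chi> a x * ?\<chi> b y * R (x + y)) =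
    ?G a * ?G b * (- of_nat CARD('p)) ^ ((a + b) div ?q) * (?Q * ?Q)" .
  have "(\<Sum>x\<in>UNIV - {0}. \<Sum>y\<in>UNIV - {0}. ?\<chi> a x * ?\<chi> b y * R (x + y)) =
    (\<Sum>x\<in>UNIV - {0}. \<Sum>y\<in>UNIV. ?\<chi> a x * ?\<chi> b y * R (x + y))"
    by (intro sum.cong refl sum_UNIV_nonzero[symmetric]) simp
  also have "\<dots> = (\<Sum>x\<in>UNIV. \<Sum>y\<in>UNIV. ?\<chi> a x * ?\<chi> b y * R (x + y))"
    by (rule sum_UNIV_nonzero[symmetric]) simp
  also have "\<dots> = (\<Sum>x\<in>UNIV. \<Sum>s\<in>UNIV. ?\<chi> a x * ?\<chi> b (s - x) * R s)"
  proof (rule sum.cong[OF refl])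
    fix x :: "'p mod_ring"
    have "bij_betw (\<lambda>y. x + y) UNIV UNIV" by (rule bij_betwI[where g="\<lambda>s. s - x"]) auto
    from sum.reindex_bij_betw[OF this, of "\<lambda>s. ?\<chi> a x * ?\<chi> b (s - x) * R s"]
    show "(\<Sum>y\<in>UNIV. ?\<chi> a x * ?\<chi> b y * R (x + y)) = (\<Sum>s\<in>UNIV. ?\<chi> a x * ?\<chi> b (s - x) * R s)" by simp
  qed
  also have "\<dots> = (\<Sum>s\<in>UNIV. \<Sum>x\<in>UNIV. ?\<chi> a x * ?\<chi> b (s - x) * R s)" by (rule sum.swap)
  also have "\<dots> = (\<Sum>s\<in>UNIV. (\<Sum>x\<in>UNIV. ?\<chi> a x * ?\<chi> b (s - x)) * R s)" by (simp only: sum_distrib_right)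
  also have "\<dots> = (\<Sum>x\<in>UNIV. ?\<chi> a x * ?\<chi> b (0 - x)) * R 0 +
    (\<Sum>s\<in>UNIV - {0}. (\<Sum>x\<in>UNIV. ?\<chi> a x * ?\<chi> b (s - x)) * R s)"
    by (rule sum.remove) simp_all
  also have "(\<Sum>x\<in>UNIV. ?\<chi> a x * ?\<chi> b (0 - x)) * R 0 = (if m = 0 then (- 1) ^ b * ?Q else 0)"
  proof -
    have "m = 0 \<longleftrightarrow> ?q dvd a + b" by (simp only: m_def dvd_eq_mod_eq_0)
    then show ?thesis unfolding sum_shifted_product[OF odd, of a b 0] R_def by simp
  qed
  also have "(\<Sum>s\<in>UNIV - {0}. (\<Sum>x\<in>UNIV. ?\<chi> a x * ?\<chi> b (s - x)) * R s) =
    (\<Sum>s\<in>UNIV - {0 :: 'p mod_ring}. jacobi_sum TYPE('p) a b * ?G m)"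
  proof (rule sum.cong[OF refl])
    fix s :: "'p mod_ring" assume "s \<in> UNIV - {0}"
    then have s: "s \<noteq> 0" by simp
    have "?\<chi> (a + b) s * ?w s ^ m = 1"
      unfolding teichmuller_bar_pow_mod[of "a + b", symmetric] m_def[symmetric]
      using s to_fract_teichmuller_nonzero[OF s] by (simp add: teichmuller_bar_pow_altdef power_inverse)
    moreover have "?\<chi> (a + b) s * jacobi_sum TYPE('p) a b * (?w s ^ m * ?G m) =
        (?\<chi> (a + b) s * ?w s ^ m) * (jacobi_sum TYPE('p) a b * ?G m)"
      by (simp only: mult_ac)
    ultimately have "?\<chi> (a + b) s * jacobi_sum TYPE('p) a b * (?w s ^ m * ?G m) =
      jacobi_sum TYPE('p) a b * ?G m"
      by (simp only: mult_1_left)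
    then show "(\<Sum>x\<in>UNIV. ?\<chi> a x * ?\<chi> b (s - x)) * R s = jacobi_sum TYPE('p) a b * ?G m"
      unfolding sum_shifted_product[OF odd] R_def using s by simp
  qed
  also have "\<dots> = ?Q * (jacobi_sum TYPE('p) a b * ?G m)"
    by (simp only: sum_constant card_Diff_singleton_if) (simp add: card_Diff_singleton)
  finally have main: "?G a * ?G b * (- of_nat CARD('p)) ^ ((a + b) div ?q) * (?Q * ?Q) =
    (if m = 0 then (- 1) ^ b * ?Q else 0) + ?Q * (jacobi_sum TYPE('p) a b * ?G m)"
    unfolding L .
  have Q0: "?Q \<noteq> 0" unfolding of_nat_eq_0_iff using q by simp
  have "1 - of_nat CARD('p) = - ?Q"
    using CARD_prime_gt_1[where 'p='p] by (simp add: of_nat_diff)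
  then have G: "?G c = - gamma_frac c / ?Q" for c
    unfolding gross_koblitz_def[OF odd] by (simp only: divide_minus_right minus_divide_left)
  have alg: "J * M = D - P * A * B"
    if "- A / Q * (- B / Q) * P * (Q * Q) = D + Q * (J * (- M / Q))" "Q \<noteq> 0" for A B P D J M Q ::
      "'p padic"
  proof -
    have "A * B * P = D - J * M" using that by simp
    then show ?thesis by (simp add: mult_ac)
  qed
  show ?thesis by (rule alg[OF main[unfolded G] Q0])
qed

section \<open>The reflection formula\<close>

lemma gamma_frac_0 [simp]: "odd CARD('p) \<Longrightarrow> gamma_frac 0 = (1 :: 'p::prime_card padic)"
proof -
  assume odd: "odd CARD('p)"
  obtain x :: "'p padic_int" where x: "of_nat (CARD('p) - 1) * x = of_nat 0"
    "gamma_frac 0 = to_fract (padic_Gamma x)"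
    using gamma_frac_eq by blast
  have "of_nat (CARD('p) - 1) \<noteq> (0 :: 'p padic_int)"
    unfolding of_nat_eq_0_iff using CARD_prime_gt_1[where 'p='p] by simp
  then have "x = 0" using x(1) by (simp only: of_nat_0 mult_eq_0_iff simp_thms)
  then show ?thesis using x(2) padic_Gamma_0[OF odd] by simp
qed

lemma gamma_frac_nonzero: "odd CARD('p) \<Longrightarrow> gamma_frac a \<noteq> (0 :: 'p::prime_card padic)"
proof -
  assume odd: "odd CARD('p)"
  obtain x :: "'p padic_int" where "gamma_frac a = to_fract (padic_Gamma x)"
    using gamma_frac_eq by blast
  then show ?thesis using padic_Gamma_unit[OF odd, of x] by auto
qed

text \<open>The sum becomes one of a single nontrivial character at \<open>x / (1 - x)\<close>. This
  quotient takes every value except -1, and the complete character sum vanishes.\<close>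

lemma jacobi_sum_reflect:
  assumes odd: "odd CARD('p::prime_card)" and a: "0 < a" "a < CARD('p) - 1"
  shows "jacobi_sum TYPE('p) a (CARD('p) - 1 - a) = - ((- 1) ^ a)"
proof -
  let ?q = "CARD('p) - 1" let ?\<chi> = "teichmuller_bar_pow :: nat \<Rightarrow> 'p mod_ring \<Rightarrow> 'p padic"
  have bij: "bij_betw (\<lambda>x :: 'p mod_ring. x / (1 - x)) (UNIV - {1}) (UNIV - {- 1})"
  proof (rule bij_betwI[where g="\<lambda>y. y / (1 + y)"])
    have 1: "1 + x / (1 - x) = 1 / (1 - x)" "1 - x \<noteq> 0" if "x \<in> UNIV - {1}" for x :: "'p mod_ring"
    proof -
      show nz: "1 - x \<noteq> 0" using that by simp
      have "1 + x / (1 - x) = ((1 - x) + x) / (1 - x)" unfolding add_divide_distrib using nz by simp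
      then show "1 + x / (1 - x) = 1 / (1 - x)" by simp
    qed
    have 2: "1 - y / (1 + y) = 1 / (1 + y)" "1 + y \<noteq> 0" if "y \<in> UNIV - {- 1}" for y :: "'p mod_ring"
    proof -
      show nz: "1 + y \<noteq> 0"
      proof
        assume "1 + y = 0"
        then have "y = - 1" by (simp only: add_eq_0_iff2 add.commute[of 1])
        then show False using that by simp
      qed
      have "1 - y / (1 + y) = ((1 + y) - y) / (1 + y)" unfolding diff_divide_distrib using nz by simp
      then show "1 - y / (1 + y) = 1 / (1 + y)" by simp
    qed
    show "(\<lambda>x. x / (1 - x)) \<in> UNIV - {1} \<rightarrow> UNIV - {- 1 :: 'p mod_ring}"
    proof
      fix x :: "'p mod_ring" assume x: "x \<in> UNIV - {1}"
      have "x / (1 - x) \<noteq> - 1"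
      proof
        assume "x / (1 - x) = - 1"
        then show False using 1[OF x] by simp
      qed
      then show "x / (1 - x) \<in> UNIV - {- 1}" by simp
    qed
    show "(\<lambda>y. y / (1 + y)) \<in> UNIV - {- 1} \<rightarrow> UNIV - {1 :: 'p mod_ring}"
    proof
      fix y :: "'p mod_ring" assume y: "y \<in> UNIV - {- 1}"
      have "y / (1 + y) \<noteq> 1"
      proof
        assume "y / (1 + y) = 1"
        then show False using 2[OF y] by simp
      qed
      then show "y / (1 + y) \<in> UNIV - {1}" by simp
    qed
    show "x / (1 - x) / (1 + x / (1 - x)) = x" if "x \<in> UNIV - {1}" for x :: "'p mod_ring"
      unfolding 1(1)[OF that] using 1(2)[OF that] by simp
    show "y / (1 + y) / (1 - y / (1 + y)) = y" if "y \<in> UNIV - {- 1}" for y :: "'p mod_ring"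
      unfolding 2(1)[OF that] using 2(2)[OF that] by simp
  qed
  have "jacobi_sum TYPE('p) a (?q - a) = (\<Sum>x\<in>UNIV - {1}. ?\<chi> a x * ?\<chi> (?q - a) (1 - x))"
    unfolding jacobi_sum_def by (rule sum.mono_neutral_right) auto
  also have "\<dots> = (\<Sum>x\<in>UNIV - {1}. ?\<chi> a (x / (1 - x)))"
  proof (rule sum.cong[OF refl])
    fix x :: "'p mod_ring" assume "x \<in> UNIV - {1}"
    then have x: "1 - x \<noteq> 0" by simp
    have "?\<chi> a (1 - x) * ?\<chi> (?q - a) (1 - x) = 1"
      using teichmuller_bar_pow_period[OF x, of 1] a by (simp flip: teichmuller_bar_pow_add)
    moreover have "?\<chi> a x = ?\<chi> a (x / (1 - x)) * ?\<chi> a (1 - x)"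
      using x by (simp flip: teichmuller_bar_pow_mult)
    ultimately show "?\<chi> a x * ?\<chi> (?q - a) (1 - x) = ?\<chi> a (x / (1 - x))" by (simp add: mult.assoc)
  qed
  also have "\<dots> = (\<Sum>y\<in>UNIV - {- 1}. ?\<chi> a y)" by (rule sum.reindex_bij_betw[OF bij])
  also have "\<dots> = (\<Sum>y\<in>UNIV. ?\<chi> a y) - ?\<chi> a (- 1)" by (simp add: sum_diff1)
  also have "(\<Sum>y\<in>UNIV. ?\<chi> a y) = 0"
  proof -
    have "(\<Sum>y\<in>UNIV. ?\<chi> a y) = (\<Sum>y\<in>UNIV - {0}. ?\<chi> a y * to_fract (teichmuller y) ^ 0)"
      by (simp add: sum_UNIV_nonzero)
    also have "\<dots> = 0" using sum_teichmuller_orthogonal[of a 0, where 'p='p] a by simp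
    finally show ?thesis .
  qed
  also have "?\<chi> a (- 1) = (- 1) ^ a" using teichmuller_bar_pow_uminus[OF odd, of a 1] by simp
  finally show ?thesis by simp
qed

lemma even_CARD_minus_1: "odd CARD('p::prime_card) \<Longrightarrow> even (CARD('p) - 1)"
  by simp

lemma minus_one_power_complement:
  assumes "even q" "a \<le> q"
  shows "(- 1) ^ (q - a) = ((- 1) ^ a :: 'a::ring_1)"
  using assms by (cases "even a") (simp_all add: even_diff_nat)

text \<open>The formula for Jacobi sums at \<open>b = p - 1 - a\<close>, where \<open>m = 0\<close>
  and the Jacobi sum is known; a factor \<open>p\<close> cancels.\<close>

lemma gamma_frac_reflect:
  assumes odd: "odd CARD('p::prime_card)" and a: "0 < a" "a < CARD('p) - 1"
  shows "gamma_frac a * gamma_frac (CARD('p) - 1 - a) = - ((- 1) ^ a :: 'p padic)"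
proof -
  let ?q = "CARD('p) - 1"
  let ?g = "gamma_frac a * gamma_frac (?q - a) :: 'p padic"
  have b: "?q - a < ?q" "a + (?q - a) = ?q" using a by simp_all
  have q: "?q > 0" using a by simp
  have "(- 1) ^ (?q - a) = ((- 1) ^ a :: 'p padic)"
    using even_CARD_minus_1[OF odd] a by (intro minus_one_power_complement) simp_all
  then have E: "- ((- 1) ^ a) = (- 1) ^ a * of_nat ?q + of_nat CARD('p) * ?g"
    using jacobi_sum_gamma[OF odd a(2) b(1)] jacobi_sum_reflect[OF odd a] gamma_frac_0[OF odd] q
    unfolding b(2) by (simp only: mod_self simp_thms if_True div_self neq0_conv[symmetric]
      power_one_right mult_1_right) (simp add: mult.assoc)
  have P: "of_nat CARD('p) = (of_nat ?q + 1 :: 'p padic)"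
    using CARD_prime_gt_1[where 'p='p] by (simp add: of_nat_diff)
  have "of_nat CARD('p) * ?g = - ((- 1) ^ a) - (- 1) ^ a * of_nat ?q"
    unfolding E by (simp only: add_diff_cancel_left')
  also have "\<dots> = of_nat CARD('p) * - ((- 1) ^ a)"
  proof -
    have "- s - s * c = (c + 1) * - s" for s c :: "'p padic" by (simp add: algebra_simps)
    then show ?thesis unfolding P .
  qed
  finally have "of_nat CARD('p) * ?g = of_nat CARD('p) * - ((- 1) ^ a)" .
  then show ?thesis by (simp only: mult_left_cancel[OF CARD_padic_nonzero])
qed

section \<open>Counting the points\<close>

lemma proj_rel_class:
  "(a, b) \<noteq> (0, 0) \<Longrightarrow> proj_rel `` {(a, b)} = {(c * a, c * b) | c. c \<noteq> 0}"
  by (auto simp: proj_rel_def)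

lemma proj_rel_class_scale:
  fixes a b :: "'a::field"
  assumes "(a, b) \<noteq> (0, 0)" "c \<noteq> 0"
  shows "proj_rel `` {(c * a, c * b)} = proj_rel `` {(a, b)}"
proof -
  have "{(e * (c * a), e * (c * b)) | e. e \<noteq> 0} = {(e * a, e * b) | e. e \<noteq> 0}"
  proof (intro equalityI subsetI)
    fix x assume "x \<in> {(e * (c * a), e * (c * b)) | e. e \<noteq> 0}"
    then obtain e where "e \<noteq> 0" "x = (e * (c * a), e * (c * b))" by blast
    then show "x \<in> {(e * a, e * b) | e. e \<noteq> 0}"
      using assms(2) by (auto intro!: exI[of _ "e * c"] simp: mult.assoc)
  next
    fix x assume "x \<in> {(e * a, e * b) | e. e \<noteq> 0}"
    then obtain e where "e \<noteq> 0" "x = (e * a, e * b)" by blast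
    then show "x \<in> {(e * (c * a), e * (c * b)) | e. e \<noteq> 0}"
      using assms(2) by (auto intro!: exI[of _ "e / c"])
  qed
  moreover have nz: "(c * a, c * b) \<noteq> (0, 0)" using assms by auto
  ultimately show ?thesis unfolding proj_rel_class[OF assms(1)] proj_rel_class[OF nz] by simp
qed

text \<open>At a point with \<open>x2 = 0\<close> the equation forces \<open>x1 = 0\<close>, so
  every solution lies in the chart \<open>x1 / x2\<close>.\<close>

lemma num_points_Z_affine:
  fixes l :: "'p::prime_card mod_ring"
  assumes d: "d \<ge> 2"
  shows "num_points_Z d l = card {x. x ^ d + 1 = of_nat d * l * x}"
proof -
  let ?f = "\<lambda>x :: 'p mod_ring. proj_rel `` {(x, 1)}"
  let ?A = "{x. x ^ d + 1 = of_nat d * l * x}"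
  let ?B = "{P \<in> proj_line. \<exists>x1 x2. (x1, x2) \<in> P \<and> x1 ^ d + x2 ^ d = of_nat d * l * x1 * x2 ^ (d - 1)}"
  have cl: "?f x = {(c * x, c) | c. c \<noteq> 0}" for x
    using proj_rel_class[of x 1] by simp
  have inj: "inj_on ?f ?A"
  proof (rule inj_onI)
    fix x y assume "?f x = ?f y"
    moreover have "(x, 1) \<in> ?f x" unfolding cl by (auto intro!: exI[of _ 1])
    ultimately have "(x, 1) \<in> ?f y" by simp
    then show "x = y" unfolding cl by auto
  qed
  have im: "?f ` ?A = ?B"
  proof (intro equalityI subsetI)
    fix P assume "P \<in> ?f ` ?A"
    then obtain x where x: "P = ?f x" "x ^ d + 1 = of_nat d * l * x" by blast
    have "P \<in> proj_line" unfolding x proj_line_def by (rule quotientI) simp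
    moreover have "(x, 1) \<in> P" unfolding x cl by (auto intro!: exI[of _ 1])
    moreover have "x ^ d + 1 ^ d = of_nat d * l * x * 1 ^ (d - 1)" using x(2) by simp
    ultimately show "P \<in> ?B" by blast
  next
    fix P assume "P \<in> ?B"
    then obtain x1 x2 where P: "P \<in> proj_line" "(x1, x2) \<in> P"
      "x1 ^ d + x2 ^ d = of_nat d * l * x1 * x2 ^ (d - 1)" by blast
    then obtain a b where ab: "(a, b) \<noteq> (0, 0)" "P = proj_rel `` {(a, b)}"
      unfolding proj_line_def by (auto elim!: quotientE)
    then obtain c where c: "c \<noteq> 0" "x1 = c * a" "x2 = c * b"
      using P(2) by (auto simp: proj_rel_class[OF ab(1)])
    have Px: "P = proj_rel `` {(x1, x2)}"
      unfolding ab(2) c(2,3) by (rule proj_rel_class_scale[OF ab(1) c(1), symmetric])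
    have x2: "x2 \<noteq> 0"
    proof
      assume "x2 = 0"
      then have "x1 ^ d = 0" using P(3) d by (simp add: power_0_left)
      then have "x1 = 0" by simp
      then show False using \<open>x2 = 0\<close> ab(1) c by simp
    qed
    define x where "x = x1 / x2"
    have x1: "x1 = x2 * x" using x2 by (simp add: x_def)
    have "P = ?f x"
      unfolding Px x1 using proj_rel_class_scale[of x 1 x2] x2 by simp
    moreover have "x ^ d + 1 = of_nat d * l * x"
    proof -
      have "x2 ^ d * (x ^ d + 1) = x2 ^ d * (of_nat d * l * x)"
      proof -
        have "x2 ^ d = x2 * x2 ^ (d - 1)" using d by (cases d) auto
        then show ?thesis using P(3) unfolding x1 power_mult_distrib by (simp add: algebra_simps)
      qed
      then show ?thesis using x2 by simp
    qed
    ultimately show "P \<in> ?f ` ?A" by blast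
  qed
  show ?thesis unfolding num_points_Z_def im[symmetric] by (rule card_image[OF inj])
qed

text \<open>The substitution is \<open>y = x^d / (\<mu> x)\<close>, which makes
  \<open>1 - y = 1 / (\<mu> x)\<close>. The trinomial turns into a monomial in \<open>y\<close> and
  \<open>1 - y\<close>, the shape from which Jacobi sums arise.\<close>

lemma card_trinomial_roots:
  fixes \<mu> :: "'a::field"
  assumes d: "d \<ge> 2" and \<mu>: "\<mu> \<noteq> 0"
  shows "card {x. x ^ d + 1 = \<mu> * x} = card {y. \<mu> ^ d * (y * (1 - y) ^ (d - 1)) = 1}"
proof (rule bij_betw_same_card, rule bij_betwI[where g="\<lambda>y. 1 / (\<mu> * (1 - y))"
  and f="\<lambda>x. 1 - 1 / (\<mu> * x)"])
  obtain e where e: "d = Suc e" "e \<ge> 1" using d by (cases d) auto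
  have 1: "x \<noteq> 0" if "x ^ d + 1 = \<mu> * x" for x using that e by auto
  have 2: "1 - y \<noteq> 0" if "\<mu> ^ d * (y * (1 - y) ^ (d - 1)) = 1" for y
  proof
    assume "1 - y = 0"
    then have "(1 - y) ^ (d - 1) = 0" using e by (simp add: power_0_left)
    then have "\<mu> ^ d * (y * (1 - y) ^ (d - 1)) = 0" by (simp only: mult_zero_right)
    then show False unfolding that by simp
  qed
  show "(\<lambda>x. 1 - 1 / (\<mu> * x)) \<in> {x. x ^ d + 1 = \<mu> * x} \<rightarrow> {y. \<mu> ^ d * (y * (1 - y) ^ (d - 1)) = 1}"
  proof
    fix x assume "x \<in> {x. x ^ d + 1 = \<mu> * x}"
    then have x: "x ^ d + 1 = \<mu> * x" by simp
    define m where "m = \<mu> * x"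
    have m: "m \<noteq> 0" using 1[OF x] \<mu> by (simp add: m_def)
    have xd: "x ^ d = m - 1" using x by (simp add: m_def algebra_simps)
    have "\<mu> ^ d * ((1 - 1 / m) * (1 / m) ^ e) = \<mu> ^ d * (x ^ d / m) * (1 / m) ^ e"
      unfolding xd using m by (simp add: diff_divide_distrib)
    also have "\<dots> = m ^ d * ((1 / m) * (1 / m) ^ e)"
      by (simp add: m_def power_mult_distrib)
    also have "\<dots> = 1" using m by (simp add: e power_one_over)
    finally show "1 - 1 / (\<mu> * x) \<in> {y. \<mu> ^ d * (y * (1 - y) ^ (d - 1)) = 1}"
      by (simp add: m_def e)
  qed
  show "(\<lambda>y. 1 / (\<mu> * (1 - y))) \<in> {y. \<mu> ^ d * (y * (1 - y) ^ (d - 1)) = 1} \<rightarrow> {x. x ^ d + 1 = \<mu> * x}"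
  proof
    fix y assume "y \<in> {y. \<mu> ^ d * (y * (1 - y) ^ (d - 1)) = 1}"
    then have y: "\<mu> ^ d * (y * (1 - y) ^ (d - 1)) = 1" by simp
    define z where "z = 1 - y"
    have z: "z \<noteq> 0" using 2[OF y] by (simp add: z_def)
    have "\<mu> ^ d * z ^ d * (y / z) = \<mu> ^ d * (y * z ^ e)" using z by (simp add: e)
    also have "\<dots> = 1" using y by (simp add: z_def e)
    finally have "(1 / (\<mu> * z)) ^ d = y / z"
      using z \<mu> by (simp add: power_divide power_mult_distrib field_simps)
    moreover have "y / z + 1 = 1 / z" using z by (simp add: z_def divide_simps)
    moreover have "\<mu> * (1 / (\<mu> * z)) = 1 / z" using \<mu> by simp
    ultimately show "1 / (\<mu> * (1 - y)) \<in> {x. x ^ d + 1 = \<mu> * x}"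
      unfolding z_def[symmetric] by simp
  qed
  show "1 / (\<mu> * (1 - (1 - 1 / (\<mu> * x)))) = x" if "x \<in> {x. x ^ d + 1 = \<mu> * x}" for x
    using 1[of x] that \<mu> by simp
  show "1 - 1 / (\<mu> * (1 / (\<mu> * (1 - y)))) = y" if "y \<in> {y. \<mu> ^ d * (y * (1 - y) ^ (d - 1)) = 1}" for y
    using 2[of y] that \<mu> by simp
qed

lemma num_points_Z_jacobi:
  fixes l :: "'p::prime_card mod_ring"
  assumes d: "d \<ge> 2" and l: "of_nat d * l \<noteq> 0"
  shows "of_nat (CARD('p) - 1) * of_nat (num_points_Z d l) =
    (\<Sum>j<CARD('p) - 1. teichmuller_bar_pow (d * j) (of_nat d * l) * jacobi_sum TYPE('p) j ((d - 1) * j))"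
proof -
  let ?q = "CARD('p) - 1" and ?\<mu> = "of_nat d * l"
  let ?g = "\<lambda>y :: 'p mod_ring. ?\<mu> ^ d * (y * (1 - y) ^ (d - 1))"
  have "num_points_Z d l = card {y. ?g y = 1}"
    using num_points_Z_affine[OF d, of l] card_trinomial_roots[OF d l] by simp
  then have "of_nat ?q * (of_nat (num_points_Z d l) :: 'p padic) = (\<Sum>y\<in>{y. ?g y = 1}. of_nat ?q)"
    by (simp only: sum_constant mult.commute)
  also have "\<dots> = (\<Sum>y\<in>UNIV. if ?g y = 1 then of_nat ?q else 0)"
    by (simp only: sum.inter_filter[symmetric] finite UNIV_I simp_thms)
  also have "\<dots> = (\<Sum>y\<in>UNIV. \<Sum>j<?q. teichmuller_bar_pow j (?g y))"
    by (simp only: sum_teichmuller_bar_pow_exponents)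
  also have "\<dots> = (\<Sum>j<?q. \<Sum>y\<in>UNIV. teichmuller_bar_pow j (?g y))" by (rule sum.swap)
  also have "\<dots> = (\<Sum>j<?q. \<Sum>y\<in>UNIV. teichmuller_bar_pow (d * j) ?\<mu> *
    (teichmuller_bar_pow j y * teichmuller_bar_pow ((d - 1) * j) (1 - y)))"
    using d by (intro sum.cong refl) (simp add: teichmuller_bar_pow_mult teichmuller_bar_pow_power
      mult.commute)
  finally show ?thesis by (simp only: jacobi_sum_def sum_distrib_left)
qed

section \<open>The quadratic character\<close>

text \<open>Euler's criterion gives the value modulo \<open>p\<close>, and both 1 and -1 are their
  own Teichmueller representatives and their own inverses.\<close>

lemma quadratic_char_teichmuller:
  fixes x :: "'p::prime_card mod_ring"
  assumes odd: "odd CARD('p)"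
  shows "of_int (quadratic_char x) = teichmuller_bar_pow ((CARD('p) - 1) div 2) x"
proof (cases "x = 0")
  case True
  have "to_int_mod_ring (0 :: 'p mod_ring) = 0" by transfer simp
  then show ?thesis using True by (simp add: quadratic_char_def Legendre_def cong_def)
next
  case False
  let ?h = "(CARD('p) - 1) div 2" let ?a = "to_int_mod_ring x"
  have ax: "of_int ?a = x" by (simp add: of_int_of_int_mod_ring)
  have "\<not> [?a = 0] (mod int CARD('p))"
  proof
    assume "[?a = 0] (mod int CARD('p))"
    then have "of_int (?a mod int CARD('p)) = (0 :: 'p mod_ring)" by (simp only: cong_def) simp
    then show False using False ax by simp
  qed
  then have pm: "quadratic_char x = 1 \<or> quadratic_char x = - 1"
    by (auto simp: quadratic_char_def Legendre_def)
  have "[Legendre ?a (int CARD('p)) = ?a ^ ((CARD('p) - 1) div 2)] (mod int CARD('p))"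
    using euler_criterion[of "CARD('p)" ?a] prime_card CARD_ge_3[OF odd] by simp
  then have "of_int (quadratic_char x mod int CARD('p)) =
    (of_int (?a ^ ?h mod int CARD('p)) :: 'p mod_ring)"
    by (simp only: quadratic_char_def cong_def)
  then have xh: "of_int (quadratic_char x) = x ^ ?h" by (simp add: ax)
  have "teichmuller (x ^ ?h) = of_int (quadratic_char x)"
    using pm
  proof
    assume "quadratic_char x = 1"
    then show ?thesis unfolding xh[symmetric] by simp
  next
    assume "quadratic_char x = - 1"
    then show ?thesis unfolding xh[symmetric] using teichmuller_uminus[OF _ odd, of 1] by simp
  qed
  then have "to_fract (teichmuller x) ^ ?h = of_int (quadratic_char x)"
    unfolding teichmuller_pow[OF False] by (metis to_fract_power to_fract_of_int)
  then have "teichmuller_bar_pow ?h x = inverse (of_int (quadratic_char x))"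
    using False by (simp add: teichmuller_bar_pow_altdef power_inverse)
  then show ?thesis using pm by auto
qed

lemma sum_quadratic_char_jacobi:
  assumes odd: "odd CARD('p::prime_card)"
  defines "h \<equiv> (CARD('p) - 1) div 2"
  shows "(\<Sum>t\<in>UNIV. of_int (quadratic_char (t * (t - 1) :: 'p mod_ring)) * teichmuller_bar_pow j t) =
    (- 1) ^ h * jacobi_sum TYPE('p) (j + h) h"
  unfolding jacobi_sum_def sum_distrib_left
proof (rule sum.cong[OF refl])
  fix t :: "'p mod_ring"
  have "t - 1 = - (1 - t)" by simp
  then have "teichmuller_bar_pow h (t - 1) = (- 1) ^ h * teichmuller_bar_pow h (1 - t)"
    by (simp only: teichmuller_bar_pow_uminus[OF odd])
  then show "of_int (quadratic_char (t * (t - 1))) * teichmuller_bar_pow j t =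
    (- 1) ^ h * (teichmuller_bar_pow (j + h) t * teichmuller_bar_pow h (1 - t))"
    by (simp only: quadratic_char_teichmuller[OF odd] h_def[symmetric] teichmuller_bar_pow_mult
      teichmuller_bar_pow_add mult_ac)
qed

section \<open>Gamma quotients with rational arguments\<close>

lemma padic_Gamma_rat_nonzero:
  assumes "odd CARD('p::prime_card)"
  shows "padic_Gamma_rat r \<noteq> (0 :: 'p padic)"
proof -
  have "padic_Gamma (padic_int_of_rat r) \<noteq> (0 :: 'p padic_int)"
    using padic_Gamma_unit[OF assms, of "padic_int_of_rat r"] by auto
  then show ?thesis by (simp add: padic_Gamma_rat_def flip: to_fract_def)
qed

lemma padic_Gamma_rat_multiplication:
  assumes odd: "odd CARD('p::prime_card)" and m: "\<not> CARD('p) dvd m" and r: "r < CARD('p) - 1"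
  shows "(\<Prod>i<m. padic_Gamma_rat ((of_nat r / of_nat (CARD('p) - 1) + of_nat i) / of_nat m)) =
    (\<Prod>i<m. padic_Gamma_rat (of_nat i / of_nat m)) * gamma_frac r *
      to_fract (teichmuller (of_nat m :: 'p mod_ring)) ^ r"
proof -
  let ?q = "CARD('p) - 1"
  have m0: "m \<noteq> 0" using m by (intro notI) simp
  obtain x :: "'p padic_int" where x: "of_nat ?q * x = of_nat r"
    "padic_int_of_rat (of_nat r / of_nat ?q) = x"
    using padic_int_of_rat_divide[OF not_dvd_CARD_minus_1] by blast
  obtain w :: "'p padic_int" where w: "of_nat m * w = of_nat 1"
    using padic_int_of_rat_divide[OF m] by blast
  have q0: "?q \<noteq> 0" using r by simp
  have tw: "to_fract w = 1 / of_nat m"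
  proof -
    have "of_nat m * to_fract w = 1" using arg_cong[OF w, of to_fract] by (simp add: to_fract_of_nat)
    then show ?thesis using m0 by (simp add: field_simps)
  qed
  have tx: "to_fract x = of_nat r / of_nat ?q"
  proof -
    have "of_nat ?q * to_fract x = of_nat r" using arg_cong[OF x(1), of to_fract]
      by (simp only: to_fract_mult to_fract_of_nat)
    moreover have nz: "of_nat ?q \<noteq> (0 :: 'p padic)" unfolding of_nat_eq_0_iff by (rule q0)
    ultimately show ?thesis by (simp only: nonzero_eq_divide_eq[OF nz] mult.commute)
  qed
  have 1: "padic_Gamma_rat (of_nat i / of_nat m) = to_fract (padic_Gamma (of_nat i * w))" for i
  proof -
    have "padic_int_of_rat (of_nat i / of_nat m) = of_nat i * w"
      by (rule padic_int_of_rat_eqI) (simp add: tw to_fract_of_nat of_rat_divide)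
    then show ?thesis by (simp add: padic_Gamma_rat_def to_fract_def)
  qed
  have 2: "padic_Gamma_rat ((of_nat r / of_nat ?q + of_nat i) / of_nat m) =
    to_fract (padic_Gamma ((x + of_nat i) * w))" for i
  proof -
    have "to_fract ((x + of_nat i) * w) = of_rat ((of_nat r / of_nat ?q + of_nat i) / of_nat m)"
      by (simp only: to_fract_mult to_fract_add tw tx to_fract_of_nat of_rat_divide of_rat_add
        of_rat_of_nat_eq) simp
    then have "padic_int_of_rat ((of_nat r / of_nat ?q + of_nat i) / of_nat m) = (x + of_nat i) * w"
      by (rule padic_int_of_rat_eqI)
    then show ?thesis by (simp only: padic_Gamma_rat_def to_fract_def)
  qed
  have 3: "gamma_frac r = to_fract (padic_Gamma x)"
    by (simp only: gamma_frac_def padic_Gamma_rat_def x(2) to_fract_def)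
  show ?thesis
    unfolding 1 2 3
    using padic_Gamma_multiplication[OF odd w[unfolded of_nat_1] m x(1) r]
    by (simp only: to_fract_prod[symmetric] to_fract_mult[symmetric] to_fract_power[symmetric])
qed

text \<open>One gamma quotient of the series together with its power of \<open>- p\<close>. An upper
  parameter \<open>a\<close> has \<open>c = \<langle>a\<rangle>\<close> and
  \<open>v = - j / (p - 1)\<close>, a lower parameter \<open>b\<close> has
  \<open>c = \<langle>-b\<rangle>\<close> and \<open>v = j / (p - 1)\<close>.\<close>

definition gamma_ratio :: "rat \<Rightarrow> rat \<Rightarrow> 'p::prime_card padic" where
  "gamma_ratio v c = (- of_nat CARD('p)) powi (- \<lfloor>c + v\<rfloor>) *
    (padic_Gamma_rat (frac (c + v)) / padic_Gamma_rat c)"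

lemma prod_power_int:
  fixes x :: "'a::field"
  assumes "x \<noteq> 0"
  shows "(\<Prod>i\<in>A. x powi f i) = x powi (\<Sum>i\<in>A. f i)"
  by (induction A rule: infinite_finite_induct) (simp_all add: assms power_int_add)

text \<open>Translation by \<open>k\<close> permutes the remainders modulo \<open>D\<close>. Summing
  the division identities over all \<open>h\<close> then shows that the quotients add up to
  \<open>k\<close>.\<close>

lemma cyclic_shift:
  fixes k :: int
  assumes "D > 0"
  defines "\<sigma> \<equiv> (\<lambda>h. nat ((int h + k) mod int D))"
  shows "bij_betw \<sigma> {..<D} {..<D}" and "(\<Sum>h<D. (int h + k) div int D) = k"
proof -
  have \<sigma>: "int (\<sigma> h) = (int h + k) mod int D" for h using assms by simp
  have ran: "\<sigma> ` {..<D} \<subseteq> {..<D}"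
  proof
    fix y assume "y \<in> \<sigma> ` {..<D}"
    then obtain h where "y = \<sigma> h" by blast
    then have "int y < int D" using assms(1) \<sigma>[of h] by simp
    then show "y \<in> {..<D}" by simp
  qed
  have "inj_on \<sigma> {..<D}"
  proof (rule inj_onI)
    fix h h' assume h: "h \<in> {..<D}" "h' \<in> {..<D}" "\<sigma> h = \<sigma> h'"
    then have "(int h + k) mod int D = (int h' + k) mod int D" using \<sigma> by metis
    then have "[int h + k = int h' + k] (mod int D)" by (simp only: cong_def)
    then have "[int h = int h'] (mod int D)" by (simp only: cong_add_rcancel)
    then have "int h = int h'" using h by (simp add: cong_def)
    then show "h = h'" by simp
  qed
  then show bij: "bij_betw \<sigma> {..<D} {..<D}"
    using ran endo_inj_surj[of "{..<D}" \<sigma>] by (auto simp: bij_betw_def)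
  have "(\<Sum>h<D. int h + k) = (\<Sum>h<D. int D * ((int h + k) div int D) + int (\<sigma> h))"
    unfolding \<sigma> by simp
  also have "\<dots> = int D * (\<Sum>h<D. (int h + k) div int D) + (\<Sum>h<D. int h)"
    using sum.reindex_bij_betw[OF bij, of int] by (simp only: sum.distrib sum_distrib_left)
  finally have "int D * k = int D * (\<Sum>h<D. (int h + k) div int D)" by (simp add: sum.distrib)
  then show "(\<Sum>h<D. (int h + k) div int D) = k" using assms(1) by simp
qed

lemma floor_of_int_add:
  fixes y :: rat
  shows "0 \<le> y \<Longrightarrow> y < 1 \<Longrightarrow> \<lfloor>of_int n + y\<rfloor> = n"
  by (rule floor_unique) simp_all

lemma eq_of_nat_mult_eq:
  fixes x z :: rat
  assumes "of_nat D * x = of_int (int D * a + b) + z" "D > 0"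
  shows "x = of_int a + (z + of_int b) / of_nat D"
  using assms by (simp add: field_simps)

text \<open>With \<open>q = p - 1\<close>, write \<open>D s / q = k + r / q\<close>, so that
  \<open>h / D + s / q\<close> is \<open>(h + k + r / q) / D\<close>. By the cyclic shift the floors
  sum to \<open>k\<close>, and the fractional parts are the numbers \<open>(r / q + i) / D\<close>,
  to which the multiplication formula applies.\<close>

lemma gamma_ratio_prod:
  fixes s :: int
  assumes odd: "odd CARD('p::prime_card)" and D: "\<not> CARD('p) dvd D"
  defines "k \<equiv> (int D * s) div int (CARD('p) - 1)" and "r \<equiv> nat ((int D * s) mod int (CARD('p) - 1))"
  shows "(\<Prod>h<D. gamma_ratio (of_int s / of_nat (CARD('p) - 1)) (of_nat h / of_nat D)) =
    (- of_nat CARD('p)) powi (- k) * gamma_frac r * to_fract (teichmuller (of_nat D :: 'p mod_ring)) ^ r"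
proof -
  let ?q = "CARD('p) - 1" and ?P = "- of_nat CARD('p) :: 'p padic"
  let ?v = "of_int s / of_nat ?q :: rat"
  let ?\<sigma> = "\<lambda>h. nat ((int h + k) mod int D)"
  have D0: "D > 0" using D by (cases D) auto
  have q: "?q > 0" using CARD_prime_gt_1[where 'p='p] by simp
  have r: "int r = (int D * s) mod int ?q" unfolding r_def using q by simp
  have rq: "r < ?q"
  proof -
    have "int r < int ?q" unfolding r using q by (intro pos_mod_bound) simp
    then show ?thesis by (simp only: of_nat_less_iff)
  qed
  have Dv: "of_nat D * ?v = of_int k + of_nat r / of_nat ?q"
  proof -
    have "int D * s = int ?q * k + int r" unfolding r k_def by simp
    then have "of_int (int D * s) = (of_int (int ?q * k + int r) :: rat)" by (simp only:)
    then have "of_nat D * of_int s = (of_nat ?q * of_int k + of_nat r :: rat)"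
      by (simp only: of_int_mult of_int_add of_int_of_nat_eq)
    moreover have nz: "of_nat ?q \<noteq> (0 :: rat)" unfolding of_nat_eq_0_iff using q by simp
    ultimately show ?thesis by (simp only: times_divide_eq_right add_divide_distrib
      nonzero_mult_div_cancel_left[OF nz])
  qed
  have val: "\<lfloor>of_nat h / of_nat D + ?v\<rfloor> = (int h + k) div int D \<and>
      frac (of_nat h / of_nat D + ?v) = (of_nat r / of_nat ?q + of_nat (?\<sigma> h)) / of_nat D" for h
  proof -
    define t where "t = int h + k"
    have s: "of_nat (?\<sigma> h) = (of_int (t mod int D) :: rat)"
      using D0 by (simp add: t_def)
    have "of_nat D * (of_nat h / of_nat D + ?v) = of_nat h + of_nat D * ?v" using D0
      by (simp add: distrib_left)
    also have "\<dots> = of_int (int D * (t div int D) + t mod int D) + of_nat r / of_nat ?q"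
      unfolding Dv by (simp add: t_def)
    finally have e: "of_nat h / of_nat D + ?v =
      of_int (t div int D) + (of_nat r / of_nat ?q + of_nat (?\<sigma> h)) / of_nat D"
      unfolding s using D0 by (rule eq_of_nat_mult_eq)
    have x: "0 \<le> (of_nat r / of_nat ?q :: rat)" "(of_nat r / of_nat ?q :: rat) < 1"
      using rq q by (simp_all only: divide_less_eq_1 of_nat_0_le_iff divide_nonneg_nonneg of_nat_less_iff
        of_nat_0_less_iff) simp_all
    have "?\<sigma> h < D" using D0 by (simp add: nat_less_iff)
    then have le: "of_nat (?\<sigma> h) + 1 \<le> (of_nat D :: rat)"
      by (metis Suc_leI of_nat_Suc of_nat_le_iff add.commute)
    have "of_nat r / of_nat ?q + of_nat (?\<sigma> h) < 1 + (of_nat (?\<sigma> h) :: rat)"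
      by (rule add_strict_right_mono) (rule x(2))
    also have "\<dots> = of_nat (?\<sigma> h) + 1" by (rule add.commute)
    also note le
    finally have "of_nat r / of_nat ?q + of_nat (?\<sigma> h) < (of_nat D :: rat)" .
    then have y: "0 \<le> (of_nat r / of_nat ?q + of_nat (?\<sigma> h)) / (of_nat D :: rat)"
      "(of_nat r / of_nat ?q + of_nat (?\<sigma> h)) / (of_nat D :: rat) < 1"
      using x(1) D0 by simp_all
    have fl: "\<lfloor>of_nat h / of_nat D + ?v\<rfloor> = t div int D"
      unfolding e by (rule floor_of_int_add) (rule y)+
    show ?thesis unfolding frac_def fl unfolding e t_def by simp
  qed
  have "(\<Prod>h<D. gamma_ratio ?v (of_nat h / of_nat D) :: 'p padic) =
    (\<Prod>h<D. ?P powi (- ((int h + k) div int D))) *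
      ((\<Prod>h<D. padic_Gamma_rat ((of_nat r / of_nat ?q + of_nat (?\<sigma> h)) / of_nat D)) /
      (\<Prod>h<D. padic_Gamma_rat (of_nat h / of_nat D)))"
    unfolding prod_dividef[symmetric] prod.distrib[symmetric] gamma_ratio_def
    by (intro prod.cong refl) (simp only: val)
  also have "(\<Prod>h<D. ?P powi (- ((int h + k) div int D))) = ?P powi (- k)"
    by (subst prod_power_int) (simp_all only: sum_negf cyclic_shift(2)[OF D0], simp)
  also have "(\<Prod>h<D. padic_Gamma_rat ((of_nat r / of_nat ?q + of_nat (?\<sigma> h)) / of_nat D) :: 'p padic) =
      (\<Prod>i<D. padic_Gamma_rat ((of_nat r / of_nat ?q + of_nat i) / of_nat D))"
    by (rule prod.reindex_bij_betw[OF cyclic_shift(1)[OF D0]])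
  also have "\<dots> = (\<Prod>i<D. padic_Gamma_rat (of_nat i / of_nat D)) * gamma_frac r *
    to_fract (teichmuller (of_nat D :: 'p mod_ring)) ^ r"
    by (rule padic_Gamma_rat_multiplication[OF odd D rq])
  also have "\<dots> / (\<Prod>h<D. padic_Gamma_rat (of_nat h / of_nat D)) =
    gamma_frac r * to_fract (teichmuller (of_nat D :: 'p mod_ring)) ^ r"
    by (simp add: padic_Gamma_rat_nonzero[OF odd])
  finally show ?thesis by (simp only: mult.assoc)
qed

lemma gamma_ratio_nonzero:
  "odd CARD('p::prime_card) \<Longrightarrow> gamma_ratio v c \<noteq> (0 :: 'p padic)"
  by (simp add: gamma_ratio_def padic_Gamma_rat_nonzero)

lemma gamma_ratio_0:
  fixes s :: int
  assumes odd: "odd CARD('p::prime_card)"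
  shows "gamma_ratio (of_int s / of_nat (CARD('p) - 1)) 0 =
    ((- of_nat CARD('p)) powi (- (s div int (CARD('p) - 1))) *
      gamma_frac (nat (s mod int (CARD('p) - 1))) :: 'p padic)"
proof -
  have "\<not> CARD('p) dvd 1" using CARD_prime_gt_1[where 'p='p] by simp
  from gamma_ratio_prod[OF odd this, of s] show ?thesis by simp
qed

text \<open>The factor of the parameter \<open>1 / 2\<close>, which is left out of the lower
  parameters and has to be divided out of the complete product.\<close>

lemma gamma_ratio_half:
  assumes odd: "odd CARD('p::prime_card)"
  defines "h \<equiv> (CARD('p) - 1) div 2"
  shows "gamma_ratio (of_nat j / of_nat (CARD('p) - 1)) (1 / 2) =
    ((- of_nat CARD('p)) powi (- int ((j + h) div (CARD('p) - 1))) *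
      (gamma_frac ((j + h) mod (CARD('p) - 1)) / gamma_frac h) :: 'p padic)"
proof -
  let ?q = "CARD('p) - 1"
  have q: "?q > 0" using CARD_prime_gt_1[where 'p='p] by simp
  have q2: "?q = 2 * h" using even_CARD_minus_1[OF odd] unfolding h_def by simp
  have half: "(1 / 2 :: rat) = of_nat h / of_nat ?q" using q unfolding q2 by simp
  have e: "(1 / 2 :: rat) + of_nat j / of_nat ?q =
    of_int (int ((j + h) div ?q)) + of_nat ((j + h) mod ?q) / of_nat ?q"
  proof -
    have "(1 / 2 :: rat) + of_nat j / of_nat ?q = of_nat (j + h) / of_nat ?q"
      unfolding half by (simp only: of_nat_add add_divide_distrib add.commute)
    also have "\<dots> = of_nat (?q * ((j + h) div ?q) + (j + h) mod ?q) / of_nat ?q" by simp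
    also have "\<dots> = of_int (int ((j + h) div ?q)) + of_nat ((j + h) mod ?q) / of_nat ?q"
    proof -
      have nz: "of_nat ?q \<noteq> (0 :: rat)" unfolding of_nat_eq_0_iff using q by simp
      show ?thesis by (simp only: of_nat_add of_nat_mult add_divide_distrib
        nonzero_mult_div_cancel_left[OF nz] of_int_of_nat_eq)
    qed
    finally show ?thesis .
  qed
  have "(of_nat ((j + h) mod ?q) :: rat) < of_nat ?q" unfolding of_nat_less_iff using q by simp
  then have y: "0 \<le> (of_nat ((j + h) mod ?q) / of_nat ?q :: rat)"
    "(of_nat ((j + h) mod ?q) / of_nat ?q :: rat) < 1"
    using q by (simp_all only: divide_less_eq_1 of_nat_0_le_iff divide_nonneg_nonneg of_nat_0_less_iff)
      simp_all
  have fl: "\<lfloor>(1 / 2 :: rat) + of_nat j / of_nat ?q\<rfloor> = int ((j + h) div ?q)"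
    unfolding e by (rule floor_of_int_add) (rule y)+
  have fr: "frac ((1 / 2 :: rat) + of_nat j / of_nat ?q) = of_nat ((j + h) mod ?q) / of_nat ?q"
    unfolding frac_def fl unfolding e by simp
  show ?thesis unfolding gamma_ratio_def fl fr unfolding half gamma_frac_def ..
qed

section \<open>The hypergeometric series\<close>

lemma frac_frac_add: "frac (frac x + y) = frac (x + y)"
proof -
  have e: "frac x + y = x + y + of_int (- \<lfloor>x\<rfloor>)" by (simp add: frac_def)
  have "frac (z + of_int n) = frac z" for z :: 'a and n by (simp add: frac_def)
  then show ?thesis unfolding e .
qed

lemma padic_G_gamma_ratio:
  fixes t :: "'p::prime_card mod_ring"
  assumes odd: "odd CARD('p)" and len: "length bs = length as" and as: "\<And>a. a \<in> set as \<Longrightarrow> 0 \<le> a \<and> a < 1"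
  shows "padic_G as bs t = - 1 / (of_nat CARD('p) - 1) *
    (\<Sum>j<CARD('p) - 1. (- 1) ^ (j * length as) * teichmuller_bar_pow j t *
      (prod_list (map (gamma_ratio (of_int (- int j) / of_nat (CARD('p) - 1))) as) *
       prod_list (map (\<lambda>b. gamma_ratio (of_int (int j) / of_nat (CARD('p) - 1)) (frac (- b))) bs)))"
proof -
  have set: "{0..CARD('p) - 2} = {..<CARD('p) - 1}" using CARD_ge_3[OF odd] by auto
  show ?thesis
    unfolding padic_G_def set
  proof (intro arg_cong2[where f="(*)"] sum.cong refl)
    fix j
    let ?q = "CARD('p) - 1" let ?u = "of_nat j / of_nat ?q :: rat" and ?P =
      "- of_nat CARD('p) :: 'p padic"
    have "prod_list (map (gamma_ratio (of_int (- int j) / of_nat ?q)) as) =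
      (\<Prod>i<length as. gamma_ratio (- ?u) (as ! i) :: 'p padic)"
      by (simp add: prod.list_conv_set_nth atLeast0LessThan)
    moreover have "prod_list (map (\<lambda>b. gamma_ratio (of_int (int j) / of_nat ?q) (frac (- b))) bs) =
      (\<Prod>i<length as. gamma_ratio ?u (frac (- (bs ! i))) :: 'p padic)"
      by (simp add: prod.list_conv_set_nth atLeast0LessThan len)
    moreover have "(let a = as ! i; b = bs ! i; u = ?u in ?P powi (- \<lfloor>frac a - u\<rfloor> - \<lfloor>frac (- b) + u\<rfloor>) *
        (padic_Gamma_rat (frac (a - u)) / padic_Gamma_rat (frac a)) *
          (padic_Gamma_rat (frac (- b + u)) / padic_Gamma_rat (frac (- b)))) =
        gamma_ratio (- ?u) (as ! i) * gamma_ratio ?u (frac (- (bs ! i)))" if "i < length as" for i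
    proof -
      have fr: "frac (as ! i) = as ! i" using as[of "as ! i"] that by (simp add: frac_eq)
      have pw: "?P powi (m - n) = ?P powi m * ?P powi (- n)" for m n
        using power_int_add[of ?P m "- n"] by simp
      show ?thesis
        unfolding Let_def pw gamma_ratio_def frac_frac_add fr
          by (simp only: diff_conv_add_uminus mult_ac)
    qed
    ultimately show "(\<Prod>i<length as. let a = as ! i; b = bs ! i; u =
      ?u in ?P powi (- \<lfloor>frac a - u\<rfloor> - \<lfloor>frac (- b) + u\<rfloor>) *
        (padic_Gamma_rat (frac (a - u)) / padic_Gamma_rat (frac a)) *
          (padic_Gamma_rat (frac (- b + u)) / padic_Gamma_rat (frac (- b)))) =
      prod_list (map (gamma_ratio (of_int (- int j) / of_nat ?q)) as) *
      prod_list (map (\<lambda>b. gamma_ratio (of_int (int j) / of_nat ?q) (frac (- b))) bs)"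
      by (simp only: prod.distrib[symmetric]) (intro prod.cong refl, simp)
  qed
qed

section \<open>Completing the lists of parameters to full systems h / D\<close>

lemma prod_list_upper:
  fixes f :: "rat \<Rightarrow> 'a::field"
  assumes "d > 0"
  shows "f 0 * prod_list (map f (map (\<lambda>h. of_nat h / of_nat d) [1..<d])) =
    (\<Prod>h<d. f (of_nat h / of_nat d))"
proof -
  have "prod_list (map f (map (\<lambda>h. of_nat h / of_nat d) [1..<d])) =
    (\<Prod>h\<in>{1..<d}. f (of_nat h / of_nat d))"
    using prod.distinct_set_conv_list[of "[1..<d]" "\<lambda>h. f (of_nat h / of_nat d)"] by (simp add: comp_def)
  moreover have "(\<Prod>h<d. f (of_nat h / of_nat d)) =
    f (of_nat 0 / of_nat d) * (\<Prod>h\<in>{..<d} - {0}. f (of_nat h / of_nat d))"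
    using assms by (intro prod.remove) auto
  moreover have "{..<d} - {0} = {1..<d}" by auto
  ultimately show ?thesis by simp
qed

text \<open>The involution taking \<open>h\<close> to \<open>2 n - h\<close> undoes the sign in
  \<open>frac (- b)\<close>. Compared with all \<open>h / (2 n)\<close> the list lacks
  \<open>1 / 2\<close> and has one 0 too many, hence the two correcting factors.\<close>

lemma prod_list_lower:
  fixes f :: "rat \<Rightarrow> 'a::field"
  assumes n: "n > 0"
  shows "f (1 / 2) * prod_list (map (\<lambda>b. f (frac (- b)))
      (map (\<lambda>h. of_nat h / of_nat (2 * n)) (filter (\<lambda>h. h \<noteq> n) [1..<2 * n]) @ [0, 0])) =
    f 0 * (\<Prod>h<2 * n. f (of_nat h / of_nat (2 * n)))"
proof -
  let ?D = "2 * n" let ?I = "{1..<?D} - {n}"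
  have set: "set (filter (\<lambda>h. h \<noteq> n) [1..<?D]) = ?I" by auto
  have fr: "frac (- (of_nat h / of_nat ?D :: rat)) = of_nat (?D - h) / of_nat ?D" if "h \<in> ?I" for h
  proof -
    have h: "h < ?D" "1 \<le> h" using that by simp_all
    have "- (of_nat h / of_nat ?D :: rat) = of_int (- 1) + of_nat (?D - h) / of_nat ?D"
      using h n by (simp add: field_simps of_nat_diff)
    moreover have "0 \<le> (of_nat (?D - h) / of_nat ?D :: rat)" "(of_nat (?D - h) / of_nat ?D :: rat) < 1"
      using h by (simp_all add: divide_less_eq_1)
    ultimately show ?thesis by (simp only: frac_def floor_of_int_add)
  qed
  have "prod_list (map (\<lambda>b. f (frac (- b))) (map (\<lambda>h. of_nat h /
    of_nat ?D) (filter (\<lambda>h. h \<noteq> n) [1..<?D]))) =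
    (\<Prod>h\<in>?I. f (frac (- (of_nat h / of_nat ?D))))"
    using prod.distinct_set_conv_list[of "filter (\<lambda>h. h \<noteq> n) [1..<?D]"
      "\<lambda>h. f (frac (- (of_nat h / of_nat ?D)))"]
    unfolding set by (simp add: comp_def)
  also have "\<dots> = (\<Prod>h\<in>?I. f (of_nat (?D - h) / of_nat ?D))"
    by (intro prod.cong refl) (simp only: fr)
  also have "\<dots> = (\<Prod>h\<in>?I. f (of_nat h / of_nat ?D))"
    by (rule prod.reindex_bij_witness[of _ "\<lambda>h. ?D - h" "\<lambda>h. ?D - h"]) auto
  finally have A: "prod_list (map (\<lambda>b. f (frac (- b))) (map (\<lambda>h. of_nat h /
    of_nat ?D) (filter (\<lambda>h. h \<noteq> n) [1..<?D]))) =
    (\<Prod>h\<in>?I. f (of_nat h / of_nat ?D))" .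
  have "(\<Prod>h<?D. f (of_nat h / of_nat ?D)) = f (of_nat 0 / of_nat ?D) *
    (\<Prod>h\<in>{..<?D} - {0}. f (of_nat h / of_nat ?D))"
    using n by (intro prod.remove) auto
  also have "(\<Prod>h\<in>{..<?D} - {0}. f (of_nat h / of_nat ?D)) =
    f (of_nat n / of_nat ?D) * (\<Prod>h\<in>({..<?D} - {0}) - {n}. f (of_nat h / of_nat ?D))"
    using n by (intro prod.remove) auto
  also have "({..<?D} - {0}) - {n} = ?I" by auto
  also have "of_nat n / of_nat ?D = (1 / 2 :: rat)" using n by simp
  finally have B: "(\<Prod>h<?D. f (of_nat h / of_nat ?D)) =
    f 0 * (f (1 / 2) * (\<Prod>h\<in>?I. f (of_nat h / of_nat ?D)))" by simp
  show ?thesis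
    unfolding map_append prod_list.append A B by (simp add: mult_ac)
qed

section \<open>Comparison of the terms with the same index j\<close>

context
  assumes odd: "odd CARD('p::prime_card)"
begin

text \<open>The Jacobi sum from the sum over \<open>t\<close> and the missing parameter
  \<open>1 / 2\<close> nearly cancel. With \<open>a = (j + h) mod q\<close> the Jacobi sum is
  expressed through gamma at \<open>a\<close>, \<open>h\<close> and \<open>j\<close>, and reflection
  gives gamma at \<open>h\<close> up to sign. Adding \<open>h\<close> twice to \<open>j\<close>
  wraps around exactly once, which leaves a single factor \<open>- p\<close>.\<close>

lemma jacobi_half_term:
  fixes j :: nat
  defines "q \<equiv> CARD('p) - 1" and "h \<equiv> (CARD('p) - 1) div 2"
  assumes j: "0 < j" "j < q"
  shows "(- 1) ^ h * jacobi_sum TYPE('p) (j + h) h * (gamma_frac j /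
    ((- of_nat CARD('p)) powi (- int ((j + h) div q)) * (gamma_frac ((j + h) mod q) / gamma_frac h))) =
      - of_nat CARD('p)"
proof -
  let ?P = "- of_nat CARD('p) :: 'p padic" and ?J = "jacobi_sum TYPE('p) (j + h) h"
  define a where "a = (j + h) mod q"
  have q2: "q = 2 * h" using even_CARD_minus_1[OF odd] unfolding h_def q_def by simp
  have h: "0 < h" "h < q" using j q2 by simp_all
  have a: "a < q" unfolding a_def using j by simp
  have ah: "(a + h) mod q = j \<and> (a + h) div q + (j + h) div q = 1"
  proof (cases "j < h")
    case True
    then have e: "a = j + h" "(j + h) div q = 0" unfolding a_def using q2 by simp_all
    then have "a + h = j + q" using q2 by simp
    then have "(a + h) mod q = j" "(a + h) div q = 1" using j by simp_all
    then show ?thesis using e(2) by simp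
  next
    case False
    then have "j + h = (j - h) + q" using q2 by simp
    then have e: "a = j - h" "(j + h) div q = 1" unfolding a_def using j by simp_all
    then have "a + h = j" using False by simp
    then have "(a + h) mod q = j" "(a + h) div q = 0" using j by simp_all
    then show ?thesis using e(2) by simp
  qed
  have "?J = jacobi_sum TYPE('p) a h"
    using jacobi_sum_mod[of "j + h" h, where 'p='p] h unfolding a_def q_def[symmetric] by simp
  then have F1: "?J * gamma_frac j = - (?P ^ ((a + h) div q) * gamma_frac a * gamma_frac h)"
    using jacobi_sum_gamma[OF odd a[unfolded q_def] h(2)[unfolded q_def]] ah j unfolding q_def[symmetric]
      by simp
  have "CARD('p) - 1 - h = h" using q2 unfolding q_def by simp
  then have F2: "gamma_frac h * gamma_frac h = - ((- 1) ^ h :: 'p padic)"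
    using gamma_frac_reflect[OF odd h(1) h(2)[unfolded q_def]] by simp
  have P: "?P ^ ((a + h) div q) * ?P ^ ((j + h) div q) = ?P"
    using ah by (simp flip: power_add)
  have t: "(- 1) ^ h * (- 1) ^ h = (1 :: 'p padic)" by (simp flip: power_add)
  have nz: "gamma_frac a \<noteq> (0 :: 'p padic)" "gamma_frac h \<noteq> (0 :: 'p padic)"
    using gamma_frac_nonzero[OF odd] by auto
  have "(- 1) ^ h * ?J * (gamma_frac j / (?P powi (- int ((j + h) div q)) *
    (gamma_frac a / gamma_frac h))) =
    (- 1) ^ h * (?J * gamma_frac j) * gamma_frac h / gamma_frac a * ?P ^ ((j + h) div q)"
    using nz by (simp add: power_int_minus field_simps)
  also have "\<dots> = - ((- 1) ^ h * (gamma_frac h * gamma_frac h)) *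
    (?P ^ ((a + h) div q) * ?P ^ ((j + h) div q))"
    unfolding F1 using nz by (simp add: field_simps)
  also have "\<dots> = ?P" unfolding F2 P using t by simp
  finally show ?thesis unfolding a_def .
qed

text \<open>For \<open>m = d j mod q\<close> nonzero, reflection at \<open>m\<close> and at
  \<open>j\<close> brings the gamma quotient into the shape of the formula for Jacobi sums; the two
  signs agree because \<open>d\<close> is odd and \<open>q\<close> even. For \<open>m = 0\<close>
  that formula has an extra term, so the Jacobi sum is taken from \<open>jacobi_sum_reflect\<close>
  instead, where \<open>j\<close> is even and the value is -1.\<close>

lemma jacobi_term:
  fixes d j :: nat
  defines "q \<equiv> CARD('p) - 1"
  assumes d: "odd d" and j: "0 < j" "j < q"
  shows "(- of_nat CARD('p)) powi (- ((int d * - int j) div int q)) *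
    gamma_frac (nat ((int d * - int j) mod int q)) *
    ((- of_nat CARD('p)) powi (- ((int (d - 1) * int j) div int q)) *
      gamma_frac (nat ((int (d - 1) * int j) mod int q))) /
    gamma_frac (q - j) = (of_nat CARD('p) * jacobi_sum TYPE('p) j ((d - 1) * j) :: 'p padic)"
proof -
  let ?P = "- of_nat CARD('p) :: 'p padic" and ?J = "jacobi_sum TYPE('p) j ((d - 1) * j)"
  define r where "r = (d - 1) * j mod q"
  define k where "k = (d - 1) * j div q"
  define m where "m = d * j mod q"
  have qe: "even q" using even_CARD_minus_1[OF odd] by (simp add: q_def)
  have q0: "q > 0" using j by simp
  have P0: "?P \<noteq> 0" by simp
  have nz: "gamma_frac i \<noteq> (0 :: 'p padic)" for i by (rule gamma_frac_nonzero[OF odd])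
  have r2: "nat ((int (d - 1) * int j) mod int q) = r" "(int (d - 1) * int j) div int q = int k"
    unfolding r_def k_def by (simp_all only: of_nat_mult[symmetric] of_nat_mod[symmetric]
      of_nat_div[symmetric] nat_int)
  have r: "r < q" unfolding r_def using q0 by simp
  have dj: "d * j = (d - 1) * j + j" using d by (cases d) auto
  have jr: "(j + r) mod q = m" unfolding m_def r_def dj by (simp add: mod_simps add.commute)
  have jk: "d * j div q = k + (j + r) div q"
  proof -
    have "(d - 1) * j = k * q + r" unfolding k_def r_def by simp
    then have "d * j = k * q + (j + r)" using dj by simp
    then show ?thesis using q0 by (simp add: add.commute)
  qed
  have J: "?J = jacobi_sum TYPE('p) j r"
    using jacobi_sum_mod[of j "(d - 1) * j", where 'p='p] j(2) unfolding r_def q_def[symmetric] by simp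
  have g0: "gamma_frac j * gamma_frac (q - j) = - ((- 1) ^ j :: 'p padic)"
    using gamma_frac_reflect[OF odd j(1) j(2)[unfolded q_def]] unfolding q_def[symmetric] .
  show ?thesis
  proof (cases "m = 0")
    case False
    have neg: "int d * - int j = int (q - m) + int q * (- int (d * j div q) - 1)"
    proof -
      have "int (d * j) = int q * int (d * j div q) + int m" unfolding m_def
        by (simp flip: of_nat_mult of_nat_add)
      moreover have "int (q - m) = int q - int m" using q0 by (simp add: m_def of_nat_diff less_imp_le)
      ultimately show ?thesis by (simp add: algebra_simps)
    qed
    have qm: "0 \<le> int (q - m)" "int (q - m) < int q" using False q0 by simp_all
    have r1: "nat ((int d * - int j) mod int q) = q - m"
      "(int d * - int j) div int q = - int (d * j div q) - 1"
    proof -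
      have "(int d * - int j) mod int q = int (q - m)" unfolding neg mod_mult_self2
        by (rule mod_pos_pos_trivial[OF qm])
      then show "nat ((int d * - int j) mod int q) = q - m" by simp
      have iq: "int q \<noteq> 0" using q0 by simp
      show "(int d * - int j) div int q = - int (d * j div q) - 1"
        unfolding neg div_mult_self2[OF iq] div_pos_pos_trivial[OF qm] by simp
    qed
    have m: "0 < m" "m < q" using False q0 by (simp_all add: m_def)
    have sgn: "(- 1) ^ m = ((- 1) ^ j :: 'p padic)"
    proof -
      have "even m \<longleftrightarrow> even (d * j)" unfolding m_def using qe by (metis dvd_mod_iff)
      then show ?thesis using d by (cases "even j") auto
    qed
    have g1: "gamma_frac m * gamma_frac (q - m) = (gamma_frac j * gamma_frac (q - j) :: 'p padic)"
      using gamma_frac_reflect[OF odd m(1) m(2)[unfolded q_def]] g0 sgn unfolding q_def[symmetric]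
        by simp
    have JG: "jacobi_sum TYPE('p) j r * gamma_frac m =
      - (?P ^ ((j + r) div q) * gamma_frac j * gamma_frac r)"
      using jacobi_sum_gamma[OF odd j(2)[unfolded q_def] r[unfolded q_def]] False
        unfolding q_def[symmetric] jr by simp
    have pow: "?P powi (- (- int (d * j div q) - 1)) * ?P powi (- int k) = ?P ^ ((j + r) div q) * ?P"
    proof -
      have "?P powi (- (- int (d * j div q) - 1)) * ?P powi (- int k) = ?P powi int ((j + r) div q + 1)"
        unfolding jk by (subst power_int_add[symmetric]) (use P0 in simp_all)
      then show ?thesis by (simp only: power_int_of_nat power_add power_one_right)
    qed
    have "?P powi (- (- int (d * j div q) - 1)) * gamma_frac (q - m) *
      (?P powi (- int k) * gamma_frac r) / gamma_frac (q - j) =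
      (?P powi (- (- int (d * j div q) - 1)) * ?P powi (- int k)) *
        (gamma_frac (q - m) / gamma_frac (q - j)) * gamma_frac r"
      by (simp only: divide_inverse mult_ac)
    also have "gamma_frac (q - m) / gamma_frac (q - j) = (gamma_frac j / gamma_frac m :: 'p padic)"
      using g1 nz by (simp add: field_simps)
    also have "(?P powi (- (- int (d * j div q) - 1)) * ?P powi (- int k)) *
      (gamma_frac j / gamma_frac m) * gamma_frac r =
      ?P * ((?P ^ ((j + r) div q) * gamma_frac j * gamma_frac r) / gamma_frac m)"
      unfolding pow by (simp only: divide_inverse mult_ac)
    also have "(?P ^ ((j + r) div q) * gamma_frac j * gamma_frac r) / gamma_frac m =
      - jacobi_sum TYPE('p) j r"
      using JG nz[of m] by (simp add: field_simps)
    finally show ?thesis unfolding r2 r1 J by simp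
  next
    case True
    then have dvd: "q dvd d * j" by (simp add: m_def dvd_eq_mod_eq_0)
    have "q dvd j + r" using jr True by (simp add: dvd_eq_mod_eq_0)
    then obtain e where e: "j + r = q * e" ..
    have "e = 1"
    proof (rule ccontr)
      assume "e \<noteq> 1"
      then consider "e = 0" | "e \<ge> 2" by linarith
      then show False
      proof cases
        case 2
        then have "q * 2 \<le> q * e" by (intro mult_le_mono2)
        then show False using e j r by linarith
      qed (use e j in simp)
    qed
    then have rj: "r = q - j" "(j + r) div q = 1" using e q0 by simp_all
    have neg: "int d * - int j = int q * - int (d * j div q)"
    proof -
      have "int (d * j) = int q * int (d * j div q)" using dvd by (simp flip: of_nat_mult)
      then show ?thesis by simp
    qed
    have r1: "nat ((int d * - int j) mod int q) = 0" "(int d * - int j) div int q = - int (d * j div q)"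
    proof -
      have iq: "int q \<noteq> 0" using q0 by simp
      show "nat ((int d * - int j) mod int q) = 0" unfolding neg by simp
      show "(int d * - int j) div int q = - int (d * j div q)"
        unfolding neg by (rule nonzero_mult_div_cancel_left[OF iq])
    qed
    have "even (d * j)" using dvd qe by (rule dvd_trans[rotated])
    then have "even j" using d by simp
    then have Jv: "jacobi_sum TYPE('p) j r = - 1"
      using jacobi_sum_reflect[OF odd j(1) j(2)[unfolded q_def]] unfolding rj q_def[symmetric] by simp
    have pow: "?P powi (- (- int (d * j div q))) * ?P powi (- int k) = ?P"
      unfolding jk rj(2) by (subst power_int_add[symmetric]) (use P0 in simp_all)
    have "?P powi (- (- int (d * j div q))) * gamma_frac 0 * (?P powi (- int k) * gamma_frac r) /
      gamma_frac (q - j) =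
      (?P powi (- (- int (d * j div q))) * ?P powi (- int k)) *
        (gamma_frac 0 * (gamma_frac r / gamma_frac (q - j)))"
      by (simp only: divide_inverse mult_ac)
    also have "\<dots> = ?P" unfolding pow unfolding rj(1) using nz[of "q - j"] gamma_frac_0[OF odd] by simp
    finally show ?thesis unfolding r2 r1 J Jv by simp
  qed
qed

lemma teichmuller_power_negative:
  fixes x :: "'p mod_ring"
  assumes "x \<noteq> 0"
  shows "to_fract (teichmuller x) ^ nat ((- int n) mod int (CARD('p) - 1)) = teichmuller_bar_pow n x"
proof -
  let ?q = "CARD('p) - 1" let ?w = "to_fract (teichmuller x)" and ?r =
    "nat ((- int n) mod int (CARD('p) - 1))"
  have q0: "?q > 0" using CARD_prime_gt_1[where 'p='p] by simp
  then have r: "int ?r = (- int n) mod int ?q" by simp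
  have "int ?q dvd (- int n) mod int ?q - (- int n)"
    by (rule iffD1[OF mod_eq_dvd_iff]) (rule mod_mod_trivial)
  then have "int ?q dvd int (?r + n)" unfolding of_nat_add r by simp
  then obtain c where c: "?r + n = ?q * c" unfolding of_nat_dvd_iff by (elim dvdE)
  have "?w ^ ?r * ?w ^ n = (?w ^ ?q) ^ c" by (simp only: power_add[symmetric] c power_mult)
  then have "?w ^ ?r * ?w ^ n = 1" using to_fract_teichmuller_power[OF assms] by simp
  then have "?w ^ ?r = inverse (?w ^ n)" by (metis inverse_unique mult.commute)
  then show ?thesis using assms by (simp add: teichmuller_bar_pow_altdef power_inverse)
qed

lemma teichmuller_power_cancel:
  fixes x :: "'p mod_ring"
  assumes "x \<noteq> 0"
  shows "teichmuller_bar_pow n x * to_fract (teichmuller x) ^ nat (int n mod int (CARD('p) - 1)) = 1"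
proof -
  have "nat (int n mod int (CARD('p) - 1)) = n mod (CARD('p) - 1)"
    by (simp only: zmod_int[symmetric] nat_int)
  then show ?thesis
    using to_fract_teichmuller_nonzero[OF assms] assms
    by (simp only: teichmuller_bar_pow_mod[of n x, symmetric])
      (simp add: teichmuller_bar_pow_altdef power_inverse)
qed

end

theorem corollary1p5:
  fixes d :: nat and lam \<alpha> :: "'p::prime_card mod_ring" and S :: "'p padic"
  assumes "d \<ge> 3" and "odd d"
    and "odd CARD('p)" and "\<not> CARD('p) dvd d * (d - 1)"
    and "lam \<noteq> 0"
    and "\<alpha> = lam ^ d * of_nat (d - 1) ^ (d - 1)"
    and "S = (\<Sum>t\<in>UNIV. of_int (quadratic_char (t * (t - 1))) *
           padic_G
             (map (\<lambda>h. of_nat h / of_nat d) [1..<d])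
             (map (\<lambda>h. of_nat h / of_nat (d - 1)) (filter (\<lambda>h. h \<noteq> (d - 1) div 2) [1..<d - 1])
                @ [0, 0])
             (\<alpha> * t))"
  shows "of_nat CARD('p) * of_nat (num_points_Z d lam) = of_nat CARD('p) - 1 - S \<and>
         padic_cong S (of_nat CARD('p) - 1) CARD('p)"
proof -
  note d = assms(1,2) and odd = assms(3)
  let ?q = "CARD('p) - 1" and ?h = "(CARD('p) - 1) div 2" and ?n = "(d - 1) div 2"
  let ?p = "of_nat CARD('p) :: 'p padic" and ?Q = "of_nat (CARD('p) - 1) :: 'p padic"
  let ?J = "jacobi_sum TYPE('p)" and ?\<mu> = "of_nat d * lam"
  define as where "as = map (\<lambda>h. of_nat h / of_nat d :: rat) [1..<d]"
  define bs where "bs = map (\<lambda>h. of_nat h / of_nat (d - 1) :: rat) (filter (\<lambda>h. h \<noteq> ?n) [1..<d -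
    1]) @ [0, 0]"
  define C :: "nat \<Rightarrow> 'p padic" where
    "C = (\<lambda>j. prod_list (map (gamma_ratio (of_int (- int j) / of_nat ?q)) as) *
       prod_list (map (\<lambda>b. gamma_ratio (of_int (int j) / of_nat ?q) (frac (- b))) bs))"
  \<comment> \<open>The terms of \<open>- (p - 1) S\<close> and of \<open>p (p - 1) N\<close> agree
    except at \<open>j = 0\<close>, where the first is -1 and the second \<open>p (p - 2)\<close>.
    Their difference \<open>p (p - 2) + 1\<close> is \<open>(p - 1)^2\<close>, which becomes the
    \<open>p - 1\<close> of the theorem after division.\<close>
  define Z where "Z = (\<lambda>j. if j = 0 then - 1 else ?p * ?J j ((d - 1) * j))"
  have n: "?n > 0" "d - 1 = 2 * ?n" using d by auto
  have q0: "?q > 0" using CARD_prime_gt_1[where 'p='p] by simp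
  have q2: "?q = 2 * ?h" using even_CARD_minus_1[OF odd] by simp
  have h: "0 < ?h" "?h < ?q" using q0 q2 by linarith+
  have Q: "?p = ?Q + 1" using CARD_prime_gt_1[where 'p='p] by (simp add: of_nat_diff)
  have Q0: "?Q \<noteq> 0" unfolding of_nat_eq_0_iff using q0 by simp
  have pd: "\<not> CARD('p) dvd d" "\<not> CARD('p) dvd d - 1" using assms(4) by auto
  have d0: "of_nat d \<noteq> (0 :: 'p mod_ring)" "of_nat (d - 1) \<noteq> (0 :: 'p mod_ring)"
    using pd of_nat_0_mod_ring_dvd by blast+
  have \<mu>: "?\<mu> \<noteq> 0" using d0(1) assms(5) by simp
  have len_as: "length as = d - 1" by (simp add: as_def)
  have len_bs: "length bs = d - 1"
  proof -
    have "length (filter (\<lambda>h. h \<noteq> ?n) [1..<d - 1]) = card ({1..<d - 1} - {?n})"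
    proof -
      have "distinct (filter (\<lambda>h. h \<noteq> ?n) [1..<d - 1])" by simp
      from distinct_card[OF this] show ?thesis by (simp add: set_diff_eq)
    qed
    also have "\<dots> = card {1..<d - 1} - 1" using n by (intro card_Diff_singleton) auto
    finally show ?thesis using d(1) by (simp add: bs_def)
  qed
  have as: "0 \<le> a \<and> a < 1" if "a \<in> set as" for a
    using that by (auto simp: as_def)
  have summand: "teichmuller_bar_pow j \<alpha> * C j * ((- 1) ^ ?h * ?J (j + ?h) ?h) =
    teichmuller_bar_pow (d * j) ?\<mu> * Z j"
    if j: "j < ?q" for j
  proof -
    let ?u = "of_int (int j) / of_nat ?q :: rat" and ?v = "of_int (- int j) / of_nat ?q :: rat"
    let ?A = "(- ?p) powi (- ((int d * - int j) div int ?q)) *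
      gamma_frac (nat ((int d * - int j) mod int ?q))"
    let ?B = "(- ?p) powi (- ((int (d - 1) * int j) div int ?q)) *
      gamma_frac (nat ((int (d - 1) * int j) mod int ?q))"
    let ?wd = "to_fract (teichmuller (of_nat d :: 'p mod_ring)) ^ nat ((int d * - int j) mod int ?q)"
    let ?wD = "to_fract (teichmuller (of_nat (d - 1) :: 'p mod_ring)) ^ nat ((int (d - 1) *
      int j) mod int ?q)"
    let ?half = "gamma_ratio ?u (1 / 2) :: 'p padic"
    have nz: "gamma_ratio v c \<noteq> (0 :: 'p padic)" for v c by (rule gamma_ratio_nonzero[OF odd])
    \<comment> \<open>Both parameter lists are completed to full systems; the factors at 0 and
      \<open>1 / 2\<close> introduced here are divided out again in the formula for
      \<open>C j\<close>.\<close>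
    have up: "gamma_ratio ?v 0 * prod_list (map (gamma_ratio ?v) as) = ?A * ?wd"
      unfolding as_def using d(1) gamma_ratio_prod[OF odd pd(1), of "- int j"]
        by (subst prod_list_upper) simp_all
    have lo: "?half * prod_list (map (\<lambda>b. gamma_ratio ?u (frac (- b))) bs) =
      gamma_ratio ?u 0 * (?B * ?wD)"
      using prod_list_lower[OF n(1), of "gamma_ratio ?u :: rat \<Rightarrow> 'p padic"]
      unfolding bs_def n(2)[symmetric] gamma_ratio_prod[OF odd pd(2), of "int j"]
        by (simp only: mult.assoc)
    have "gamma_ratio ?v 0 * ?half * C j =
      (gamma_ratio ?v 0 * prod_list (map (gamma_ratio ?v) as)) *
        (?half * prod_list (map (\<lambda>b. gamma_ratio ?u (frac (- b))) bs))"
      unfolding C_def by (simp only: mult_ac)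
    also have "\<dots> = (?A * ?B) * (?wd * ?wD) * gamma_ratio ?u 0" unfolding up lo by (simp only: mult_ac)
    finally have C: "C j = (?A * ?B) * (?wd * ?wD) * gamma_ratio ?u 0 / (gamma_ratio ?v 0 * ?half)"
      using nz by (simp add: field_simps)
    \<comment> \<open>This fixes the normalisation of \<open>\<alpha>\<close>: the Teichmueller
      powers from the multiplication formula remove \<open>(d - 1)^(d-1)\<close> and supply
      \<open>d^d\<close>, which leaves \<open>(d lam)^d\<close> as in the point count.\<close>
    have w: "teichmuller_bar_pow j \<alpha> * (?wd * ?wD) = teichmuller_bar_pow (d * j) ?\<mu>"
    proof -
      have e1: "?wd = teichmuller_bar_pow (d * j) (of_nat d)"
        using teichmuller_power_negative[OF odd d0(1), of "d * j"] by simp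
      have e2: "teichmuller_bar_pow ((d - 1) * j) (of_nat (d - 1)) * ?wD = 1"
        using teichmuller_power_cancel[OF odd d0(2), of "(d - 1) * j"] by simp
      have e3: "teichmuller_bar_pow j \<alpha> = teichmuller_bar_pow (d * j) lam *
        teichmuller_bar_pow ((d - 1) * j) (of_nat (d - 1))"
        using d(1) unfolding assms(6) by (simp only: teichmuller_bar_pow_mult)
          (simp add: teichmuller_bar_pow_power mult.commute)
      have "teichmuller_bar_pow j \<alpha> * (?wd * ?wD) =
        teichmuller_bar_pow (d * j) lam * ?wd *
        (teichmuller_bar_pow ((d - 1) * j) (of_nat (d - 1)) * ?wD)"
        unfolding e3 by (simp only: mult_ac)
      also have "\<dots> = teichmuller_bar_pow (d * j) lam * teichmuller_bar_pow (d * j) (of_nat d)"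
        by (simp only: e1 e2 mult_1_right)
      also have "\<dots> = teichmuller_bar_pow (d * j) ?\<mu>"
        unfolding teichmuller_bar_pow_mult by (rule mult.commute)
      finally show ?thesis .
    qed
    have g0: "gamma_ratio ?u 0 = (gamma_frac j :: 'p padic)"
      using gamma_ratio_0[OF odd, of "int j"] j by simp
    have gh: "?half = (- ?p) powi (- int ((j + ?h) div ?q)) *
      (gamma_frac ((j + ?h) mod ?q) / gamma_frac ?h)"
      using gamma_ratio_half[OF odd, of j] by simp
    have main: "(?A * ?B) / gamma_ratio ?v 0 * ((- 1) ^ ?h * ?J (j + ?h) ?h * (gamma_frac j / ?half)) =
      Z j"
    proof (cases "j = 0")
      case True
      have "?J ?h ?h = - ((- 1) ^ ?h)"
      proof -
        have "?q - ?h = ?h" using q2 by linarith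
        then show ?thesis using jacobi_sum_reflect[OF odd h] by simp
      qed
      moreover have "?half = 1" unfolding gh using True h gamma_frac_nonzero[OF odd, of ?h] by simp
      moreover have "gamma_ratio ?v 0 = (1 :: 'p padic)"
        using gamma_ratio_0[OF odd, of 0] gamma_frac_0[OF odd] True by simp
      moreover have "(- 1) ^ ?h * (- 1) ^ ?h = (1 :: 'p padic)" by (simp flip: power_add)
      ultimately show ?thesis using True gamma_frac_0[OF odd] by (simp add: Z_def)
    next
      case False
      then have j0: "0 < j" by simp
      have "(- int j) mod int ?q = int (?q - j)" "(- int j) div int ?q = - 1"
      proof -
        have e: "- int j = int (?q - j) + int ?q * (- 1)" using j by simp
        have b: "0 \<le> int (?q - j)" "int (?q - j) < int ?q" "int ?q \<noteq> 0" using j j0 by simp_all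
        show "(- int j) mod int ?q = int (?q - j)" unfolding e mod_mult_self2
          by (rule mod_pos_pos_trivial[OF b(1,2)])
        show "(- int j) div int ?q = - 1" unfolding e div_mult_self2[OF b(3)]
          div_pos_pos_trivial[OF b(1,2)] by simp
      qed
      \<comment> \<open>The factor \<open>- p\<close>, due to the floor of
        \<open>- j / (p - 1)\<close> being -1, cancels against the value of
        \<open>jacobi_half_term\<close>.\<close>
      then have gv: "gamma_ratio ?v 0 = (- ?p * gamma_frac (?q - j))"
        using gamma_ratio_0[OF odd, of "- int j"] by simp
      have "(?A * ?B) / gamma_ratio ?v 0 * (- ?p) = ?A * ?B / gamma_frac (?q - j)"
        unfolding gv by (simp add: gamma_frac_nonzero[OF odd])
      also have "\<dots> = ?p * ?J j ((d - 1) * j)"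
        by (rule jacobi_term[OF odd d(2) j0 j])
      finally show ?thesis
        unfolding gh jacobi_half_term[OF odd j0 j] using False by (simp add: Z_def)
    qed
    have "teichmuller_bar_pow j \<alpha> * C j * ((- 1) ^ ?h * ?J (j + ?h) ?h) =
      (teichmuller_bar_pow j \<alpha> * (?wd * ?wD)) *
        ((?A * ?B) / gamma_ratio ?v 0 * ((- 1) ^ ?h * ?J (j + ?h) ?h * (gamma_frac j / ?half)))"
      unfolding C g0 by (simp only: divide_inverse inverse_mult_distrib mult_ac)
    then show ?thesis unfolding w main .
  qed
  have "S = (\<Sum>t\<in>UNIV. of_int (quadratic_char (t * (t - 1) :: 'p mod_ring)) * padic_G as bs (\<alpha> * t))"
    unfolding assms(7) as_def bs_def by (rule refl)
  also have "\<dots> = (\<Sum>t\<in>UNIV. \<Sum>j<?q. - 1 / ?Q * (teichmuller_bar_pow j \<alpha> * C j *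
    (of_int (quadratic_char (t * (t - 1) :: 'p mod_ring)) * teichmuller_bar_pow j t)))"
  proof (rule sum.cong[OF refl])
    fix t :: "'p mod_ring"
    have e: "(- 1) ^ (j * length as) = (1 :: 'p padic)" for j
    proof -
      have "even (j * length as)" unfolding len_as using d by simp
      then show ?thesis by simp
    qed
    have "padic_G as bs (\<alpha> * t) = - 1 / (?p - 1) *
      (\<Sum>j<?q. (- 1) ^ (j * length as) * teichmuller_bar_pow j (\<alpha> * t) * C j)"
      unfolding C_def by (rule padic_G_gamma_ratio[OF odd]) (use len_as len_bs as in simp_all)
    moreover have "?p - 1 = ?Q" unfolding Q by simp
    ultimately have "padic_G as bs (\<alpha> * t) = - 1 / ?Q * (\<Sum>j<?q. teichmuller_bar_pow j (\<alpha> * t) * C j)"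
      by (simp only: e mult_1_left)
    then show "of_int (quadratic_char (t * (t - 1))) * padic_G as bs (\<alpha> * t) =
      (\<Sum>j<?q. - 1 / ?Q * (teichmuller_bar_pow j \<alpha> * C j *
        (of_int (quadratic_char (t * (t - 1))) * teichmuller_bar_pow j t)))"
      by (simp only: sum_distrib_left teichmuller_bar_pow_mult mult_ac)
  qed
  also have "\<dots> = (\<Sum>j<?q. \<Sum>t\<in>UNIV. - 1 / ?Q * (teichmuller_bar_pow j \<alpha> * C j *
    (of_int (quadratic_char (t * (t - 1) :: 'p mod_ring)) * teichmuller_bar_pow j t)))"
    by (rule sum.swap)
  also have "\<dots> = - 1 / ?Q * (\<Sum>j<?q. teichmuller_bar_pow (d * j) ?\<mu> * Z j)"
    unfolding sum_distrib_left[symmetric] sum_quadratic_char_jacobi[OF odd]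
    by (intro arg_cong2[where f="(*)"] sum.cong refl summand) simp
  finally have S_eq: "S = - 1 / ?Q * (\<Sum>j<?q. teichmuller_bar_pow (d * j) ?\<mu> * Z j)" .
  have cancel: "- c * (- 1 / c * x) = x" if "c \<noteq> 0" for c x :: "'p padic"
    using that by simp
  have S: "- ?Q * S = (\<Sum>j<?q. teichmuller_bar_pow (d * j) ?\<mu> * Z j)"
    unfolding S_eq by (rule cancel[OF Q0])
  have split: "(\<Sum>j<?q. f j) = f 0 + (\<Sum>j\<in>{..<?q} - {0}. f j)" for f :: "nat \<Rightarrow> 'p padic"
    using q0 by (intro sum.remove) auto
  have t0: "teichmuller_bar_pow 0 ?\<mu> = 1" using \<mu> by (simp add: teichmuller_bar_pow_altdef)
  have J0: "?J 0 0 = ?Q - 1"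
    using jacobi_sum_gamma[OF odd q0 q0] gamma_frac_0[OF odd] q0 by simp
  let ?N = "of_nat (num_points_Z d lam) :: 'p padic"
  have N: "?Q * ?N = (\<Sum>j<?q. teichmuller_bar_pow (d * j) ?\<mu> * ?J j ((d - 1) * j))"
    using d(1) \<mu> by (intro num_points_Z_jacobi) simp_all
  let ?R = "\<Sum>j\<in>{..<?q} - {0}. teichmuller_bar_pow (d * j) ?\<mu> * (?p * ?J j ((d - 1) * j))"
  have "?p * (?Q * ?N) = ?p * (?Q - 1) + ?R"
    unfolding N split[of "\<lambda>j. teichmuller_bar_pow (d * j) ?\<mu> * ?J j ((d - 1) * j)"] distrib_left
      sum_distrib_left
    by (simp only: t0 J0 mult_0_right mult_1_left mult.left_commute)
  moreover have "- ?Q * S = - 1 + ?R"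
  proof -
    have "(\<Sum>j\<in>{..<?q} - {0}. teichmuller_bar_pow (d * j) ?\<mu> * Z j) = ?R"
      by (intro sum.cong refl) (simp add: Z_def)
    then show ?thesis unfolding S split[of "\<lambda>j. teichmuller_bar_pow (d * j) ?\<mu> * Z j"] mult_0_right t0
      by (simp add: Z_def)
  qed
  ultimately have "?Q * (?p * ?N) = ?p * (?Q - 1) + 1 - ?Q * S" by (simp add: algebra_simps)
  also have "\<dots> = ?Q * (?Q - S)" unfolding Q by (simp add: algebra_simps)
  finally have "?p * ?N = ?Q - S" using Q0 by (simp only: mult_left_cancel[OF Q0])
  then have main: "?p * ?N = ?p - 1 - S" unfolding Q by simp
  have "padic_cong S (?p - 1) CARD('p)"
    unfolding padic_cong_def
  proof (intro exI conjI)
    \<comment> \<open>The integrality of \<open>S\<close> is read off from the identity just proved: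
      \<open>S\<close> is the rational integer \<open>p - 1 - p N\<close>.\<close>
    let ?b = "of_nat CARD('p) - 1 :: 'p padic_int"
    let ?c = "of_nat CARD('p) * of_nat (num_points_Z d lam) :: 'p padic_int"
    show "S = padic_of_int (?b - ?c)"
      using main unfolding to_fract_def[symmetric] by (simp add: to_fract_of_nat)
    show "?p - 1 = padic_of_int ?b"
      unfolding to_fract_def[symmetric] by (simp add: to_fract_of_nat)
    show "of_nat CARD('p) dvd (?b - ?c) - ?b" by simp
  qed
  with main show ?thesis by simp
qed

end
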